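(* Let $\Omega\subset\mathbb{R}^d$ be a bounded open set and $f\in L^2(\Omega)$. For measurable $V:\Omega\to[0,+\infty]$ let $$\mathcal{E}_f(V)=\inf\left\{\int_\Omega\Big(\tfrac12|\nabla u|^2+\tfrac12V(x)u^2-f(x)u\Big)dx\ :\ u\in H^1_0(\Omega)\right\}.$$ Then there is a unique solution of the problem $$\min\left\{-\mathcal{E}_f(V)\ :\ V\ge0,\ \int_\Omega V\,dx\le1\right\},$$ given by $$V_1=\frac1M\left(\chi_{\omega_+}f-\chi_{\omega_-}f\right),$$ where $M=\|u_1\|_{L^\infty(\Omega)}$, $\omega_+=\{u_1=M\}$, $\omega_-=\{u_1=-M\}$, and $u_1\in H^1_0(\Omega)\cap L^\infty(\Omega)$ is the unique minimizer over $H^1_0(\Omega)$ of the functional $$J_1(u)=\frac12\int_\Omega|\nabla u|^2\,dx+\frac12\|u\|_{L^\infty(\Omega)}^2-\int_\Omega uf\,dx.$$ In particular, $\int_{\omega_+}f\,dx-\int_{\omega_-}f\,dx=M$, $f\ge0$ on $\omega_+$ and $f\le0$ on $\omega_-$.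
   Context: $\chi_U$ is the characteristic function of $U$. $J_1(u)=+\infty$ if $u\notin L^\infty(\Omega)$. Potentials are Lebesgue measurable functions; uniqueness and the sign conditions on $f$ are understood almost everywhere.
   Formalization: The claims about V_1 (formula, optimality, uniqueness) are stated for f not a.e. zero; if f = 0 a.e., then M = 0, 1/M is undefined and every admissible V is optimal, so uniqueness fails. *)

theory Defs
  imports "HOL-Analysis.Analysis" "HOL-Probability.Essential_Supremum"
begin

text \<open>
  Functions on an open set \<open>\<Omega>\<close> of a Euclidean space are represented by functions on the whole
  space, of which only the restriction to \<open>\<Omega>\<close> matters: measurability, integrals and ``almost
  everywhere'' always refer to \<^term>\<open>lebesgue_on \<Omega>\<close>.
\<close>

text \<open>For \<open>f\<close> differentiable at \<open>x\<close>, the derivative in the direction \<open>i\<close>.\<close>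

definition partial :: "'a::euclidean_space \<Rightarrow> ('a \<Rightarrow> real) \<Rightarrow> 'a \<Rightarrow> real" where
  "partial i f x = frechet_derivative f (at x) i"

fun continuously_diff :: "nat \<Rightarrow> ('a::euclidean_space \<Rightarrow> real) \<Rightarrow> bool" where
  "continuously_diff 0 f \<longleftrightarrow> continuous_on UNIV f"
| "continuously_diff (Suc k) f \<longleftrightarrow>
     f differentiable_on UNIV \<and> (\<forall>i\<in>Basis. continuously_diff k (partial i f))"

text \<open>The space of smooth functions with compact support contained in \<open>\<Omega>\<close>.\<close>

definition test_functions :: "'a::euclidean_space set \<Rightarrow> ('a \<Rightarrow> real) set" where
  "test_functions \<Omega> =
     {\<phi>. (\<forall>k. continuously_diff k \<phi>) \<and> compact (closure {x. \<phi> x \<noteq> 0}) \<and> closure {x. \<phi> x \<noteq> 0} \<subseteq> \<Omega>}"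

definition L2 :: "'a::euclidean_space set \<Rightarrow> ('a \<Rightarrow> 'b::euclidean_space) set" where
  "L2 \<Omega> = {u. u \<in> borel_measurable (lebesgue_on \<Omega>) \<and>
               integrable (lebesgue_on \<Omega>) (\<lambda>x. (norm (u x))\<^sup>2)}"

text \<open>The essential supremum of the absolute value, possibly infinite.\<close>

definition Linf_norm :: "'a::euclidean_space set \<Rightarrow> ('a \<Rightarrow> real) \<Rightarrow> ennreal" where
  "Linf_norm \<Omega> u = esssup (lebesgue_on \<Omega>) (\<lambda>x. ennreal \<bar>u x\<bar>)"

definition Linf :: "'a::euclidean_space set \<Rightarrow> ('a \<Rightarrow> real) set" where
  "Linf \<Omega> = {u. u \<in> borel_measurable (lebesgue_on \<Omega>) \<and> Linf_norm \<Omega> u < \<infinity>}"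

definition has_weak_gradient ::
  "'a::euclidean_space set \<Rightarrow> ('a \<Rightarrow> real) \<Rightarrow> ('a \<Rightarrow> 'a) \<Rightarrow> bool" where
  "has_weak_gradient \<Omega> u g \<longleftrightarrow>
     (\<forall>\<phi>\<in>test_functions \<Omega>. \<forall>i\<in>Basis.
        (LINT x|lebesgue_on \<Omega>. u x * partial i \<phi> x) = - (LINT x|lebesgue_on \<Omega>. (g x \<bullet> i) * \<phi> x))"

definition H1 :: "'a::euclidean_space set \<Rightarrow> ('a \<Rightarrow> real) set" where
  "H1 \<Omega> = {u \<in> L2 \<Omega>. \<exists>g\<in>L2 \<Omega>. has_weak_gradient \<Omega> u g}"

text \<open>A representative of the weak gradient, which is determined only almost everywhere on \<open>\<Omega>\<close>.\<close>

definition weak_grad :: "'a::euclidean_space set \<Rightarrow> ('a \<Rightarrow> real) \<Rightarrow> 'a \<Rightarrow> 'a" where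
  "weak_grad \<Omega> u = (SOME g. g \<in> L2 \<Omega> \<and> has_weak_gradient \<Omega> u g)"

definition H1_norm :: "'a::euclidean_space set \<Rightarrow> ('a \<Rightarrow> real) \<Rightarrow> real" where
  "H1_norm \<Omega> u =
     sqrt ((LINT x|lebesgue_on \<Omega>. (u x)\<^sup>2) + (LINT x|lebesgue_on \<Omega>. (norm (weak_grad \<Omega> u x))\<^sup>2))"

text \<open>The closure of the test functions in \<^term>\<open>H1 \<Omega>\<close>.\<close>

definition H10 :: "'a::euclidean_space set \<Rightarrow> ('a \<Rightarrow> real) set" where
  "H10 \<Omega> = {u \<in> H1 \<Omega>. \<forall>\<epsilon>>0. \<exists>\<phi>\<in>test_functions \<Omega>. H1_norm \<Omega> (\<lambda>x. u x - \<phi> x) < \<epsilon>}"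

text \<open>
  The integral of \<open>|\<nabla>u|\<^sup>2/2 + V u\<^sup>2/2 - f u\<close> as an extended real: the first and last terms are
  integrable for \<open>u\<close> in \<^term>\<open>H1 \<Omega>\<close> and \<open>f\<close> in \<^term>\<open>L2 \<Omega>\<close>, while the nonnegative term with \<open>V\<close> may
  have an infinite integral. The potential may take the value \<open>\<infinity>\<close>, and \<open>\<infinity> * 0 = 0\<close>.
\<close>

definition energy_functional ::
  "'a::euclidean_space set \<Rightarrow> ('a \<Rightarrow> real) \<Rightarrow> ('a \<Rightarrow> ennreal) \<Rightarrow> ('a \<Rightarrow> real) \<Rightarrow> ereal" where
  "energy_functional \<Omega> f V u =
     ereal (LINT x|lebesgue_on \<Omega>. (norm (weak_grad \<Omega> u x))\<^sup>2 / 2 - f x * u x) +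
     enn2ereal (\<integral>\<^sup>+x. V x * ennreal ((u x)\<^sup>2) / 2 \<partial>lebesgue_on \<Omega>)"

definition energy ::
  "'a::euclidean_space set \<Rightarrow> ('a \<Rightarrow> real) \<Rightarrow> ('a \<Rightarrow> ennreal) \<Rightarrow> ereal" where
  "energy \<Omega> f V = (INF u\<in>H10 \<Omega>. energy_functional \<Omega> f V u)"

definition admissible :: "'a::euclidean_space set \<Rightarrow> ('a \<Rightarrow> ennreal) \<Rightarrow> bool" where
  "admissible \<Omega> V \<longleftrightarrow>
     V \<in> borel_measurable (lebesgue_on \<Omega>) \<and> (\<integral>\<^sup>+x. V x \<partial>lebesgue_on \<Omega>) \<le> 1"

text \<open>For \<open>u\<close> in \<^term>\<open>H1 \<Omega>\<close> but not in \<^term>\<open>Linf \<Omega>\<close> the value is \<open>\<infinity>\<close>.\<close>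

definition J1 :: "'a::euclidean_space set \<Rightarrow> ('a \<Rightarrow> real) \<Rightarrow> ('a \<Rightarrow> real) \<Rightarrow> ereal" where
  "J1 \<Omega> f u =
     ereal (1 / 2 * (LINT x|lebesgue_on \<Omega>. (norm (weak_grad \<Omega> u x))\<^sup>2)) +
     enn2ereal ((Linf_norm \<Omega> u)\<^sup>2 / 2) - ereal (LINT x|lebesgue_on \<Omega>. u x * f x)"

end

theory Submission
  imports Defs "HOL-Real_Asymp.Real_Asymp"
begin

text \<open>
  Let \<open>u\<close> be the minimizer of \<open>J\<^sub>1\<close>, \<open>M\<close> its supremum norm, and \<open>V\<close> an admissible potential;
  \<open>M\<close> is positive unless \<open>f\<close> vanishes (\<open>source_trivial\<close>), and is assumed so here. Since
  \<open>\<integral>V u\<^sup>2 \<le> M\<^sup>2\<close>, testing the energy with \<open>u\<close> gives \<open>\<E>\<^sub>f(V) \<le> J\<^sub>1(u)\<close>. Equality holds if and only if \<open>V\<close> has mass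
  one, is concentrated on the contact set \<open>{\<bar>u\<bar> = M}\<close>, and \<open>u\<close> minimizes the energy of \<open>V\<close>, that is,
  \<open>-\<Delta>u + V u = f\<close>. Hence an optimal \<open>V\<close> is determined by \<open>V u = f + \<Delta>u\<close>, and it is the potential of the
  theorem provided that \<open>-\<Delta>u\<close> equals \<open>f\<close> where \<open>\<bar>u\<bar> < M\<close> and vanishes on the contact set
  (\<open>Euler_Lagrange\<close>). The mass of this potential is one because \<open>J\<^sub>1\<close> is stationary along the ray
  through \<open>u\<close>, which means \<open>\<integral>\<bar>\<nabla>u\<bar>\<^sup>2 + M\<^sup>2 = \<integral>f u\<close> (\<open>scaling_identity\<close>). These conclusions are drawn in
  \<open>optimal_potential\<close>.

  The equation for \<open>u\<close> comes from the variational inequality expressing that \<open>u\<close> minimizes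
  \<open>\<integral>(\<bar>\<nabla>v\<bar>\<^sup>2/2 - f v)\<close> among the functions with \<open>\<bar>v\<bar> \<le> M\<close>, in three steps.

  \<^item> \<open>\<Delta>u\<close> is square-integrable (\<open>source_bound\<close>). The function \<open>v = (1 - l \<Delta>)\<^sup>-\<^sup>1 u\<close> satisfies \<open>\<bar>v\<bar> \<le> M\<close> by the
    maximum principle, and the variational inequality, tested with \<open>v\<close>, yields \<open>\<parallel>\<Delta>v\<parallel> \<le> \<parallel>f\<parallel>\<close>; then \<open>l\<close> tends
    to zero.
  \<^item> Testing with \<open>u + \<zeta> (\<plusminus>M - u)\<close> shows that \<open>-\<Delta>u = f\<close> where \<open>\<bar>u\<bar> < M\<close> and gives the signs of
    \<open>f + \<Delta>u\<close> on the two parts of the contact set (\<open>source_sign\<close>).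
  \<^item> \<open>\<Delta>u = 0\<close> almost everywhere on every level set of \<open>u\<close> (\<open>source_zero_on_level_set\<close>). After localization
    \<open>u\<close> vanishes on the level set. Its second difference quotients are bounded in \<open>L\<^sup>2\<close> by the norm of
    the Laplacian and converge weakly to it; they are zero at the points of a set \<open>A\<close> of zeros whose
    translates stay in \<open>A\<close>, which are almost all of \<open>A\<close> as the step tends to zero.

  Existence and uniqueness of \<open>u\<close> follow from uniform convexity: minimizing sequences are Cauchy
  sequences by the parallelogram identity and the Poincare inequality (\<open>exists_minimizer\<close>,
  \<open>minimizer_unique\<close>). The Riesz representation theorem, used for the resolvent and for \<open>\<Delta>u\<close>, is proved in
  the same way.
\<close>

section \<open>Square-integrable functions\<close>

definition sq_int :: "'a measure \<Rightarrow> ('a \<Rightarrow> 'b::euclidean_space) \<Rightarrow> bool" where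
  "sq_int M u \<longleftrightarrow> u \<in> borel_measurable M \<and> integrable M (\<lambda>x. (norm (u x))\<^sup>2)"

definition ip :: "'a measure \<Rightarrow> ('a \<Rightarrow> 'b::euclidean_space) \<Rightarrow> ('a \<Rightarrow> 'b) \<Rightarrow> real" where
  "ip M u v = (LINT x|M. u x \<bullet> v x)"

definition nrm :: "'a measure \<Rightarrow> ('a \<Rightarrow> 'b::euclidean_space) \<Rightarrow> real" where
  "nrm M u = sqrt (LINT x|M. (norm (u x))\<^sup>2)"

lemma sq_int_measurable [measurable_dest]: "sq_int M u \<Longrightarrow> u \<in> borel_measurable M"
  by (simp add: sq_int_def)

lemma sq_int_integrable: "sq_int M u \<Longrightarrow> integrable M (\<lambda>x. (norm (u x))\<^sup>2)"
  by (simp add: sq_int_def)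

lemma sq_int_dominated:
  assumes u: "u \<in> borel_measurable M" and g: "integrable M g"
    and le: "AE x in M. (norm (u x))\<^sup>2 \<le> g x"
  shows "sq_int M u"
  unfolding sq_int_def
proof
  show "integrable M (\<lambda>x. (norm (u x))\<^sup>2)"
    by (rule Bochner_Integration.integrable_bound[OF g]) (use u le in \<open>auto elim!: eventually_mono\<close>)
qed (rule u)

lemma norm_add_sq_le: "(norm (a + b :: 'b::euclidean_space))\<^sup>2 \<le> 2 * (norm a)\<^sup>2 + 2 * (norm b)\<^sup>2"
proof -
  have "(norm (a + b))\<^sup>2 \<le> (norm a + norm b)\<^sup>2"
    by (simp add: norm_triangle_ineq power_mono)
  also have "\<dots> \<le> 2 * (norm a)\<^sup>2 + 2 * (norm b)\<^sup>2"
    using sum_squares_bound[of "norm a" "norm b"] by (simp add: power2_sum)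
  finally show ?thesis .
qed

lemma sq_int_add [intro]:
  assumes u: "sq_int M u" and v: "sq_int M v" shows "sq_int M (\<lambda>x. u x + v x)"
proof (rule sq_int_dominated)
  show "integrable M (\<lambda>x. 2 * (norm (u x))\<^sup>2 + 2 * (norm (v x))\<^sup>2)"
    using sq_int_integrable[OF u] sq_int_integrable[OF v] by simp
qed (use u v in \<open>auto simp: norm_add_sq_le sq_int_measurable intro!: borel_measurable_add\<close>)

lemma sq_int_scale [intro]:
  assumes u: "sq_int M u" shows "sq_int M (\<lambda>x. c *\<^sub>R u x)"
proof (rule sq_int_dominated)
  show "integrable M (\<lambda>x. c\<^sup>2 * (norm (u x))\<^sup>2)"
    using sq_int_integrable[OF u] by simp
qed (use u in \<open>auto simp: power_mult_distrib sq_int_measurable\<close>)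

lemma sq_int_cmult [intro]: "sq_int M u \<Longrightarrow> sq_int M (\<lambda>x. c * u x)" for u :: "'a \<Rightarrow> real"
  using sq_int_scale[of M u c] by simp

lemma sq_int_minus [intro]: "sq_int M u \<Longrightarrow> sq_int M (\<lambda>x. - u x)"
  using sq_int_scale[of M u "-1"] by simp

lemma sq_int_diff [intro]:
  assumes u: "sq_int M u" and v: "sq_int M v" shows "sq_int M (\<lambda>x. u x - v x)"
  using sq_int_add[OF u sq_int_scale[OF v, of "-1"]] by simp

lemma sq_int_zero [intro, simp]: "sq_int M (\<lambda>x. 0)"
  by (simp add: sq_int_def)

lemma sq_int_sum [intro]:
  "(\<And>i. i \<in> I \<Longrightarrow> sq_int M (u i)) \<Longrightarrow> sq_int M (\<lambda>x. \<Sum>i\<in>I. u i x)"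
  by (induction I rule: infinite_finite_induct) auto

lemma sq_int_norm_le:
  assumes v: "sq_int M v" and u: "u \<in> borel_measurable M"
    and le: "AE x in M. norm (u x) \<le> c * norm (v x)"
  shows "sq_int M u"
proof (rule sq_int_dominated[OF u])
  show "integrable M (\<lambda>x. c\<^sup>2 * (norm (v x))\<^sup>2)"
    using sq_int_integrable[OF v] by simp
  show "AE x in M. (norm (u x))\<^sup>2 \<le> c\<^sup>2 * (norm (v x))\<^sup>2"
    using le by eventually_elim (metis norm_ge_zero power_mono power_mult_distrib)
qed

lemma norm_fst_le': "norm (fst p) \<le> norm p"
  by (metis norm_fst_le prod.collapse)

lemma norm_snd_le': "norm (snd p) \<le> norm p"
  by (metis norm_snd_le prod.collapse)

lemma sq_int_fst [intro]: assumes "sq_int M U" shows "sq_int M (\<lambda>x. fst (U x))"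
proof (rule sq_int_norm_le[where c=1, OF assms])
  have [measurable]: "U \<in> borel_measurable M" using assms by (rule sq_int_measurable)
  show "(\<lambda>x. fst (U x)) \<in> borel_measurable M"
    by (rule borel_measurable_continuous_on[of fst]) (auto intro: continuous_on_fst continuous_on_id)
qed (simp add: norm_fst_le')

lemma sq_int_snd [intro]: assumes "sq_int M U" shows "sq_int M (\<lambda>x. snd (U x))"
proof (rule sq_int_norm_le[where c=1, OF assms])
  have [measurable]: "U \<in> borel_measurable M" using assms by (rule sq_int_measurable)
  show "(\<lambda>x. snd (U x)) \<in> borel_measurable M"
    by (rule borel_measurable_continuous_on[of snd]) (auto intro: continuous_on_snd continuous_on_id)
qed (simp add: norm_snd_le')

lemma sq_int_Pair [intro]:
  assumes u: "sq_int M u" and v: "sq_int M v" shows "sq_int M (\<lambda>x. (u x, v x))"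
  unfolding sq_int_def
proof
  show "(\<lambda>x. (u x, v x)) \<in> borel_measurable M"
    using sq_int_measurable[OF u] sq_int_measurable[OF v] by (rule borel_measurable_Pair)
  show "integrable M (\<lambda>x. (norm (u x, v x))\<^sup>2)"
    using sq_int_integrable[OF u] sq_int_integrable[OF v] by (simp add: norm_Pair)
qed

lemma sq_int_inner_const [intro]:
  assumes "sq_int M u" shows "sq_int M (\<lambda>x. u x \<bullet> b)"
proof (rule sq_int_norm_le[where c="norm b", OF assms])
  show "(\<lambda>x. u x \<bullet> b) \<in> borel_measurable M"
    using sq_int_measurable[OF assms] by measurable
qed (simp add: Cauchy_Schwarz_ineq2 mult.commute[of "norm b"])

lemma sq_int_bounded_mult:
  fixes u :: "'a \<Rightarrow> 'b::euclidean_space"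
  assumes "sq_int M u" and [measurable]: "z \<in> borel_measurable M" and "AE x in M. \<bar>z x\<bar> \<le> B"
  shows "sq_int M (\<lambda>x. z x *\<^sub>R u x)"
proof (rule sq_int_norm_le[where c="B", OF assms(1)])
  have [measurable]: "u \<in> borel_measurable M" using assms(1) by (rule sq_int_measurable)
  show "(\<lambda>x. z x *\<^sub>R u x) \<in> borel_measurable M" by measurable
qed (use assms(3) in \<open>auto elim!: eventually_mono intro: mult_right_mono\<close>)

lemma integrable_inner:
  assumes u: "sq_int M u" and v: "sq_int M v" shows "integrable M (\<lambda>x. u x \<bullet> v x)"
proof (rule Bochner_Integration.integrable_bound)
  show "integrable M (\<lambda>x. (norm (u x))\<^sup>2 + (norm (v x))\<^sup>2)"
    using sq_int_integrable[OF u] sq_int_integrable[OF v] by simp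
  show "(\<lambda>x. u x \<bullet> v x) \<in> borel_measurable M"
    using sq_int_measurable[OF u] sq_int_measurable[OF v] by measurable
  have "\<bar>u x \<bullet> v x\<bar> \<le> (norm (u x))\<^sup>2 + (norm (v x))\<^sup>2" for x
  proof -
    have "\<bar>u x \<bullet> v x\<bar> \<le> norm (u x) * norm (v x)" by (rule Cauchy_Schwarz_ineq2)
    moreover have "2 * (norm (u x) * norm (v x)) \<le> (norm (u x))\<^sup>2 + (norm (v x))\<^sup>2"
      using sum_squares_bound[of "norm (u x)" "norm (v x)"] by simp
    moreover have "0 \<le> norm (u x) * norm (v x)" by simp
    ultimately show ?thesis by linarith
  qed
  then show "AE x in M. norm (u x \<bullet> v x) \<le> norm ((norm (u x))\<^sup>2 + (norm (v x))\<^sup>2)"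
    by auto
qed

lemma integrable_mult_sq:
  fixes u v :: "'a \<Rightarrow> real"
  assumes "sq_int M u" "sq_int M v" shows "integrable M (\<lambda>x. u x * v x)"
  using integrable_inner[OF assms] by simp

lemma ip_commute: "ip M u v = ip M v u"
  by (simp add: ip_def inner_commute)

lemma ip_add_left:
  assumes "sq_int M u" "sq_int M v" "sq_int M w"
  shows "ip M (\<lambda>x. u x + v x) w = ip M u w + ip M v w"
  using integrable_inner[OF assms(1,3)] integrable_inner[OF assms(2,3)]
  by (simp add: ip_def inner_add_left)

lemma ip_diff_left:
  assumes "sq_int M u" "sq_int M v" "sq_int M w"
  shows "ip M (\<lambda>x. u x - v x) w = ip M u w - ip M v w"
  using integrable_inner[OF assms(1,3)] integrable_inner[OF assms(2,3)]
  by (simp add: ip_def inner_diff_left)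

lemma ip_scale_left [simp]: "ip M (\<lambda>x. c *\<^sub>R u x) w = c * ip M u w"
  by (simp add: ip_def)

lemma ip_scale_right [simp]: "ip M u (\<lambda>x. c *\<^sub>R w x) = c * ip M u w"
  by (simp add: ip_def)

lemma ip_cmult_left [simp]: "ip M (\<lambda>x. c * u x) w = c * ip M u w"
  using ip_scale_left[of M c u w] by simp

lemma ip_cmult_right [simp]: "ip M u (\<lambda>x. c * w x) = c * ip M u w"
  using ip_scale_right[of M u c w] by simp

lemma ip_minus_left [simp]: "ip M (\<lambda>x. - u x) w = - ip M u w"
  using ip_scale_left[of M "-1" u w] by simp

lemma ip_add_right:
  assumes "sq_int M u" "sq_int M v" "sq_int M w"
  shows "ip M w (\<lambda>x. u x + v x) = ip M w u + ip M w v"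
  using ip_add_left[OF assms] by (simp add: ip_commute)

lemma ip_diff_right:
  assumes "sq_int M u" "sq_int M v" "sq_int M w"
  shows "ip M w (\<lambda>x. u x - v x) = ip M w u - ip M w v"
  using ip_diff_left[OF assms] by (simp add: ip_commute)

lemma nrm_nonneg [simp]: "0 \<le> nrm M u"
  by (simp add: nrm_def)

lemma nrm_sq: "(nrm M u)\<^sup>2 = ip M u u"
  by (simp add: nrm_def ip_def power2_norm_eq_inner)

lemma ip_self_nonneg [simp]: "0 \<le> ip M u u"
  by (metis nrm_sq zero_le_power2)

lemma nrm_sq_integral: "(nrm M u)\<^sup>2 = (LINT x|M. (norm (u x))\<^sup>2)"
  by (simp add: nrm_def)

lemma ip_add_self:
  assumes u: "sq_int M u" and v: "sq_int M v"
  shows "ip M (\<lambda>x. u x + t *\<^sub>R v x) (\<lambda>x. u x + t *\<^sub>R v x) = ip M u u + 2 * t * ip M u v + t\<^sup>2 * ip M v v"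
proof -
  have tv: "sq_int M (\<lambda>x. t *\<^sub>R v x)" using v by auto
  have uv: "sq_int M (\<lambda>x. u x + t *\<^sub>R v x)" using u tv by auto
  show ?thesis
    using ip_add_left[OF u tv uv] ip_add_right[OF u tv u] ip_add_right[OF u tv v]
    by (simp add: ip_commute[of M v u] power2_eq_square algebra_simps)
qed

lemma ip_diff_self:
  assumes u: "sq_int M u" and v: "sq_int M v"
  shows "ip M (\<lambda>x. u x - v x) (\<lambda>x. u x - v x) = ip M u u - 2 * ip M u v + ip M v v"
  using ip_add_self[OF assms, of "-1"] by simp

text \<open>
  A quadratic polynomial in \<open>t\<close> that is nonnegative everywhere has a nonpositive discriminant. With
  \<open>a = 0\<close> this says that the linear coefficient vanishes, which is how every first-order
  optimality condition below is extracted.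
\<close>

lemma quadratic_nonneg_discriminant:
  fixes a b c :: real
  assumes "\<And>t. 0 \<le> a + 2 * t * b + t\<^sup>2 * c" "0 \<le> c" "0 \<le> a"
  shows "b\<^sup>2 \<le> a * c"
proof (cases "c = 0")
  case True
  have "b = 0"
  proof (rule ccontr)
    assume "b \<noteq> 0"
    with assms(1)[of "- (a + 1) / (2 * b)"] True show False by (simp add: field_simps)
  qed
  with True show ?thesis by simp
next
  case False
  with assms(2) have c: "c > 0" by simp
  have "0 \<le> a + 2 * (- b / c) * b + (- b / c)\<^sup>2 * c" by (rule assms(1))
  also have "\<dots> = a - b\<^sup>2 / c" using c by (simp add: power2_eq_square field_simps)
  finally show ?thesis using c by (simp add: field_simps)
qed

lemma ip_Cauchy_Schwarz:
  assumes u: "sq_int M u" and v: "sq_int M v"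
  shows "\<bar>ip M u v\<bar> \<le> nrm M u * nrm M v"
proof -
  have "(ip M u v)\<^sup>2 \<le> ip M u u * ip M v v"
  proof (rule quadratic_nonneg_discriminant)
    show "0 \<le> ip M u u + 2 * t * ip M u v + t\<^sup>2 * ip M v v" for t
      by (metis ip_add_self[OF u v] ip_self_nonneg)
  qed auto
  then have "(ip M u v)\<^sup>2 \<le> (nrm M u * nrm M v)\<^sup>2"
    by (simp add: power_mult_distrib nrm_sq)
  then show ?thesis
    by (metis abs_le_square_iff abs_of_nonneg mult_nonneg_nonneg nrm_nonneg)
qed

lemma nrm_triangle:
  assumes u: "sq_int M u" and v: "sq_int M v"
  shows "nrm M (\<lambda>x. u x + v x) \<le> nrm M u + nrm M v"
proof (rule power2_le_imp_le)
  have "(nrm M (\<lambda>x. u x + v x))\<^sup>2 = ip M u u + 2 * ip M u v + ip M v v"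
    using ip_add_self[OF u v, of 1] by (simp add: nrm_sq)
  also have "\<dots> \<le> (nrm M u + nrm M v)\<^sup>2"
    using ip_Cauchy_Schwarz[OF u v] by (simp add: power2_sum nrm_sq)
  finally show "(nrm M (\<lambda>x. u x + v x))\<^sup>2 \<le> (nrm M u + nrm M v)\<^sup>2" .
qed simp

lemma nrm_scale [simp]: "nrm M (\<lambda>x. c *\<^sub>R u x) = \<bar>c\<bar> * nrm M u"
  by (simp add: nrm_def power_mult_distrib real_sqrt_mult)

lemma nrm_cmult [simp]: "nrm M (\<lambda>x. c * u x) = \<bar>c\<bar> * nrm M u" for u :: "'a \<Rightarrow> real"
  using nrm_scale[of M c u] by simp

lemma nrm_minus [simp]: "nrm M (\<lambda>x. - u x) = nrm M u"
  using nrm_scale[of M "-1" u] by simp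

lemma nrm_diff_commute: "nrm M (\<lambda>x. u x - v x) = nrm M (\<lambda>x. v x - u x)"
  using nrm_minus[of M "\<lambda>x. u x - v x"] by simp

lemma nrm_zero [simp]: "nrm M (\<lambda>x. 0) = 0"
  by (simp add: nrm_def)

lemma nrm_diff_triangle:
  assumes "sq_int M u" "sq_int M v" "sq_int M w"
  shows "nrm M (\<lambda>x. u x - w x) \<le> nrm M (\<lambda>x. u x - v x) + nrm M (\<lambda>x. v x - w x)"
  using nrm_triangle[of M "\<lambda>x. u x - v x" "\<lambda>x. v x - w x"] assms by auto

lemma nrm_mono:
  assumes v: "sq_int M v" and u: "u \<in> borel_measurable M"
    and le: "AE x in M. norm (u x) \<le> c * norm (v x)" and c: "0 \<le> c"
  shows "nrm M u \<le> c * nrm M v"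
proof -
  have "(LINT x|M. (norm (u x))\<^sup>2) \<le> (LINT x|M. c\<^sup>2 * (norm (v x))\<^sup>2)"
  proof (rule integral_mono_AE)
    show "integrable M (\<lambda>x. (norm (u x))\<^sup>2)"
      using sq_int_norm_le[OF v u le] by (rule sq_int_integrable)
    show "integrable M (\<lambda>x. c\<^sup>2 * (norm (v x))\<^sup>2)"
      using sq_int_integrable[OF v] by simp
    show "AE x in M. (norm (u x))\<^sup>2 \<le> c\<^sup>2 * (norm (v x))\<^sup>2"
      using le by eventually_elim (metis norm_ge_zero power_mono power_mult_distrib)
  qed
  also have "\<dots> = c\<^sup>2 * (LINT x|M. (norm (v x))\<^sup>2)" by simp
  finally have "nrm M u \<le> sqrt (c\<^sup>2 * (LINT x|M. (norm (v x))\<^sup>2))"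
    unfolding nrm_def by (rule real_sqrt_le_mono)
  with c show ?thesis by (simp add: nrm_def real_sqrt_mult)
qed

lemma nrm_cong_AE:
  assumes "u \<in> borel_measurable M" "v \<in> borel_measurable M" "AE x in M. u x = v x"
  shows "nrm M u = nrm M v"
proof -
  have "(LINT x|M. (norm (u x))\<^sup>2) = (LINT x|M. (norm (v x))\<^sup>2)"
    using assms by (intro integral_cong_AE) auto
  then show ?thesis by (simp add: nrm_def)
qed

lemma nrm_eq_0_AE:
  assumes "sq_int M u" "nrm M u = 0" shows "AE x in M. u x = 0"
proof -
  have "(LINT x|M. (norm (u x))\<^sup>2) = 0" using assms(2) by (simp add: nrm_def)
  then have "AE x in M. (norm (u x))\<^sup>2 = 0"
    using integral_nonneg_eq_0_iff_AE[OF sq_int_integrable[OF assms(1)]] by auto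
  then show ?thesis by (auto elim!: eventually_mono)
qed

lemma nrm_Pair_sq:
  assumes u: "sq_int M u" and v: "sq_int M v"
  shows "(nrm M (\<lambda>x. (u x, v x)))\<^sup>2 = (nrm M u)\<^sup>2 + (nrm M v)\<^sup>2"
  using sq_int_integrable[OF u] sq_int_integrable[OF v] by (simp add: nrm_sq_integral norm_Pair)

lemma ip_Pair:
  assumes "sq_int M u" "sq_int M v" "sq_int M u'" "sq_int M v'"
  shows "ip M (\<lambda>x. (u x, v x)) (\<lambda>x. (u' x, v' x)) = ip M u u' + ip M v v'"
  using integrable_inner[OF assms(1,3)] integrable_inner[OF assms(2,4)] by (simp add: ip_def)

lemma nrm_fst_le: assumes "sq_int M U" shows "nrm M (\<lambda>x. fst (U x)) \<le> nrm M U"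
  using nrm_mono[OF assms, of "\<lambda>x. fst (U x)" 1] norm_fst_le
        sq_int_measurable[OF sq_int_fst[OF assms]] by (simp add: norm_fst_le')

lemma nrm_snd_le: assumes "sq_int M U" shows "nrm M (\<lambda>x. snd (U x)) \<le> nrm M U"
  using nrm_mono[OF assms, of "\<lambda>x. snd (U x)" 1] norm_snd_le
        sq_int_measurable[OF sq_int_snd[OF assms]] by (simp add: norm_snd_le')

lemma ip_tendsto:
  assumes u: "\<And>n. sq_int M (u n)" "sq_int M u'" "(\<lambda>n. nrm M (\<lambda>x. u n x - u' x)) \<longlonglongrightarrow> 0"
    and v: "\<And>n. sq_int M (v n)" "sq_int M v'" "(\<lambda>n. nrm M (\<lambda>x. v n x - v' x)) \<longlonglongrightarrow> 0"
  shows "(\<lambda>n. ip M (u n) (v n)) \<longlonglongrightarrow> ip M u' v'"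
proof -
  let ?a = "\<lambda>n. nrm M (\<lambda>x. u n x - u' x)" and ?b = "\<lambda>n. nrm M (\<lambda>x. v n x - v' x)"
  have du: "sq_int M (\<lambda>x. u n x - u' x)" and dv: "sq_int M (\<lambda>x. v n x - v' x)" for n
    using u v by auto
  have "(\<lambda>n. ip M (u n) (v n) - ip M u' v') \<longlonglongrightarrow> 0"
  proof (rule Lim_null_comparison)
    show "\<forall>\<^sub>F n in sequentially. norm (ip M (u n) (v n) - ip M u' v')
        \<le> ?a n * ?b n + ?a n * nrm M v' + nrm M u' * ?b n"
    proof (rule always_eventually, rule)
      fix n
      have "ip M (u n) (v n) - ip M u' v'
        = ip M (\<lambda>x. u n x - u' x) (\<lambda>x. v n x - v' x) + ip M (\<lambda>x. u n x - u' x) v'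
          + ip M u' (\<lambda>x. v n x - v' x)"
        using ip_diff_left[OF u(1)[of n] u(2) dv[of n]] ip_diff_left[OF u(1)[of n] u(2) v(2)]
          ip_diff_right[OF v(1)[of n] v(2) u(1)[of n]] ip_diff_right[OF v(1)[of n] v(2) u(2)]
        by linarith
      then show "norm (ip M (u n) (v n) - ip M u' v')
        \<le> ?a n * ?b n + ?a n * nrm M v' + nrm M u' * ?b n"
        using ip_Cauchy_Schwarz[OF du[of n] dv[of n]] ip_Cauchy_Schwarz[OF du[of n] v(2)]
          ip_Cauchy_Schwarz[OF u(2) dv[of n]] by (auto simp: abs_le_iff)
    qed
    have "(\<lambda>n. ?a n * ?b n + ?a n * nrm M v' + nrm M u' * ?b n) \<longlonglongrightarrow> 0 * 0 + 0 * nrm M v' + nrm M u' * 0"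
      by (intro tendsto_intros u(3) v(3))
    then show "(\<lambda>n. ?a n * ?b n + ?a n * nrm M v' + nrm M u' * ?b n) \<longlonglongrightarrow> 0" by simp
  qed
  then show ?thesis by (simp add: LIM_zero_iff)
qed

lemma ip_tendsto_left:
  assumes u: "\<And>n. sq_int M (u n)" "sq_int M u'" "(\<lambda>n. nrm M (\<lambda>x. u n x - u' x)) \<longlonglongrightarrow> 0"
    and v: "sq_int M v"
  shows "(\<lambda>n. ip M (u n) v) \<longlonglongrightarrow> ip M u' v"
  using ip_tendsto[OF u, of "\<lambda>_. v" v] v by simp

lemma nrm_tendsto:
  assumes u: "\<And>n. sq_int M (u n)" "sq_int M u'" "(\<lambda>n. nrm M (\<lambda>x. u n x - u' x)) \<longlonglongrightarrow> 0"
  shows "(\<lambda>n. nrm M (u n)) \<longlonglongrightarrow> nrm M u'"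
proof -
  have "(\<lambda>n. sqrt (ip M (u n) (u n))) \<longlonglongrightarrow> sqrt (ip M u' u')"
    by (intro tendsto_intros ip_tendsto u)
  then show ?thesis by (simp add: nrm_sq[symmetric])
qed


text \<open>
  The direct method for uniformly convex functionals: if a functional bounded
  below satisfies the midpoint inequality \<open>mid\<close>, then the defect \<open>d\<close> between two almost
  minimal points is small, so every minimizing sequence is a Cauchy sequence.
\<close>

lemma minimizing_sequence:
  fixes Q :: "'i \<Rightarrow> real"
  assumes ne: "S \<noteq> {}" and bd: "\<And>i. i \<in> S \<Longrightarrow> B \<le> Q i"
    and mid: "\<And>i j. i \<in> S \<Longrightarrow> j \<in> S \<Longrightarrow> \<exists>k\<in>S. Q k + d i j \<le> (Q i + Q j) / 2"
  obtains s where "\<And>n::nat. s n \<in> S" "(\<lambda>n. Q (s n)) \<longlonglongrightarrow> (INF i\<in>S. Q i)"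
    "\<And>e. 0 < e \<Longrightarrow> \<exists>N. \<forall>m\<ge>N. \<forall>n\<ge>N. d (s m) (s n) < e"
proof -
  define I where "I = (INF i\<in>S. Q i)"
  have bdd: "bdd_below (Q ` S)" using bd by (auto simp: bdd_below_def)
  have lower: "I \<le> Q i" if "i \<in> S" for i
    unfolding I_def using bdd that by (rule cINF_lower)
  have "\<exists>i\<in>S. Q i < I + 1 / Suc n" for n
    using cINF_less_iff[OF ne bdd, of "I + 1 / Suc n"] by (simp add: I_def)
  then obtain s where s: "\<And>n. s n \<in> S" "\<And>n. Q (s n) < I + 1 / Suc n" by metis
  show thesis
  proof
    show "s n \<in> S" for n by (rule s)
    show "(\<lambda>n. Q (s n)) \<longlonglongrightarrow> (INF i\<in>S. Q i)"
    proof (rule tendsto_sandwich)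
      show "\<forall>\<^sub>F n in sequentially. I \<le> Q (s n)" using lower s by auto
      show "\<forall>\<^sub>F n in sequentially. Q (s n) \<le> I + 1 / Suc n"
        using s(2) by (auto intro: always_eventually less_imp_le)
      have "(\<lambda>n. I + 1 / real (Suc n)) \<longlonglongrightarrow> I + 0"
        by (intro tendsto_add tendsto_const LIMSEQ_Suc[OF lim_1_over_n])
      then show "(\<lambda>n. I + 1 / real (Suc n)) \<longlonglongrightarrow> (INF i\<in>S. Q i)" by (simp add: I_def)
    qed (simp add: I_def)
    fix e :: real assume e: "0 < e"
    then obtain N where N: "1 / real (Suc N) < e" using nat_approx_posE by blast
    show "\<exists>N. \<forall>m\<ge>N. \<forall>n\<ge>N. d (s m) (s n) < e"
    proof (intro exI allI impI)
      fix m n assume mn: "N \<le> m" "N \<le> n"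
      obtain k where k: "k \<in> S" "Q k + d (s m) (s n) \<le> (Q (s m) + Q (s n)) / 2"
        using mid[OF s(1) s(1)] by blast
      have "1 / real (Suc m) \<le> 1 / real (Suc N)" "1 / real (Suc n) \<le> 1 / real (Suc N)"
        using mn by (auto intro!: divide_left_mono)
      with k(2) lower[OF k(1)] s(2)[of m] s(2)[of n] N show "d (s m) (s n) < e"
        by argo
    qed
  qed
qed

text \<open>
  Each index may be chosen as late as desired, so consecutive terms can be made as close as any
  prescribed sequence of tolerances demands.
\<close>

lemma Cauchy_fast_subseq:
  fixes d :: "nat \<Rightarrow> nat \<Rightarrow> real" and c :: "nat \<Rightarrow> real"
  assumes "\<And>e. 0 < e \<Longrightarrow> \<exists>N. \<forall>m\<ge>N. \<forall>n\<ge>N. d m n < e" and "\<And>k. 0 < c k"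
  obtains r where "strict_mono r" "\<And>k. d (r (Suc k)) (r k) < c k"
proof -
  have "\<forall>k. \<exists>N. \<forall>m\<ge>N. \<forall>n\<ge>N. d m n < c k" using assms by blast
  then have "\<exists>N. \<forall>k. \<forall>m\<ge>N k. \<forall>n\<ge>N k. d m n < c k" by (rule choice)
  then obtain N where N: "\<And>k m n. N k \<le> m \<Longrightarrow> N k \<le> n \<Longrightarrow> d m n < c k" by blast
  define r where "r = rec_nat (N 0) (\<lambda>k x. max (Suc x) (N (Suc k)))"
  have r: "r 0 = N 0" "r (Suc k) = max (Suc (r k)) (N (Suc k))" for k by (simp_all add: r_def)
  have ge: "N k \<le> r k" for k by (cases k) (auto simp: r)
  have lt: "r k < r (Suc k)" for k by (simp add: r)
  show thesis
  proof
    show "strict_mono r" using lt by (simp add: strict_mono_Suc_iff)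
    show "d (r (Suc k)) (r k) < c k" for k
      using lt[of k] ge[of k] by (intro N) auto
  qed
qed

text \<open>
  Riesz-Fischer. Along a subsequence whose increments have norms at most \<open>4^-k\<close>, the series of
  the increments squared converges even with weights \<open>2^k\<close>; this makes the increments geometrically
  small almost everywhere, so the subsequence converges pointwise. Fatou's lemma then turns the
  pointwise limit into the limit in norm.
\<close>

lemma L2_complete:
  fixes u :: "nat \<Rightarrow> 'a \<Rightarrow> 'b::euclidean_space"
  assumes u: "\<And>n. sq_int M (u n)"
    and Cauchy: "\<And>e. 0 < e \<Longrightarrow> \<exists>N. \<forall>m\<ge>N. \<forall>n\<ge>N. nrm M (\<lambda>x. u m x - u n x) < e"
  obtains v where "sq_int M v" "(\<lambda>n. nrm M (\<lambda>x. u n x - v x)) \<longlonglongrightarrow> 0"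
proof -
  have meas [measurable]: "u n \<in> borel_measurable M" for n using u by (rule sq_int_measurable)
  define d where "d m n = (\<lambda>x. u m x - u n x)" for m n
  have d: "sq_int M (d m n)" for m n unfolding d_def using u by auto
  obtain r where r: "strict_mono r" "\<And>k. nrm M (d (r (Suc k)) (r k)) < (1/4) ^ k"
    using Cauchy_fast_subseq[of "\<lambda>m n. nrm M (d m n)" "\<lambda>k. (1/4) ^ k"] Cauchy
    unfolding d_def by auto
  define D where "D k = d (r (Suc k)) (r k)" for k
  have Dm [measurable]: "D k \<in> borel_measurable M" for k
    unfolding D_def by (rule sq_int_measurable[OF d])
  \<comment> \<open>The weights \<open>2^k\<close> grow more slowly than the squared norms, at most \<open>16^-k\<close>, decay.\<close>
  define h where "h k x = 2 ^ k * (norm (D k x))\<^sup>2" for k x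
  have h_int: "(\<integral>\<^sup>+x. ennreal (h k x) \<partial>M) \<le> ennreal ((1/2) ^ k)" for k
  proof -
    have "(\<integral>\<^sup>+x. ennreal (h k x) \<partial>M) = ennreal (LINT x|M. h k x)"
      unfolding h_def using sq_int_integrable[OF d[of "r (Suc k)" "r k"]]
      by (intro nn_integral_eq_integral) (auto simp: D_def)
    also have "(LINT x|M. h k x) = 2 ^ k * (nrm M (D k))\<^sup>2"
      by (simp add: h_def nrm_sq_integral)
    also have "\<dots> \<le> 2 ^ k * ((1/4) ^ k)\<^sup>2"
      using r(2)[of k] by (intro mult_left_mono power_mono) (auto simp: D_def)
    also have "\<dots> \<le> 2 ^ k * (1/4) ^ k"
      by (intro mult_left_mono) (auto simp: power2_eq_square power_le_one mult_left_le_one_le)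
    also have "\<dots> = (1/2) ^ k" by (simp add: power_mult_distrib[symmetric])
    finally show ?thesis by (simp add: ennreal_leI)
  qed
  have "(\<integral>\<^sup>+x. (\<Sum>k. ennreal (h k x)) \<partial>M) = (\<Sum>k. \<integral>\<^sup>+x. ennreal (h k x) \<partial>M)"
    by (rule nn_integral_suminf) (simp add: h_def)
  also have "\<dots> \<le> (\<Sum>k. ennreal ((1/2) ^ k))"
    by (rule suminf_le[OF h_int]) auto
  also have "\<dots> = ennreal (\<Sum>k. (1/2) ^ k)"
    by (rule suminf_ennreal2) (auto intro: summable_geometric)
  also have "\<dots> < \<infinity>" by simp
  finally have "(\<integral>\<^sup>+x. (\<Sum>k. ennreal (h k x)) \<partial>M) \<noteq> \<infinity>" by simp
  then have "AE x in M. (\<Sum>k. ennreal (h k x)) \<noteq> \<infinity>"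
    by (intro nn_integral_noteq_infinite) (auto simp: h_def)
  then have conv: "AE x in M. convergent (\<lambda>k. u (r k) x)"
  proof eventually_elim
    case (elim x)
    have "summable (\<lambda>k. h k x)"
      by (rule summable_suminf_not_top) (use elim in \<open>auto simp: h_def\<close>)
    then obtain C where C: "\<And>k. \<bar>h k x\<bar> \<le> C"
      using summable_imp_Bseq[of "\<lambda>k. h k x"] by (auto simp: Bseq_def)
    have le: "norm (D k x) \<le> sqrt C * (1 / sqrt 2) ^ k" for k
    proof (rule power2_le_imp_le)
      have "0 \<le> C" using C[of 0] by auto
      moreover have "((1 / sqrt 2) ^ k)\<^sup>2 = (1 / 2 ^ k :: real)"
        by (simp add: power_divide real_sqrt_power[symmetric])
      moreover have "(norm (D k x))\<^sup>2 \<le> C / 2 ^ k"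
        using C[of k] by (simp add: h_def field_simps)
      ultimately show "(norm (D k x))\<^sup>2 \<le> (sqrt C * (1 / sqrt 2) ^ k)\<^sup>2"
        by (simp add: power_mult_distrib)
      show "0 \<le> sqrt C * (1 / sqrt 2) ^ k" using \<open>0 \<le> C\<close> by simp
    qed
    have "summable (\<lambda>k. sqrt C * (1 / sqrt 2) ^ k)"
      by (rule summable_mult, rule summable_geometric) simp
    then have "summable (\<lambda>k. D k x)"
      by (rule summable_comparison_test'[where N=0]) (rule le)
    then have "(\<lambda>n. \<Sum>k<n. D k x) \<longlonglongrightarrow> (\<Sum>k. D k x)"
      by (rule summable_LIMSEQ)
    then have "(\<lambda>n. u (r 0) x + (\<Sum>k<n. D k x)) \<longlonglongrightarrow> u (r 0) x + (\<Sum>k. D k x)"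
      by (intro tendsto_intros)
    moreover have "u (r 0) x + (\<Sum>k<n. D k x) = u (r n) x" for n
      using sum_lessThan_telescope[of "\<lambda>k. u (r k) x" n] by (simp add: D_def d_def)
    ultimately show ?case by (auto simp: convergent_def)
  qed
  define v where "v x = lim (\<lambda>k. u (r k) x)" for x
  have vm [measurable]: "v \<in> borel_measurable M"
    unfolding v_def by measurable
  have lim: "AE x in M. (\<lambda>k. u (r k) x) \<longlonglongrightarrow> v x"
    using conv by eventually_elim (simp add: v_def convergent_LIMSEQ_iff)
  have bound: "(\<integral>\<^sup>+x. ennreal ((norm (u n x - v x))\<^sup>2) \<partial>M) \<le> ennreal (e\<^sup>2)"
    if N: "\<forall>m\<ge>N. \<forall>n\<ge>N. nrm M (d m n) < e" and n: "N \<le> n" for N n e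
  proof -
    have "(\<integral>\<^sup>+x. ennreal ((norm (u n x - v x))\<^sup>2) \<partial>M)
        = (\<integral>\<^sup>+x. liminf (\<lambda>k. ennreal ((norm (u n x - u (r k) x))\<^sup>2)) \<partial>M)"
    proof (rule nn_integral_cong_AE, use lim in eventually_elim)
      case (elim x)
      have "(\<lambda>k. ennreal ((norm (u n x - u (r k) x))\<^sup>2)) \<longlonglongrightarrow> ennreal ((norm (u n x - v x))\<^sup>2)"
        by (intro tendsto_intros tendsto_ennrealI elim)
      from lim_imp_Liminf[OF trivial_limit_sequentially this] show ?case by (rule sym)
    qed
    also have "\<dots> \<le> liminf (\<lambda>k. \<integral>\<^sup>+x. ennreal ((norm (u n x - u (r k) x))\<^sup>2) \<partial>M)"
      by (rule nn_integral_liminf) measurable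
    also have "\<dots> \<le> ennreal (e\<^sup>2)"
    proof (rule Liminf_le)
      have "(\<integral>\<^sup>+x. ennreal ((norm (u n x - u (r k) x))\<^sup>2) \<partial>M) \<le> ennreal (e\<^sup>2)" if "N \<le> k" for k
      proof -
        have "N \<le> r k" using that seq_suble[OF r(1), of k] by simp
        then have "(nrm M (d n (r k)))\<^sup>2 \<le> e\<^sup>2"
          using N n by (intro power_mono) (auto intro: less_imp_le)
        moreover have "(\<integral>\<^sup>+x. ennreal ((norm (u n x - u (r k) x))\<^sup>2) \<partial>M) = ennreal ((nrm M (d n (r k)))\<^sup>2)"
          unfolding nrm_sq_integral using sq_int_integrable[OF d[of n "r k"]]
          by (subst nn_integral_eq_integral) (auto simp: d_def)
        ultimately show ?thesis by (simp add: ennreal_leI)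
      qed
      then show "\<forall>\<^sub>F k in sequentially. (\<integral>\<^sup>+x. ennreal ((norm (u n x - u (r k) x))\<^sup>2) \<partial>M) \<le> ennreal (e\<^sup>2)"
        by (auto simp: eventually_sequentially)
    qed simp
    finally show ?thesis .
  qed
  have fin: "integrable M (\<lambda>x. (norm (u n x - v x))\<^sup>2)" 
    if N: "\<forall>m\<ge>N. \<forall>n\<ge>N. nrm M (d m n) < e" and n: "N \<le> n" for N n e
    using bound[OF that] by (intro integrableI_bounded) (auto simp: top_unique intro: le_less_trans)
  have small: "nrm M (\<lambda>x. u n x - v x) \<le> e"
    if N: "\<forall>m\<ge>N. \<forall>n\<ge>N. nrm M (d m n) < e" and n: "N \<le> n" and e: "0 < e" for N n e
  proof -
    have "ennreal (LINT x|M. (norm (u n x - v x))\<^sup>2) = (\<integral>\<^sup>+x. ennreal ((norm (u n x - v x))\<^sup>2) \<partial>M)"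
      by (rule nn_integral_eq_integral[symmetric, OF fin[OF N n]]) simp
    with bound[OF N n] have "(LINT x|M. (norm (u n x - v x))\<^sup>2) \<le> e\<^sup>2"
      by (metis ennreal_le_iff zero_le_power2)
    then have "nrm M (\<lambda>x. u n x - v x) \<le> sqrt (e\<^sup>2)"
      unfolding nrm_def by (rule real_sqrt_le_mono)
    with e show ?thesis by simp
  qed
  obtain N1 where N1: "\<forall>m\<ge>N1. \<forall>n\<ge>N1. nrm M (d m n) < 1"
    using Cauchy[of 1] by (auto simp: d_def)
  have "sq_int M (\<lambda>x. u N1 x - v x)"
    unfolding sq_int_def using fin[OF N1 order_refl] by simp
  then have "sq_int M v" using sq_int_diff[OF u[of N1], of "\<lambda>x. u N1 x - v x"] by simp
  moreover have "(\<lambda>n. nrm M (\<lambda>x. u n x - v x)) \<longlonglongrightarrow> 0"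
  proof (rule LIMSEQ_I)
    fix e :: real assume "0 < e"
    then obtain N where "\<forall>m\<ge>N. \<forall>n\<ge>N. nrm M (d m n) < e / 2"
      using Cauchy[of "e / 2"] by (auto simp: d_def)
    then have "nrm M (\<lambda>x. u n x - v x) \<le> e / 2" if "N \<le> n" for n
      using small[of N "e / 2" n] that \<open>0 < e\<close> by simp
    then have "nrm M (\<lambda>x. u n x - v x) < e" if "N \<le> n" for n
      using that \<open>0 < e\<close> by force
    then show "\<exists>N. \<forall>n\<ge>N. norm (nrm M (\<lambda>x. u n x - v x) - 0) < e" by auto
  qed
  ultimately show thesis by (rule that)
qed

text \<open>
  Transfers the Cauchy property from the convexity defect of a minimizing sequence to the norm.
\<close>

lemma L2_Cauchy_of_bound:
  assumes d: "\<And>m n. 0 \<le> d m n" "\<And>e. 0 < e \<Longrightarrow> \<exists>N::nat. \<forall>m\<ge>N. \<forall>n\<ge>N. d m n < e"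
    and le: "\<And>m n. (nrm M (\<lambda>x. u m x - u n x))\<^sup>2 \<le> c * d m n" and c: "0 < c" and e: "0 < (e::real)"
  shows "\<exists>N. \<forall>m\<ge>N. \<forall>n\<ge>N. nrm M (\<lambda>x. u m x - u n x) < e"
proof -
  obtain N where N: "\<forall>m\<ge>N. \<forall>n\<ge>N. d m n < e\<^sup>2 / c" using d(2)[of "e\<^sup>2 / c"] c e by auto
  show ?thesis
  proof (intro exI allI impI)
    fix m n assume "N \<le> m" "N \<le> n"
    with N c have "c * d m n < e\<^sup>2" by (simp add: field_simps)
    with le[of m n] have "(nrm M (\<lambda>x. u m x - u n x))\<^sup>2 < e\<^sup>2" by linarith
    with e show "nrm M (\<lambda>x. u m x - u n x) < e" by (simp add: power_less_imp_less_base)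
  qed
qed

text \<open>
  The Riesz representation theorem on the closure of a subspace \<open>S\<close>, which is given only by its
  elements: the representing function is the limit of a minimizing sequence of
  \<open>ip u u / 2 - L u\<close> over \<open>S\<close>. Besides the function itself, the approximating sequence in \<open>S\<close> is
  part of the conclusion, since membership in a Sobolev space is defined through it.
\<close>

lemma L2_Riesz:
  fixes S :: "('a \<Rightarrow> 'b::euclidean_space) set"
  assumes ne: "S \<noteq> {}" and S: "\<And>u. u \<in> S \<Longrightarrow> sq_int M u"
    and comb: "\<And>u v a b. u \<in> S \<Longrightarrow> v \<in> S \<Longrightarrow> (\<lambda>x. a *\<^sub>R u x + b *\<^sub>R v x) \<in> S"
    and L: "\<And>u v a b. u \<in> S \<Longrightarrow> v \<in> S \<Longrightarrow> L (\<lambda>x. a *\<^sub>R u x + b *\<^sub>R v x) = a * L u + b * L v"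
    and bound: "\<And>u. u \<in> S \<Longrightarrow> \<bar>L u\<bar> \<le> C * nrm M u"
  obtains p s where "sq_int M p" "\<And>n. s n \<in> S" "(\<lambda>n. nrm M (\<lambda>x. s n x - p x)) \<longlonglongrightarrow> 0"
    "\<And>u. u \<in> S \<Longrightarrow> ip M p u = L u"
proof -
  define Q where "Q u = ip M u u / 2 - L u" for u
  let ?d = "\<lambda>u v. (nrm M (\<lambda>x. u x - v x))\<^sup>2 / 8"
  have Q_low: "- (C\<^sup>2 / 2) \<le> Q u" if "u \<in> S" for u
    using bound[OF that] zero_le_power2[of "nrm M u - C"]
    by (simp add: Q_def nrm_sq[symmetric] power2_diff) argo
  have Q_mid: "\<exists>k\<in>S. Q k + ?d u v \<le> (Q u + Q v) / 2" if u: "u \<in> S" and v: "v \<in> S" for u v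
  proof
    let ?k = "\<lambda>x. (1/2) *\<^sub>R u x + (1/2) *\<^sub>R v x"
    show "?k \<in> S" using u v by (rule comb)
    have "ip M ?k ?k = ip M u u / 4 + ip M u v / 2 + ip M v v / 4"
      using ip_add_self[OF sq_int_scale[OF S[OF u], of "1/2"] S[OF v], of "1/2"]
      by (simp add: power2_eq_square)
    moreover have "L ?k = (L u + L v) / 2" using L[OF u v, of "1/2" "1/2"] by simp
    ultimately show "Q ?k + ?d u v \<le> (Q u + Q v) / 2"
      using ip_diff_self[OF S[OF u] S[OF v]] by (simp add: Q_def nrm_sq field_simps)
  qed
  obtain s where s: "\<And>n::nat. s n \<in> S" and lim: "(\<lambda>n. Q (s n)) \<longlonglongrightarrow> (INF u\<in>S. Q u)"
    and Cauchy: "\<And>e. 0 < e \<Longrightarrow> \<exists>N. \<forall>m\<ge>N. \<forall>n\<ge>N. ?d (s m) (s n) < e"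
    using minimizing_sequence[OF ne Q_low Q_mid] by blast
  obtain p where p: "sq_int M p" "(\<lambda>n. nrm M (\<lambda>x. s n x - p x)) \<longlonglongrightarrow> 0"
  proof (rule L2_complete[of M s])
    show "\<exists>N. \<forall>m\<ge>N. \<forall>n\<ge>N. nrm M (\<lambda>x. s m x - s n x) < e" if "0 < e" for e
      by (rule L2_Cauchy_of_bound[where c=8, OF _ Cauchy]) (use that in auto)
  qed (use s S in auto)
  show thesis
  proof
    fix v assume v: "v \<in> S"
    have "0 \<le> 0 + 2 * t * (ip M p v - L v) + t\<^sup>2 * ip M v v" for t
    proof -
      have "(INF u\<in>S. Q u) \<le> Q (s n) + t * (ip M (s n) v - L v) + t\<^sup>2 / 2 * ip M v v" for n
      proof -
        have "(INF u\<in>S. Q u) \<le> Q (\<lambda>x. 1 *\<^sub>R s n x + t *\<^sub>R v x)"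
          by (rule cINF_lower[OF _ comb[OF s v]]) (use Q_low in \<open>auto simp: bdd_below_def\<close>)
        also have "\<dots> = Q (s n) + t * (ip M (s n) v - L v) + t\<^sup>2 / 2 * ip M v v"
          using ip_add_self[OF S[OF s[of n]] S[OF v], of t] L[OF s[of n] v, of 1 t]
          by (simp add: Q_def field_simps)
        finally show ?thesis .
      qed
      moreover have "(\<lambda>n. Q (s n) + t * (ip M (s n) v - L v) + t\<^sup>2 / 2 * ip M v v)
          \<longlonglongrightarrow> (INF u\<in>S. Q u) + t * (ip M p v - L v) + t\<^sup>2 / 2 * ip M v v"
        by (intro tendsto_intros lim ip_tendsto_left S s p v)
      ultimately have "(INF u\<in>S. Q u) \<le> (INF u\<in>S. Q u) + t * (ip M p v - L v) + t\<^sup>2 / 2 * ip M v v"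
        by (intro LIMSEQ_le_const) auto
      then show ?thesis by simp
    qed
    then have "(ip M p v - L v)\<^sup>2 \<le> 0 * ip M v v"
      by (rule quadratic_nonneg_discriminant) auto
    then show "ip M p v = L v" by simp
  qed (use p s in auto)
qed

section \<open>Smooth functions and the flat exponential\<close>

definition smooth :: "('a::euclidean_space \<Rightarrow> real) \<Rightarrow> bool" where
  "smooth f \<longleftrightarrow> (\<forall>k. continuously_diff k f)"

lemma continuously_diff_Suc_imp: "continuously_diff (Suc k) f \<Longrightarrow> continuously_diff k f"
proof (induction k arbitrary: f)
  case 0
  then show ?case by (auto intro: differentiable_imp_continuous_on)
next
  case (Suc k)
  show ?case using Suc.prems Suc.IH by (auto simp del: continuously_diff.simps(2) simp: continuously_diff.simps(2)[of "Suc k"] continuously_diff.simps(2)[of "k" f])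
qed

lemma partial_eq: "(f has_derivative D) (at x) \<Longrightarrow> partial i f x = D i"
  unfolding partial_def by (metis frechet_derivative_at)

lemma has_derivative_frechet:
  "f differentiable_on UNIV \<Longrightarrow> (f has_derivative frechet_derivative f (at x)) (at x)"
  by (simp add: differentiable_on_def frechet_derivative_works)

lemma partial_add:
  assumes "f differentiable_on UNIV" "g differentiable_on UNIV"
  shows "partial i (\<lambda>x. f x + g x) = (\<lambda>x. partial i f x + partial i g x)"
  using partial_eq[OF has_derivative_add[OF has_derivative_frechet[OF assms(1)] has_derivative_frechet[OF assms(2)]]]
  by (auto simp: partial_def)

lemma partial_mult:
  assumes "f differentiable_on UNIV" "g differentiable_on UNIV"
  shows "partial i (\<lambda>x. f x * g x) = (\<lambda>x. f x * partial i g x + partial i f x * g x)"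
  using partial_eq[OF has_derivative_mult[OF has_derivative_frechet[OF assms(1)] has_derivative_frechet[OF assms(2)]]]
  by (auto simp: partial_def)

lemma partial_const: "partial i (\<lambda>x. c) = (\<lambda>x. 0)"
  by (auto simp: partial_def)

lemma continuously_diff_const: "continuously_diff k (\<lambda>x. c)"
  by (induction k arbitrary: c) (auto simp: partial_const)

lemma continuously_diff_add:
  "continuously_diff k f \<Longrightarrow> continuously_diff k g \<Longrightarrow> continuously_diff k (\<lambda>x. f x + g x)"
  by (induction k arbitrary: f g) (auto simp: partial_add intro!: continuous_intros derivative_intros)

lemma continuously_diff_mult:
  "continuously_diff k f \<Longrightarrow> continuously_diff k g \<Longrightarrow> continuously_diff k (\<lambda>x. f x * g x)"
proof (induction k arbitrary: f g)
  case 0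
  then show ?case by (auto intro!: continuous_intros)
next
  case (Suc k)
  have "continuously_diff k f" "continuously_diff k g"
    using Suc.prems by (auto intro: continuously_diff_Suc_imp)
  with Suc show ?case
    by (auto simp: partial_mult intro!: continuously_diff_add derivative_intros)
qed

lemma smooth_const [intro, simp]: "smooth (\<lambda>x. c)"
  by (simp add: smooth_def continuously_diff_const)

lemma smooth_add [intro]: "smooth f \<Longrightarrow> smooth g \<Longrightarrow> smooth (\<lambda>x. f x + g x)"
  by (simp add: smooth_def continuously_diff_add)

lemma smooth_mult [intro]: "smooth f \<Longrightarrow> smooth g \<Longrightarrow> smooth (\<lambda>x. f x * g x)"
  by (simp add: smooth_def continuously_diff_mult)

lemma smooth_minus [intro]: "smooth f \<Longrightarrow> smooth (\<lambda>x. - f x)"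
  using smooth_mult[of "\<lambda>_. -1" f] by simp

lemma smooth_diff [intro]: "smooth f \<Longrightarrow> smooth g \<Longrightarrow> smooth (\<lambda>x. f x - g x)"
  using smooth_add[of f "\<lambda>x. - g x"] by auto

lemma smooth_prod [intro]: "(\<And>i. i \<in> I \<Longrightarrow> smooth (f i)) \<Longrightarrow> smooth (\<lambda>x. \<Prod>i\<in>I. f i x)"
  by (induction I rule: infinite_finite_induct) auto

lemma smooth_partial [intro]: "smooth f \<Longrightarrow> i \<in> Basis \<Longrightarrow> smooth (partial i f)"
  unfolding smooth_def by (metis continuously_diff.simps(2))

lemma smooth_differentiable: "smooth f \<Longrightarrow> f differentiable_on UNIV"
  unfolding smooth_def by (metis continuously_diff.simps(2))

lemma smooth_continuous: "smooth f \<Longrightarrow> continuous_on UNIV f"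
  unfolding smooth_def by (metis continuously_diff.simps(1))

lemma smooth_has_derivative: "smooth f \<Longrightarrow> (f has_derivative frechet_derivative f (at x)) (at x)"
  by (intro has_derivative_frechet smooth_differentiable)

lemma smooth_coord: "smooth (\<lambda>x. x \<bullet> i)"
proof -
  have d: "((\<lambda>x. x \<bullet> i) has_derivative (\<lambda>h. h \<bullet> i)) (at x)" for x :: 'a
    by (auto intro!: derivative_eq_intros)
  then have p: "partial j (\<lambda>x. x \<bullet> i) = (\<lambda>x. j \<bullet> i)" for j :: 'a
    using partial_eq[OF d] by auto
  have "continuously_diff k (\<lambda>x. x \<bullet> i)" for k
  proof (cases k)
    case (Suc j)
    have "(\<lambda>x. x \<bullet> i) differentiable_on UNIV"
      by (auto simp: differentiable_on_def intro!: derivative_intros)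
    then show ?thesis by (simp add: Suc p continuously_diff_const)
  qed (auto intro!: continuous_intros)
  then show ?thesis by (simp add: smooth_def)
qed

lemma partial_coord: "partial j (\<lambda>x. x \<bullet> i) = (\<lambda>x. j \<bullet> i)"
proof
  fix x :: 'a
  have d: "((\<lambda>x. x \<bullet> i) has_derivative (\<lambda>h. h \<bullet> i)) (at x)"
    by (auto intro!: derivative_eq_intros)
  then show "partial j (\<lambda>x. x \<bullet> i) x = j \<bullet> i" by (rule partial_eq)
qed

lemma smooth_translate: "smooth f \<Longrightarrow> smooth (\<lambda>x. f (x + a))"
  and partial_translate: "smooth f \<Longrightarrow> partial i (\<lambda>x. f (x + a)) = (\<lambda>x. partial i f (x + a))"
proof -
  have d: "((\<lambda>x. f (x + a)) has_derivative frechet_derivative f (at (x + a))) (at x)"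
    if "f differentiable_on UNIV" for x and f :: "'a \<Rightarrow> real"
  proof -
    have "((\<lambda>x. x + a) has_derivative (\<lambda>h. h)) (at x)" by (auto intro!: derivative_eq_intros)
    from has_derivative_compose[OF this has_derivative_frechet[OF that]] show ?thesis .
  qed
  have p: "partial i (\<lambda>x. f (x + a)) = (\<lambda>x. partial i f (x + a))"
    if "f differentiable_on UNIV" for f i
    using partial_eq[OF d[OF that]] by (auto simp: partial_def)
  have "continuously_diff k f \<Longrightarrow> continuously_diff k (\<lambda>x. f (x + a))" for k f
  proof (induction k arbitrary: f)
    case 0
    then show ?case by (auto intro!: continuous_on_compose2[of UNIV f] continuous_intros)
  next
    case (Suc k)
    have "(\<lambda>x. f (x + a)) differentiable_on UNIV"
      using d[of f] Suc.prems by (auto simp: differentiable_on_def differentiable_def)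
    with Suc show ?case by (simp add: p)
  qed
  then show "smooth f \<Longrightarrow> smooth (\<lambda>x. f (x + a))" by (simp add: smooth_def)
  show "smooth f \<Longrightarrow> partial i (\<lambda>x. f (x + a)) = (\<lambda>x. partial i f (x + a))"
    using p smooth_differentiable by blast
qed

lemma has_derivative_compose_real:
  assumes "f differentiable_on UNIV" "(g has_real_derivative g') (at (f x))"
  shows "((\<lambda>x. g (f x)) has_derivative (\<lambda>h. g' * frechet_derivative f (at x) h)) (at x)"
  using has_derivative_compose[OF has_derivative_frechet[OF assms(1), of x], of g "\<lambda>h. g' * h"] assms(2)
  by (simp add: has_field_derivative_def mult_commute_abs)

text \<open>
  Smoothness of compositions with a function of one variable needs all its derivatives at once, so
  the induction runs over a family \<open>b\<close> closed under differentiation, \<open>D j\<close> being the index of the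
  derivative of \<open>b j\<close>.
\<close>

lemma continuously_diff_compose:
  fixes b :: "'j \<Rightarrow> real \<Rightarrow> real" and f :: "'a::euclidean_space \<Rightarrow> real"
  assumes b: "\<And>j s. (b j has_real_derivative b (D j) s) (at s)"
  shows "continuously_diff k f \<Longrightarrow> continuously_diff k (\<lambda>x. b j (f x))"
proof (induction k arbitrary: j)
  case 0
  have "continuous_on UNIV (b j)"
    using b by (meson DERIV_continuous_on has_field_derivative_at_within)
  with 0 show ?case by (auto intro: continuous_on_compose2[of UNIV "b j"])
next
  case (Suc k)
  have f: "f differentiable_on UNIV" using Suc.prems by simp
  have d: "((\<lambda>x. b j (f x)) has_derivative (\<lambda>h. b (D j) (f x) * frechet_derivative f (at x) h)) (at x)" for x
    by (rule has_derivative_compose_real[OF f b])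
  have "partial i (\<lambda>x. b j (f x)) = (\<lambda>x. b (D j) (f x) * partial i f x)" for i
    using partial_eq[OF d] by (auto simp: partial_def)
  moreover have "(\<lambda>x. b j (f x)) differentiable_on UNIV"
    using d by (auto simp: differentiable_on_def differentiable_def)
  moreover have "continuously_diff k f" using Suc.prems by (rule continuously_diff_Suc_imp)
  ultimately show ?case
    using Suc by (auto intro!: continuously_diff_mult)
qed

text \<open>
  The functions \<open>p(1/t) exp(-1/t)\<close>, extended by zero to \<open>t \<le> 0\<close>. They are closed under
  differentiation, unlike the single function \<open>exp(-1/t)\<close>.
\<close>

definition flat_exp :: "real poly \<Rightarrow> real \<Rightarrow> real" where
  "flat_exp p t = (if 0 < t then poly p (1 / t) * exp (- 1 / t) else 0)"

lemma poly_times_exp_tendsto_0: "((\<lambda>x. poly p x * exp (- x)) \<longlongrightarrow> 0) (at_top :: real filter)"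
proof -
  have "((\<lambda>x. \<Sum>i\<le>degree p. coeff p i * (x ^ i / exp x)) \<longlongrightarrow> (\<Sum>i\<le>degree p. coeff p i * 0)) (at_top :: real filter)"
    by (intro tendsto_sum tendsto_mult tendsto_const tendsto_power_div_exp_0)
  moreover have "poly p x * exp (- x) = (\<Sum>i\<le>degree p. coeff p i * (x ^ i / exp x))" for x
    by (simp add: poly_altdef sum_distrib_right exp_minus divide_inverse mult.assoc)
  ultimately show ?thesis by simp
qed

lemma flat_exp_deriv:
  "(flat_exp p has_real_derivative flat_exp ([:0, 0, 1:] * (p - pderiv p)) t) (at t)"
proof -
  consider "0 < t" | "t < 0" | "t = 0" by linarith
  then show ?thesis
  proof cases
    case 1
    have "((\<lambda>t. poly p (1 / t) * exp (- 1 / t)) has_real_derivative flat_exp ([:0, 0, 1:] * (p - pderiv p)) t) (at t)"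
      using 1 by (auto intro!: derivative_eq_intros DERIV_chain2[OF poly_DERIV] simp: flat_exp_def field_simps power2_eq_square)
    moreover have "\<forall>\<^sub>F s in nhds t. flat_exp p s = poly p (1 / s) * exp (- 1 / s)"
      using eventually_nhds_in_open[of "{0<..}" t] 1 by (auto simp: flat_exp_def elim!: eventually_mono)
    ultimately show ?thesis by (simp add: DERIV_cong_ev)
  next
    case 2
    have "\<forall>\<^sub>F s in nhds t. flat_exp p s = 0"
      using eventually_nhds_in_open[of "{..<0}" t] 2 by (auto simp: flat_exp_def elim!: eventually_mono)
    moreover have "flat_exp ([:0, 0, 1:] * (p - pderiv p)) t = 0" using 2 by (simp add: flat_exp_def)
    ultimately show ?thesis by (simp add: DERIV_cong_ev)
  next
    case 3
    have "((\<lambda>t. poly (pCons 0 p) (1 / t) * exp (- (1 / t))) \<longlongrightarrow> 0) (at_right (0::real))"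
      using filterlim_compose[OF poly_times_exp_tendsto_0 filterlim_inverse_at_top_right, of "pCons 0 p"]
      by (simp add: inverse_eq_divide)
    then have "((\<lambda>h. flat_exp p h / h) \<longlongrightarrow> 0) (at_right 0)"
      by (rule Lim_transform_eventually)
         (auto simp: flat_exp_def eventually_at_right_less eventually_at intro!: exI[of _ 1])
    moreover have "((\<lambda>h. flat_exp p h / h) \<longlongrightarrow> 0) (at_left 0)"
      by (rule tendsto_eventually) (auto simp: flat_exp_def eventually_at intro!: exI[of _ 1])
    ultimately have "((\<lambda>h. flat_exp p h / h) \<longlongrightarrow> 0) (at 0)"
      by (simp add: filterlim_split_at)
    then show ?thesis
      by (simp add: 3 has_field_derivative_iff flat_exp_def)
  qed
qed

lemma smooth_flat_exp [intro]: "smooth f \<Longrightarrow> smooth (\<lambda>x. flat_exp p (f x))"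
  unfolding smooth_def
  using continuously_diff_compose[of flat_exp "\<lambda>p. [:0, 0, 1:] * (p - pderiv p)", OF flat_exp_deriv] by blast

definition flat :: "real \<Rightarrow> real" where "flat = flat_exp 1"

lemma flat_eq: "flat t = (if 0 < t then exp (- 1 / t) else 0)"
  by (simp add: flat_def flat_exp_def)

lemma flat_nonneg [simp]: "0 \<le> flat t" and flat_le_1: "flat t \<le> 1"
  by (auto simp: flat_eq)

text \<open>
  The derivative of \<open>exp(-1/t)\<close> is \<open>s\<^sup>2 exp(-s)\<close> with \<open>s = 1/t\<close>, and \<open>exp s \<ge> s\<^sup>2/2\<close>.
\<close>

lemma flat_deriv:
  obtains D where "\<And>t. (flat has_real_derivative D t) (at t)" "\<And>t. 0 \<le> D t" "\<And>t. D t \<le> 2"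
proof
  let ?D = "flat_exp [:0, 0, 1:]"
  show "(flat has_real_derivative ?D t) (at t)" for t
    using flat_exp_deriv[of 1 t] by (simp add: flat_def)
  show "0 \<le> ?D t" for t by (simp add: flat_exp_def)
  show "?D t \<le> 2" for t
  proof (cases "0 < t")
    case True
    then have "(1 / t)\<^sup>2 / 2 \<le> exp (1 / t)"
      using exp_lower_Taylor_quadratic[of "1 / t"] by (smt (verit) divide_nonneg_nonneg)
    with True show ?thesis
      by (simp add: flat_exp_def exp_minus field_simps power2_eq_square)
  qed (simp add: flat_exp_def)
qed

lemma smooth_flat [intro]: "smooth f \<Longrightarrow> smooth (\<lambda>x. flat (f x))"
  unfolding flat_def by (rule smooth_flat_exp)

section \<open>Test functions and the fundamental lemma of the calculus of variations\<close>

lemma test_functions_iff: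
  "\<phi> \<in> test_functions \<Omega> \<longleftrightarrow> smooth \<phi> \<and> compact (closure {x. \<phi> x \<noteq> 0}) \<and> closure {x. \<phi> x \<noteq> 0} \<subseteq> \<Omega>"
  by (simp add: test_functions_def smooth_def)

lemma test_smooth: "\<phi> \<in> test_functions \<Omega> \<Longrightarrow> smooth \<phi>"
  by (simp add: test_functions_iff)

lemma test_mono: "\<Omega> \<subseteq> \<Omega>' \<Longrightarrow> \<phi> \<in> test_functions \<Omega> \<Longrightarrow> \<phi> \<in> test_functions \<Omega>'"
  by (auto simp: test_functions_iff)

lemma test_supported:
  assumes "smooth \<psi>" "\<phi> \<in> test_functions \<Omega>" "\<And>x. \<phi> x = 0 \<Longrightarrow> \<psi> x = 0"
  shows "\<psi> \<in> test_functions \<Omega>"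
proof -
  have "closure {x. \<psi> x \<noteq> 0} \<subseteq> closure {x. \<phi> x \<noteq> 0}" using assms(3) by (intro closure_mono) auto
  with assms(1,2) show ?thesis unfolding test_functions_iff
    by (metis bounded_subset closure_closure compact_closure compact_imp_bounded subset_trans)
qed

lemma test_supportI:
  assumes "smooth \<psi>" "compact K" "K \<subseteq> \<Omega>" "\<And>x. x \<notin> K \<Longrightarrow> \<psi> x = 0"
  shows "\<psi> \<in> test_functions \<Omega>"
proof -
  have "closure {x. \<psi> x \<noteq> 0} \<subseteq> K"
    using assms(2,4) by (intro closure_minimal) (auto intro: compact_imp_closed)
  moreover from this have "compact (closure {x. \<psi> x \<noteq> 0})"
    using assms(2) by (metis bounded_subset closure_closure closure_subset compact_closure compact_imp_bounded)
  ultimately show ?thesis using assms(1,3) by (auto simp: test_functions_iff)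
qed

lemma test_outside: "\<phi> \<in> test_functions \<Omega> \<Longrightarrow> x \<notin> \<Omega> \<Longrightarrow> \<phi> x = 0"
  using closure_subset[of "{x. \<phi> x \<noteq> 0}"] by (auto simp: test_functions_iff)

lemma partial_outside_support:
  assumes "x \<notin> closure {x. \<phi> x \<noteq> 0}" shows "partial i \<phi> x = 0"
proof -
  have "(\<phi> has_derivative (\<lambda>h. 0)) (at x)"
    by (rule has_derivative_transform_within_open[where f="\<lambda>_. 0" and s="- closure {x. \<phi> x \<noteq> 0}"])
       (use assms closure_subset[of "{x. \<phi> x \<noteq> 0}"] in \<open>auto simp: open_Compl\<close>)
  then show ?thesis by (rule partial_eq)
qed

lemma test_partial [intro]: "\<phi> \<in> test_functions \<Omega> \<Longrightarrow> i \<in> Basis \<Longrightarrow> partial i \<phi> \<in> test_functions \<Omega>"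
  by (rule test_supportI[where K="closure {x. \<phi> x \<noteq> 0}"])
     (auto simp: test_functions_iff partial_outside_support)

lemma partial_outside: "\<phi> \<in> test_functions \<Omega> \<Longrightarrow> x \<notin> \<Omega> \<Longrightarrow> partial i \<phi> x = 0"
  by (rule partial_outside_support) (auto simp: test_functions_iff)

lemma test_zero [intro, simp]: "(\<lambda>x. 0) \<in> test_functions \<Omega>"
  by (simp add: test_functions_iff)

lemma test_mult [intro]: "\<phi> \<in> test_functions \<Omega> \<Longrightarrow> smooth g \<Longrightarrow> (\<lambda>x. \<phi> x * g x) \<in> test_functions \<Omega>"
  by (rule test_supported[where \<phi>=\<phi>]) (auto simp: test_functions_iff)

lemma test_add [intro]:
  assumes "\<phi> \<in> test_functions \<Omega>" "\<psi> \<in> test_functions \<Omega>"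
  shows "(\<lambda>x. \<phi> x + \<psi> x) \<in> test_functions \<Omega>"
proof (rule test_supportI)
  show "compact (closure {x. \<phi> x \<noteq> 0} \<union> closure {x. \<psi> x \<noteq> 0})"
    using assms by (auto simp: test_functions_iff)
  show "\<phi> x + \<psi> x = 0" if "x \<notin> closure {x. \<phi> x \<noteq> 0} \<union> closure {x. \<psi> x \<noteq> 0}" for x
    using that by (metis (mono_tags, lifting) UnCI add_0 closure_subset mem_Collect_eq subsetD)
qed (use assms in \<open>auto simp: test_functions_iff\<close>)

lemma test_cmult [intro]: "\<phi> \<in> test_functions \<Omega> \<Longrightarrow> (\<lambda>x. c * \<phi> x) \<in> test_functions \<Omega>"
  using test_mult[of \<phi> \<Omega> "\<lambda>_. c"] by (simp add: mult.commute)

lemma test_diff [intro]: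
  "\<phi> \<in> test_functions \<Omega> \<Longrightarrow> \<psi> \<in> test_functions \<Omega> \<Longrightarrow> (\<lambda>x. \<phi> x - \<psi> x) \<in> test_functions \<Omega>"
  using test_add[of \<phi> \<Omega> "\<lambda>x. (-1) * \<psi> x"] test_cmult[of \<psi> \<Omega> "-1"] by simp

lemma test_translate: "\<phi> \<in> test_functions UNIV \<Longrightarrow> (\<lambda>x. \<phi> (x + a)) \<in> test_functions UNIV"
proof (rule test_supportI)
  assume \<phi>: "\<phi> \<in> test_functions UNIV"
  then show "smooth (\<lambda>x. \<phi> (x + a))" by (auto intro: smooth_translate test_smooth)
  show "compact ((\<lambda>x. - a + x) ` closure {x. \<phi> x \<noteq> 0})"
    using \<phi> by (intro compact_translation) (auto simp: test_functions_iff)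
  show "\<phi> (x + a) = 0" if "x \<notin> (\<lambda>x. - a + x) ` closure {x. \<phi> x \<noteq> 0}" for x
  proof (rule ccontr)
    assume "\<phi> (x + a) \<noteq> 0"
    then have "x + a \<in> closure {x. \<phi> x \<noteq> 0}" using closure_subset[of "{x. \<phi> x \<noteq> 0}"] by auto
    then have "- a + (x + a) \<in> (\<lambda>x. - a + x) ` closure {x. \<phi> x \<noteq> 0}" by (rule imageI)
    with that show False by simp
  qed
qed simp

text \<open>
  A smooth nondecreasing function vanishing exactly on \<open>[-M, M]\<close> stands in for the truncation at
  height \<open>M\<close>: composed with a test function it yields a test function again.
\<close>

lemma test_flat: 
  assumes \<phi>: "\<phi> \<in> test_functions \<Omega>" and M: "0 \<le> M"
  shows "(\<lambda>x. flat (\<phi> x - M) - flat (- \<phi> x - M)) \<in> test_functions \<Omega>"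
proof (rule test_supported[OF _ \<phi>])
  show "smooth (\<lambda>x. flat (\<phi> x - M) - flat (- \<phi> x - M))"
    using test_smooth[OF \<phi>] by (intro smooth_diff smooth_flat smooth_minus smooth_const)
qed (use M in \<open>simp add: flat_eq\<close>)

lemma test_bounded:
  assumes "\<phi> \<in> test_functions \<Omega>" obtains B where "0 < B" "\<And>x. \<bar>\<phi> x\<bar> \<le> B"
proof -
  let ?K = "closure {x. \<phi> x \<noteq> 0}"
  have "compact (\<phi> ` ?K)"
    using assms by (intro compact_continuous_image continuous_on_subset[OF smooth_continuous])
      (auto simp: test_functions_iff)
  then obtain B where B: "0 < B" "\<And>x. x \<in> ?K \<Longrightarrow> \<bar>\<phi> x\<bar> \<le> B"
    using bounded_pos[of "\<phi> ` ?K"] by (auto dest: compact_imp_bounded)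
  have "\<bar>\<phi> x\<bar> \<le> B" for x
    using B closure_subset[of "{x. \<phi> x \<noteq> 0}"] by (cases "\<phi> x = 0") auto
  with B(1) show thesis by (rule that)
qed

lemma test_support_ball:
  assumes "\<phi> \<in> test_functions \<Omega>" obtains R where "0 < R" "\<And>x. R < norm x \<Longrightarrow> \<phi> x = 0"
proof -
  have "bounded {x. \<phi> x \<noteq> 0}"
    using assms by (metis bounded_subset closure_subset compact_imp_bounded test_functions_iff)
  then obtain R where "0 < R" "\<And>x. \<phi> x \<noteq> 0 \<Longrightarrow> norm x \<le> R"
    using bounded_pos[of "{x. \<phi> x \<noteq> 0}"] by auto
  then show thesis using that by (metis linorder_not_le)
qed

lemma smooth_measurable: "smooth \<phi> \<Longrightarrow> \<phi> \<in> borel_measurable (lebesgue_on \<Omega>)"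
  using borel_measurable_continuous_onI[OF smooth_continuous, of \<phi>]
  by (intro measurable_restrict_space1) (auto intro: measurable_completion)

lemma test_measurable: "\<phi> \<in> test_functions \<Omega>' \<Longrightarrow> \<phi> \<in> borel_measurable (lebesgue_on \<Omega>)"
  by (intro smooth_measurable test_smooth)


text \<open>
  The shift by \<open>1\<close> keeps the support at distance \<open>1/n\<close> from the boundary of the box, so that it is
  a compact subset of the open box.
\<close>

definition box_bump :: "nat \<Rightarrow> 'a::euclidean_space \<Rightarrow> 'a \<Rightarrow> 'a \<Rightarrow> real" where
  "box_bump n a b x =
     (\<Prod>i\<in>Basis. flat (real n * (x \<bullet> i - a \<bullet> i) - 1) * flat (real n * (b \<bullet> i - x \<bullet> i) - 1))"

lemma box_bump_nonneg: "0 \<le> box_bump n a b x" and box_bump_le_1: "box_bump n a b x \<le> 1"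
  by (auto simp: box_bump_def flat_le_1 intro!: prod_nonneg prod_le_1 mult_le_one)

lemma box_bump_tendsto:
  fixes x :: "'a::euclidean_space"
  assumes "x \<in> box a b" shows "(\<lambda>n. box_bump n a b x) \<longlonglongrightarrow> 1"
proof -
  have *: "(\<lambda>n. flat (real n * c - 1)) \<longlonglongrightarrow> 1" if c: "0 < c" for c
  proof -
    have at: "filterlim (\<lambda>n. real n * c - 1) at_top sequentially"
      using c by real_asymp
    have "((\<lambda>t::real. exp (- 1 / t)) \<longlongrightarrow> 1) at_top" by real_asymp
    then have "(flat \<longlongrightarrow> 1) at_top"
      by (rule Lim_transform_eventually) (auto simp: flat_eq eventually_at_top_dense)
    then show ?thesis using at by (rule filterlim_compose)
  qed
  have "(\<lambda>n. box_bump n a b x) \<longlonglongrightarrow> (\<Prod>i\<in>(Basis::'a set). 1 * 1)"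
    unfolding box_bump_def
  proof (rule tendsto_prod)
    fix i :: 'a assume "i \<in> Basis"
    then have "0 < x \<bullet> i - a \<bullet> i" "0 < b \<bullet> i - x \<bullet> i" using assms by (auto simp: mem_box)
    then show "(\<lambda>n. flat (real n * (x \<bullet> i - a \<bullet> i) - 1) * flat (real n * (b \<bullet> i - x \<bullet> i) - 1)) \<longlonglongrightarrow> 1 * 1"
      by (intro tendsto_mult *)
  qed
  then show ?thesis by simp
qed

lemma box_bump_test: "box_bump n a b \<in> test_functions (box a b)"
proof (rule test_supportI)
  show "smooth (box_bump n a b)"
    unfolding box_bump_def
    by (intro smooth_prod smooth_mult smooth_flat smooth_diff smooth_const smooth_coord)
  let ?K = "if n = 0 then {} else cbox (a + (1 / real n) *\<^sub>R One) (b - (1 / real n) *\<^sub>R One)"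
  show "compact ?K" by auto
  have pos: "0 < 1 / real n" if "n \<noteq> 0" using that by simp
  show "?K \<subseteq> box a b"
  proof (cases "n = 0")
    case False
    show ?thesis
    proof
      fix x assume "x \<in> ?K"
      then have x: "a \<bullet> i + 1 / real n \<le> x \<bullet> i" "x \<bullet> i \<le> b \<bullet> i - 1 / real n" if "i \<in> Basis" for i
        using False that by (auto simp: mem_box inner_simps)
      show "x \<in> box a b" unfolding mem_box
        using x pos[OF False] by (smt (verit))
    qed
  qed simp
  show "box_bump n a b x = 0" if x: "x \<notin> ?K" for x
  proof (cases "n = 0")
    case True
    then show ?thesis by (simp add: box_bump_def flat_eq)
  next
    case False
    then obtain i where i: "i \<in> Basis" "x \<bullet> i < a \<bullet> i + 1 / real n \<or> b \<bullet> i - 1 / real n < x \<bullet> i"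
      using x by (auto simp: mem_box inner_simps not_le)
    then have "real n * (x \<bullet> i - a \<bullet> i) < 1 \<or> real n * (b \<bullet> i - x \<bullet> i) < 1"
      using False by (auto simp: field_simps)
    then have "flat (real n * (x \<bullet> i - a \<bullet> i) - 1) * flat (real n * (b \<bullet> i - x \<bullet> i) - 1) = 0"
      by (auto simp: flat_eq)
    with i(1) show ?thesis unfolding box_bump_def by (metis (mono_tags, lifting) finite_Basis prod_zero)
  qed
qed

text \<open>
  An open set is a countable union of open boxes; \<open>1 - \<Prod>j<n. (1 - \<beta> n j)\<close> combines the bumps of the
  first \<open>n\<close> boxes without leaving the interval \<open>[0, 1]\<close>.
\<close>

lemma open_set_bumps:
  fixes U :: "'a::euclidean_space set"
  assumes "open U"
  obtains \<zeta> :: "nat \<Rightarrow> 'a \<Rightarrow> real" where "\<And>n. \<zeta> n \<in> test_functions U"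
    "\<And>n x. 0 \<le> \<zeta> n x" "\<And>n x. \<zeta> n x \<le> 1" "\<And>x. (\<lambda>n. \<zeta> n x) \<longlonglongrightarrow> indicator U x"
proof (cases "U = {}")
  case True
  then show thesis using that[of "\<lambda>n x. 0"] by simp
next
  case False
  obtain \<D> where \<D>: "countable \<D>" "\<D> \<subseteq> Pow U" "\<And>X. X \<in> \<D> \<Longrightarrow> \<exists>a b. X = box a b" "\<Union>\<D> = U"
    using open_countable_Union_open_box[OF assms] by metis
  with False have "\<D> \<noteq> {}" by auto
  then have range: "range (from_nat_into \<D>) = \<D>" using \<D>(1) by (rule range_from_nat_into)
  then have "\<exists>a b. from_nat_into \<D> j = box a b" for j
    using \<D>(3)[of "from_nat_into \<D> j"] range by (metis rangeI)
  then obtain a b where ab: "\<And>j. from_nat_into \<D> j = box (a j) (b j)" by metis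
  have box: "box (a j) (b j) \<subseteq> U" for j using range \<D>(2) ab by (metis PowD rangeI subsetD)
  have U: "\<exists>j. x \<in> box (a j) (b j)" if "x \<in> U" for x
    using that \<D>(4) range ab by (metis UnionE imageE)
  define \<beta> where "\<beta> n j x = box_bump n (a j) (b j) x" for n j x
  have \<beta>: "0 \<le> \<beta> n j x" "\<beta> n j x \<le> 1" for n j x
    by (simp_all add: \<beta>_def box_bump_nonneg box_bump_le_1)
  have \<beta>_test: "\<beta> n j \<in> test_functions U" for n j
    using test_mono[OF box[of j] box_bump_test[of n "a j" "b j"]] by (simp add: \<beta>_def[abs_def])
  define \<zeta> where "\<zeta> n x = 1 - (\<Prod>j<n. 1 - \<beta> n j x)" for n x
  have test: "(\<lambda>x. 1 - (\<Prod>j<k. 1 - \<beta> n j x)) \<in> test_functions U" for k n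
  proof (induction k)
    case (Suc k)
    have "(\<lambda>x. (1 - (\<Prod>j<k. 1 - \<beta> n j x)) + \<beta> n k x * (1 - (1 - (\<Prod>j<k. 1 - \<beta> n j x)))) \<in> test_functions U"
      by (intro test_add test_mult smooth_diff smooth_const Suc test_smooth[OF Suc] \<beta>_test)
    moreover have "(\<lambda>x. (1 - (\<Prod>j<k. 1 - \<beta> n j x)) + \<beta> n k x * (1 - (1 - (\<Prod>j<k. 1 - \<beta> n j x))))
      = (\<lambda>x. 1 - (\<Prod>j<Suc k. 1 - \<beta> n j x))"
      by (auto simp: algebra_simps)
    ultimately show ?case by simp
  qed simp
  have P: "0 \<le> (\<Prod>j<n. 1 - \<beta> n j x)" "(\<Prod>j<n. 1 - \<beta> n j x) \<le> 1" for n x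
    using \<beta> by (auto intro!: prod_nonneg prod_le_1)
  show thesis
  proof
    show \<zeta>_test: "\<zeta> n \<in> test_functions U" for n using test[where k=n and n=n] by (simp add: \<zeta>_def[abs_def])
    show "(\<lambda>n. \<zeta> n x) \<longlonglongrightarrow> indicator U x" for x
    proof (cases "x \<in> U")
      case True
      then obtain j where "x \<in> box (a j) (b j)" using U by blast
      then have lim: "(\<lambda>n. \<beta> n j x) \<longlonglongrightarrow> 1" unfolding \<beta>_def by (rule box_bump_tendsto)
      have "(\<lambda>n. \<zeta> n x) \<longlonglongrightarrow> 1"
      proof (rule tendsto_sandwich[OF _ _ lim tendsto_const])
        show "\<forall>\<^sub>F n in sequentially. \<beta> n j x \<le> \<zeta> n x"
        proof (rule eventually_sequentiallyI[of "Suc j"])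
          fix n assume "Suc j \<le> n"
          then have "(\<Prod>i<n. 1 - \<beta> n i x) = (1 - \<beta> n j x) * (\<Prod>i\<in>{..<n} - {j}. 1 - \<beta> n i x)"
            by (intro prod.remove) auto
          also have "\<dots> \<le> (1 - \<beta> n j x) * 1"
            using \<beta> by (intro mult_left_mono prod_le_1) auto
          finally show "\<beta> n j x \<le> \<zeta> n x" by (simp add: \<zeta>_def)
        qed
      qed (use P in \<open>auto simp: \<zeta>_def\<close>)
      with True show ?thesis by simp
    qed (simp add: test_outside[OF \<zeta>_test])
  qed (use P in \<open>auto simp: \<zeta>_def\<close>)
qed

lemma test_measurable_lebesgue: "\<phi> \<in> test_functions \<Omega> \<Longrightarrow> \<phi> \<in> borel_measurable lebesgue"
  using test_measurable[of \<phi> \<Omega> UNIV] by (simp add: lebesgue_on_UNIV_eq)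

text \<open>
  By outer regularity a set of finite measure differs little from an open set, whose indicator is
  the limit of bumps. The range \<open>[0, 1]\<close> serves as the dominating bound in later limits.
\<close>

lemma test_approx_indicator:
  fixes A :: "'a::euclidean_space set"
  assumes "open \<Omega>" and A: "A \<in> lmeasurable" "A \<subseteq> \<Omega>"
  obtains \<zeta> :: "nat \<Rightarrow> 'a \<Rightarrow> real" where "\<And>n. \<zeta> n \<in> test_functions \<Omega>"
    "\<And>n x. 0 \<le> \<zeta> n x" "\<And>n x. \<zeta> n x \<le> 1"
    "\<And>n. integrable lebesgue (\<lambda>x. \<bar>\<zeta> n x - indicator A x\<bar>)"
    "(\<lambda>n. LINT x|lebesgue. \<bar>\<zeta> n x - indicator A x\<bar>) \<longlonglongrightarrow> 0"
    "AE x in lebesgue. (\<lambda>n. \<zeta> n x) \<longlonglongrightarrow> indicator A x"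
proof -
  define close :: "real \<Rightarrow> ('a \<Rightarrow> real) \<Rightarrow> bool" where
    "close e \<zeta> \<longleftrightarrow> \<zeta> \<in> test_functions \<Omega> \<and> (\<forall>x. 0 \<le> \<zeta> x \<and> \<zeta> x \<le> 1) \<and>
      integrable lebesgue (\<lambda>x. \<bar>\<zeta> x - indicator A x\<bar>) \<and>
      (LINT x|lebesgue. \<bar>\<zeta> x - indicator A x\<bar>) < e" for e \<zeta>
  have close: "\<exists>\<zeta>. close e \<zeta>" if e: "0 < e" for e
  proof -
    have "A \<in> sets lebesgue" using A by auto
    then obtain T where T: "open T" "A \<subseteq> T" "T - A \<in> lmeasurable" "emeasure lebesgue (T - A) < ennreal (e/2)"
      using sets_lebesgue_outer_open[of A "e/2"] e by auto
    define U where "U = T \<inter> \<Omega>"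
    have U: "open U" "A \<subseteq> U" "U \<subseteq> \<Omega>" using T assms by (auto simp: U_def)
    have "U - A = (T - A) \<inter> \<Omega>" by (auto simp: U_def)
    then have UA: "U - A \<in> lmeasurable"
      using T(3) \<open>open \<Omega>\<close> by (metis fmeasurable_Int_fmeasurable lmeasurable_open sets_completionI_sets borel_open sets_lborel)
    have "measure lebesgue (U - A) \<le> measure lebesgue (T - A)"
      using T(3) UA by (intro measure_mono_fmeasurable) (auto simp: U_def)
    also have "\<dots> < e/2" using T(3,4) e
      by (metis emeasure_eq_measure2 ennreal_less_iff measure_nonneg)
    finally have small: "measure lebesgue (U - A) < e/2" .
    have Um: "U \<in> lmeasurable"
      using fmeasurable.Un[OF A(1) UA] U(2) by (simp add: Un_absorb1)
    obtain \<zeta> where \<zeta>: "\<And>n. \<zeta> n \<in> test_functions U" "\<And>n x. 0 \<le> \<zeta> n x" "\<And>n x. \<zeta> n x \<le> 1"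
        "\<And>x. (\<lambda>n. \<zeta> n x) \<longlonglongrightarrow> indicator U x"
      by (rule open_set_bumps[OF U(1)]) (rule that)
    have [measurable]: "\<zeta> n \<in> borel_measurable lebesgue" for n using \<zeta>(1) by (rule test_measurable_lebesgue)
    have [measurable]: "U \<in> sets lebesgue" "A \<in> sets lebesgue" using Um A by auto
    have iU: "integrable lebesgue (indicator U :: 'a \<Rightarrow> real)"
      using Um by (intro integrable_real_indicator) (auto simp: fmeasurable_def)
    have bd: "\<bar>\<zeta> n x - indicator A x\<bar> \<le> indicator U x" for n x
      using \<zeta>(2,3)[of n x] test_outside[OF \<zeta>(1), of x n] U(2) by (auto simp: indicator_def)
    have int: "integrable lebesgue (\<lambda>x. \<bar>\<zeta> n x - indicator A x\<bar>)" for n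
      by (rule Bochner_Integration.integrable_bound[OF iU]) (use bd in auto)
    have "(\<lambda>n. LINT x|lebesgue. \<bar>\<zeta> n x - indicator A x\<bar>) \<longlonglongrightarrow> (LINT x|lebesgue. \<bar>indicator U x - indicator A x\<bar>)"
    proof (rule integral_dominated_convergence[OF _ _ iU])
      show "AE x in lebesgue. (\<lambda>n. \<bar>\<zeta> n x - indicator A x\<bar>) \<longlonglongrightarrow> \<bar>indicator U x - indicator A x\<bar>"
        using \<zeta>(4) by (auto intro!: tendsto_intros)
    qed (use bd in auto)
    also have "(LINT x|lebesgue. \<bar>indicator U x - indicator A x :: real\<bar>) = (LINT x|lebesgue. indicator (U - A) x)"
      using U(2) by (intro Bochner_Integration.integral_cong) (auto simp: indicator_def)
    also have "\<dots> = measure lebesgue (U - A)" using UA by simp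
    finally have "\<forall>\<^sub>F n in sequentially. (LINT x|lebesgue. \<bar>\<zeta> n x - indicator A x\<bar>) < e"
      by (rule order_tendstoD(2)) (use small e in simp)
    then obtain n where "(LINT x|lebesgue. \<bar>\<zeta> n x - indicator A x\<bar>) < e"
      by (auto simp: eventually_sequentially)
    then have "close e (\<zeta> n)"
      using \<zeta>(2,3) int test_mono[OF U(3) \<zeta>(1)] by (simp add: close_def)
    then show ?thesis by blast
  qed
  have "\<exists>\<zeta>. close (1 / real (Suc n)) \<zeta>" for n by (rule close) simp
  then obtain \<zeta> where close_\<zeta>: "\<And>n. close (1 / real (Suc n)) (\<zeta> n)" by metis
  then have \<zeta>: "\<And>n. \<zeta> n \<in> test_functions \<Omega>" "\<And>n x. 0 \<le> \<zeta> n x" "\<And>n x. \<zeta> n x \<le> 1"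
    "\<And>n. integrable lebesgue (\<lambda>x. \<bar>\<zeta> n x - indicator A x\<bar>)"
    "\<And>n. (LINT x|lebesgue. \<bar>\<zeta> n x - indicator A x\<bar>) < 1 / real (Suc n)"
    by (simp_all add: close_def)
  have lim: "(\<lambda>n. LINT x|lebesgue. \<bar>\<zeta> n x - indicator A x\<bar>) \<longlonglongrightarrow> 0"
    by (rule tendsto_sandwich[OF _ _ tendsto_const LIMSEQ_Suc[OF lim_1_over_n]])
       (use \<zeta>(5) in \<open>auto intro!: always_eventually less_imp_le\<close>)
  have [measurable]: "\<zeta> n \<in> borel_measurable lebesgue" for n using \<zeta>(1) by (rule test_measurable_lebesgue)
  have [measurable]: "A \<in> sets lebesgue" using A by auto
  have int: "integrable lebesgue (\<lambda>x. \<zeta> n x - indicator A x)" for n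
    by (rule integrable_norm_cancel) (use \<zeta>(4) in auto)
  obtain r :: "nat \<Rightarrow> nat" where r: "strict_mono r" "AE x in lebesgue. (\<lambda>n. \<zeta> (r n) x - indicator A x) \<longlonglongrightarrow> 0"
    using tendsto_L1_AE_subseq[of lebesgue "\<lambda>n x. \<zeta> n x - indicator A x", OF int] lim by auto
  show thesis
  proof (rule that[of "\<lambda>n. \<zeta> (r n)"])
    show "(\<lambda>n. LINT x|lebesgue. \<bar>\<zeta> (r n) x - indicator A x\<bar>) \<longlonglongrightarrow> 0"
      using LIMSEQ_subseq_LIMSEQ[OF lim r(1)] by (simp add: o_def)
    show "AE x in lebesgue. (\<lambda>n. \<zeta> (r n) x) \<longlonglongrightarrow> indicator A x"
      using r(2) by eventually_elim (simp add: LIM_zero_iff)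
  qed (use \<zeta> in auto)
qed

lemma open_sets_lebesgue [simp]: "open \<Omega> \<Longrightarrow> \<Omega> \<in> sets lebesgue"
  by (metis borel_open sets_completionI_sets sets_lborel)

text \<open>
  The fundamental lemma of the calculus of variations in a form with signs: test functions
  approximate the indicator of the part of \<open>{q < 0}\<close> in a ball, so \<open>q\<close> has nonnegative integral
  over this part. The restriction to balls makes its measure finite.
\<close>

lemma AE_nonneg_if_test_nonneg:
  fixes q :: "'a::euclidean_space \<Rightarrow> real"
  assumes \<Omega>: "open \<Omega>" and q: "integrable (lebesgue_on \<Omega>) q"
    and test: "\<And>\<zeta>. \<zeta> \<in> test_functions \<Omega> \<Longrightarrow> (\<And>x. 0 \<le> \<zeta> x) \<Longrightarrow> (\<And>x. \<zeta> x \<le> 1) \<Longrightarrow>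
      0 \<le> (LINT x|lebesgue_on \<Omega>. q x * \<zeta> x)"
  shows "AE x in lebesgue_on \<Omega>. 0 \<le> q x"
proof -
  have [measurable]: "q \<in> borel_measurable (lebesgue_on \<Omega>)" using q by auto
  have "AE x in lebesgue_on \<Omega>. x \<in> ball 0 (real n) \<longrightarrow> 0 \<le> q x" for n
  proof -
    define A where "A = {x \<in> space (lebesgue_on \<Omega>). q x < 0} \<inter> ball 0 (real n)"
    have "{x \<in> space (lebesgue_on \<Omega>). q x < 0} \<in> sets (lebesgue_on \<Omega>)" by measurable
    then have "{x \<in> space (lebesgue_on \<Omega>). q x < 0} \<in> sets lebesgue"
      using \<Omega> by (auto simp: sets_restrict_space_iff)
    then have Am: "A \<in> lmeasurable"
      unfolding A_def by (intro bounded_set_imp_lmeasurable) (auto intro: bounded_Int)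
    have A\<Omega>: "A \<subseteq> \<Omega>" by (auto simp: A_def)
    obtain \<zeta> where \<zeta>: "\<And>n. \<zeta> n \<in> test_functions \<Omega>" "\<And>n x. 0 \<le> \<zeta> n x" "\<And>n x. \<zeta> n x \<le> 1"
      "\<And>n. integrable lebesgue (\<lambda>x. \<bar>\<zeta> n x - indicator A x\<bar>)"
      "(\<lambda>n. LINT x|lebesgue. \<bar>\<zeta> n x - indicator A x\<bar>) \<longlonglongrightarrow> 0"
      "AE x in lebesgue. (\<lambda>n. \<zeta> n x) \<longlonglongrightarrow> indicator A x"
      by (rule test_approx_indicator[OF \<Omega> Am A\<Omega>]) (rule that)
    have [measurable]: "\<zeta> n \<in> borel_measurable (lebesgue_on \<Omega>)" for n using \<zeta>(1) by (rule test_measurable)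
    have [measurable]: "A \<in> sets (lebesgue_on \<Omega>)"
      using Am A\<Omega> \<Omega> by (auto simp: sets_restrict_space_iff)
    have "(\<lambda>n. LINT x|lebesgue_on \<Omega>. q x * \<zeta> n x) \<longlonglongrightarrow> (LINT x|lebesgue_on \<Omega>. q x * indicator A x)"
    proof (rule integral_dominated_convergence[where w="\<lambda>x. \<bar>q x\<bar>"])
      have "AE x in lebesgue_on \<Omega>. (\<lambda>n. \<zeta> n x) \<longlonglongrightarrow> indicator A x"
        using \<zeta>(6) \<Omega> by (auto simp: AE_restrict_space_iff elim!: eventually_mono)
      then show "AE x in lebesgue_on \<Omega>. (\<lambda>n. q x * \<zeta> n x) \<longlonglongrightarrow> q x * indicator A x"
        by eventually_elim (intro tendsto_intros)
      show "AE x in lebesgue_on \<Omega>. norm (q x * \<zeta> n x) \<le> \<bar>q x\<bar>" for n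
        using \<zeta>(2,3) by (auto simp: abs_mult mult_left_le)
    qed (use q in auto)
    then have "0 \<le> (LINT x|lebesgue_on \<Omega>. q x * indicator A x)"
      by (rule LIMSEQ_le_const) (use test \<zeta> in auto)
    moreover have int: "integrable (lebesgue_on \<Omega>) (\<lambda>x. - (q x * indicator A x))"
      by (rule Bochner_Integration.integrable_bound[OF q]) (auto simp: indicator_def)
    moreover have nonneg: "0 \<le> - (q x * indicator A x)" for x by (auto simp: A_def indicator_def)
    ultimately have "(LINT x|lebesgue_on \<Omega>. - (q x * indicator A x)) = 0"
      using Bochner_Integration.integral_nonneg[of "lebesgue_on \<Omega>" "\<lambda>x. - (q x * indicator A x)"] by simp
    then have "AE x in lebesgue_on \<Omega>. - (q x * indicator A x) = 0"
      using integral_nonneg_eq_0_iff_AE[OF int] nonneg by auto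
    with AE_space show ?thesis
      by eventually_elim (auto simp: A_def indicator_def split: if_splits)
  qed
  then have "AE x in lebesgue_on \<Omega>. \<forall>n::nat. x \<in> ball 0 (real n) \<longrightarrow> 0 \<le> q x"
    unfolding AE_all_countable by blast
  then show ?thesis
  proof eventually_elim
    case (elim x)
    obtain n where "norm x < real n" using reals_Archimedean2 by blast
    with elim show ?case by auto
  qed
qed

lemma AE_zero_if_test_zero:
  fixes q :: "'a::euclidean_space \<Rightarrow> real"
  assumes \<Omega>: "open \<Omega>" and q: "integrable (lebesgue_on \<Omega>) q"
    and test: "\<And>\<zeta>. \<zeta> \<in> test_functions \<Omega> \<Longrightarrow> (LINT x|lebesgue_on \<Omega>. q x * \<zeta> x) = 0"
  shows "AE x in lebesgue_on \<Omega>. q x = 0"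
proof -
  have "AE x in lebesgue_on \<Omega>. 0 \<le> q x"
    by (rule AE_nonneg_if_test_nonneg[OF \<Omega> q]) (simp add: test)
  moreover have "AE x in lebesgue_on \<Omega>. 0 \<le> - q x"
    by (rule AE_nonneg_if_test_nonneg[OF \<Omega>]) (use q in \<open>simp_all add: test\<close>)
  ultimately show ?thesis by eventually_elim simp
qed

section \<open>Difference quotients and integration by parts\<close>

lemma lebesgue_translate:
  shows measurable_lebesgue_translate: "(\<lambda>x. x + a) \<in> lebesgue \<rightarrow>\<^sub>M lebesgue"
    and distr_lebesgue_translate: "distr lebesgue lebesgue (\<lambda>x. x + a) = (lebesgue :: 'a::euclidean_space measure)"
proof -
  have T: "(\<lambda>x. a + (\<Sum>j\<in>Basis. (1 * (x \<bullet> j)) *\<^sub>R j)) = (\<lambda>x. x + a)"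
    by (simp add: euclidean_representation add.commute)
  show "(\<lambda>x. x + a) \<in> lebesgue \<rightarrow>\<^sub>M lebesgue"
    using lebesgue_affine_measurable[of "\<lambda>_. 1" a] unfolding T by simp
  show "distr lebesgue lebesgue (\<lambda>x. x + a) = (lebesgue :: 'a measure)"
    using lebesgue_affine_euclidean[of "\<lambda>_. 1" a] unfolding T by (simp add: density_1)
qed

lemma measurable_translate:
  "u \<in> borel_measurable lebesgue \<Longrightarrow> (\<lambda>x. u (x + a)) \<in> borel_measurable lebesgue"
  by (rule measurable_compose[OF measurable_lebesgue_translate])

lemma integral_translate:
  fixes u :: "'a::euclidean_space \<Rightarrow> real"
  assumes "u \<in> borel_measurable lebesgue"
  shows "(LINT x|lebesgue. u (x + a)) = (LINT x|lebesgue. u x)"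
  using integral_distr[OF measurable_lebesgue_translate assms, of a]
  by (simp add: distr_lebesgue_translate)

lemma integrable_translate:
  fixes u :: "'a::euclidean_space \<Rightarrow> real"
  assumes "integrable lebesgue u"
  shows "integrable lebesgue (\<lambda>x. u (x + a))"
  using integrable_distr[OF measurable_lebesgue_translate[of a], of u] assms
  by (simp add: distr_lebesgue_translate)

lemma sq_int_translate [intro]:
  "sq_int lebesgue u \<Longrightarrow> sq_int lebesgue (\<lambda>x. u (x + a))"
  unfolding sq_int_def
  using measurable_translate integrable_translate[of "\<lambda>x. (norm (u x))\<^sup>2" a] by auto

lemma ip_translate:
  assumes "sq_int lebesgue u" "sq_int lebesgue v"
  shows "ip lebesgue (\<lambda>x. u (x + a)) (\<lambda>x. v (x + a)) = ip lebesgue u v"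
  unfolding ip_def
  using integral_translate[of "\<lambda>x. u x \<bullet> v x" a] integrable_inner[OF assms] by auto

lemma nrm_translate: "sq_int lebesgue u \<Longrightarrow> nrm lebesgue (\<lambda>x. u (x + a)) = nrm lebesgue u"
  using ip_translate[of u u a] by (metis nrm_nonneg nrm_sq power2_eq_imp_eq)

definition diff_quot :: "real \<Rightarrow> 'a \<Rightarrow> ('a::euclidean_space \<Rightarrow> 'b::euclidean_space) \<Rightarrow> 'a \<Rightarrow> 'b" where
  "diff_quot h i u x = (1 / h) *\<^sub>R (u (x + h *\<^sub>R i) - u x)"

lemma sq_int_diff_quot [intro]: "sq_int lebesgue u \<Longrightarrow> sq_int lebesgue (diff_quot h i u)"
  unfolding diff_quot_def by (intro sq_int_scale sq_int_diff sq_int_translate)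

lemma ip_diff_quot:
  assumes u: "sq_int lebesgue u" and v: "sq_int lebesgue v"
  shows "ip lebesgue u (diff_quot h i v) = - ip lebesgue (diff_quot (- h) i u) v"
proof -
  have "ip lebesgue u (\<lambda>x. v (x + h *\<^sub>R i)) = ip lebesgue (\<lambda>x. u (x - h *\<^sub>R i)) v"
    using ip_translate[OF u sq_int_translate[OF v, of "h *\<^sub>R i"], of "- h *\<^sub>R i"] by simp
  moreover have "sq_int lebesgue (\<lambda>x. u (x - h *\<^sub>R i))"
    using sq_int_translate[OF u, of "- h *\<^sub>R i"] by simp
  ultimately show ?thesis
    using ip_diff_right[OF sq_int_translate[OF v] v u, of "h *\<^sub>R i"] ip_diff_left[OF _ u v, of "\<lambda>x. u (x - h *\<^sub>R i)"]
    unfolding diff_quot_def by simp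
qed

lemma diff_quot_diff: "diff_quot h i (\<lambda>x. u x - v x) = (\<lambda>x. diff_quot h i u x - diff_quot h i v x)"
  by (auto simp: diff_quot_def algebra_simps)

lemma nrm_diff_quot_crude:
  assumes "sq_int lebesgue u" shows "nrm lebesgue (diff_quot h i u) \<le> 2 / \<bar>h\<bar> * nrm lebesgue u"
proof -
  have "nrm lebesgue (\<lambda>x. u (x + h *\<^sub>R i) - u x) \<le> nrm lebesgue u + nrm lebesgue u"
    using nrm_triangle[OF sq_int_translate[OF assms] sq_int_minus[OF assms], of "h *\<^sub>R i"] nrm_translate[OF assms, of "h *\<^sub>R i"]
    by simp
  then have "1 / \<bar>h\<bar> * nrm lebesgue (\<lambda>x. u (x + h *\<^sub>R i) - u x) \<le> 1 / \<bar>h\<bar> * (nrm lebesgue u + nrm lebesgue u)"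
    by (rule mult_left_mono) simp
  then show ?thesis unfolding diff_quot_def by simp
qed

lemma diff_quot_test [intro]: "\<phi> \<in> test_functions UNIV \<Longrightarrow> diff_quot h i \<phi> \<in> test_functions UNIV"
  unfolding diff_quot_def real_scaleR_def by (intro test_cmult test_diff test_translate)

lemma partial_cmult: "f differentiable_on UNIV \<Longrightarrow> partial i (\<lambda>x. c * f x) = (\<lambda>x. c * partial i f x)"
  using partial_mult[of "\<lambda>_. c" f i] by (simp add: partial_const)

lemma partial_diff:
  assumes "f differentiable_on UNIV" "g differentiable_on UNIV"
  shows "partial i (\<lambda>x. f x - g x) = (\<lambda>x. partial i f x - partial i g x)"
  using partial_eq[OF has_derivative_diff[OF has_derivative_frechet[OF assms(1)] has_derivative_frechet[OF assms(2)]]]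
  by (auto simp: partial_def)

lemma partial_diff_quot:
  assumes "smooth \<phi>" shows "partial j (diff_quot h i \<phi>) = diff_quot h i (partial j \<phi>)"
proof -
  have "smooth (\<lambda>x. \<phi> (x + h *\<^sub>R i))" using assms by (rule smooth_translate)
  then show ?thesis
    using assms unfolding diff_quot_def real_scaleR_def
    by (subst partial_cmult) (auto simp: partial_diff partial_translate smooth_differentiable)
qed

lemma smooth_deriv_along:
  assumes "smooth \<phi>"
  shows "((\<lambda>t. \<phi> (x + t *\<^sub>R i)) has_real_derivative partial i \<phi> (x + t *\<^sub>R i)) (at t)"
proof -
  have "((\<lambda>t. x + t *\<^sub>R i) has_derivative (\<lambda>h. h *\<^sub>R i)) (at t)"
    by (auto intro!: derivative_eq_intros)
  from has_derivative_compose[OF this smooth_has_derivative[OF assms]]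
  have "((\<lambda>t. \<phi> (x + t *\<^sub>R i)) has_derivative (\<lambda>h. frechet_derivative \<phi> (at (x + t *\<^sub>R i)) (h *\<^sub>R i))) (at t)" .
  moreover have "linear (frechet_derivative \<phi> (at (x + t *\<^sub>R i)))"
    using smooth_has_derivative[OF assms] by (rule has_derivative_linear)
  ultimately show ?thesis
    by (simp add: has_field_derivative_def partial_def linear_cmul mult_commute_abs)
qed

lemma diff_quot_tendsto:
  assumes "smooth \<phi>" "h \<longlonglongrightarrow> 0" "\<And>n. h n \<noteq> 0"
  shows "(\<lambda>n. diff_quot (h n) i \<phi> x) \<longlonglongrightarrow> partial i \<phi> x"
proof -
  have "((\<lambda>t. (\<phi> (x + t *\<^sub>R i) - \<phi> x) / t) \<longlongrightarrow> partial i \<phi> x) (at 0)"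
    using smooth_deriv_along[OF assms(1), of x i 0] by (simp add: has_field_derivative_iff)
  moreover have "filterlim h (at 0) sequentially"
    using assms(2,3) by (simp add: filterlim_at)
  ultimately have "(\<lambda>n. (\<phi> (x + h n *\<^sub>R i) - \<phi> x) / h n) \<longlonglongrightarrow> partial i \<phi> x"
    by (rule filterlim_compose)
  then show ?thesis by (simp add: diff_quot_def)
qed

lemma diff_quot_bound:
  assumes \<phi>: "\<phi> \<in> test_functions \<Omega>" and i: "i \<in> Basis"
  obtains B R where "\<And>h x. h \<noteq> 0 \<Longrightarrow> \<bar>h\<bar> \<le> 1 \<Longrightarrow> \<bar>diff_quot h i \<phi> x\<bar> \<le> B * indicator (cball 0 R) x"
    "\<And>x. \<bar>partial i \<phi> x\<bar> \<le> B * indicator (cball 0 R) x" "0 < B"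
proof -
  obtain B where B: "0 < B" "\<And>x. \<bar>partial i \<phi> x\<bar> \<le> B"
    using test_bounded[OF test_partial[OF \<phi> i]] by blast
  obtain R1 where R1: "0 < R1" "\<And>x. R1 < norm x \<Longrightarrow> \<phi> x = 0" using test_support_ball[OF \<phi>] by blast
  obtain R2 where R2: "0 < R2" "\<And>x. R2 < norm x \<Longrightarrow> partial i \<phi> x = 0"
    using test_support_ball[OF test_partial[OF \<phi> i]] by blast
  let ?R = "max (R1 + 1) R2"
  show thesis
  proof
    show "\<bar>partial i \<phi> x\<bar> \<le> B * indicator (cball 0 ?R) x" for x
      using B R2(2)[of x] by (auto simp: indicator_def)
    show "0 < B" by (rule B)
    fix h :: real and x :: 'a assume h: "h \<noteq> 0" "\<bar>h\<bar> \<le> 1"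
    show "\<bar>diff_quot h i \<phi> x\<bar> \<le> B * indicator (cball 0 ?R) x"
    proof (cases "norm x \<le> ?R")
      case True
      have "norm (\<phi> (x + h *\<^sub>R i) - \<phi> (x + 0 *\<^sub>R i)) \<le> B * norm (h - 0)"
      proof (rule field_differentiable_bound[of UNIV])
        show "((\<lambda>t. \<phi> (x + t *\<^sub>R i)) has_field_derivative partial i \<phi> (x + t *\<^sub>R i)) (at t within UNIV)" for t
          using smooth_deriv_along[OF test_smooth[OF \<phi>]] by simp
      qed (use B in auto)
      then have "\<bar>diff_quot h i \<phi> x\<bar> \<le> B" using h by (simp add: diff_quot_def abs_mult field_simps)
      with True show ?thesis by simp
    next
      case False
      have "norm x \<le> norm (x + h *\<^sub>R i) + norm (h *\<^sub>R i)"
        using norm_triangle_ineq4[of "x + h *\<^sub>R i" "h *\<^sub>R i"] by simp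
      also have "norm (h *\<^sub>R i) \<le> 1" using h i by simp
      finally have "R1 < norm (x + h *\<^sub>R i)" "R1 < norm x" using False by auto
      then show ?thesis using R1 False by (simp add: diff_quot_def)
    qed
  qed
qed

lemma integrable_const_cball: "integrable lebesgue (\<lambda>x. c * indicator (cball (0::'a::euclidean_space) R) x :: real)"
  using lmeasurable_cball[of "0::'a" R] by (simp add: lmeasurable_iff_integrable)

lemma test_sq_int_lebesgue:
  assumes "\<phi> \<in> test_functions \<Omega>" shows "sq_int lebesgue \<phi>"
proof -
  obtain B where B: "0 < B" "\<And>x. \<bar>\<phi> x\<bar> \<le> B" using test_bounded[OF assms] by blast
  obtain R where R: "0 < R" "\<And>x. R < norm x \<Longrightarrow> \<phi> x = 0" using test_support_ball[OF assms] by blast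
  show ?thesis
  proof (rule sq_int_dominated[OF test_measurable_lebesgue[OF assms] integrable_const_cball[of "B\<^sup>2" R]])
    have "(\<phi> x)\<^sup>2 \<le> B\<^sup>2" for x using B by (metis abs_ge_zero power2_abs power_mono)
    then show "AE x in lebesgue. (norm (\<phi> x))\<^sup>2 \<le> B\<^sup>2 * indicator (cball 0 R) x"
      using R by (intro AE_I2) (auto simp: indicator_def)
  qed
qed

lemma sq_int_restrict:
  assumes u: "sq_int lebesgue u" and \<Omega>: "\<Omega> \<in> sets lebesgue"
  shows "sq_int (lebesgue_on \<Omega>) u"
  unfolding sq_int_def
proof
  show "u \<in> borel_measurable (lebesgue_on \<Omega>)"
    using sq_int_measurable[OF u] by (rule measurable_restrict_space1)
  show "integrable (lebesgue_on \<Omega>) (\<lambda>x. (norm (u x))\<^sup>2)"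
    using sq_int_integrable[OF u] \<Omega>
    by (simp add: integrable_restrict_space integrable_mult_indicator del: real_scaleR_def)
qed

lemma test_sq_int [intro]:
  "\<phi> \<in> test_functions \<Omega>' \<Longrightarrow> open \<Omega> \<Longrightarrow> sq_int (lebesgue_on \<Omega>) \<phi>"
  by (intro sq_int_restrict test_sq_int_lebesgue) auto

lemma test_integrable_lebesgue:
  assumes "\<phi> \<in> test_functions \<Omega>" shows "integrable lebesgue \<phi>"
proof -
  obtain B where B: "0 < B" "\<And>x. \<bar>\<phi> x\<bar> \<le> B" using test_bounded[OF assms] by blast
  obtain R where R: "0 < R" "\<And>x. R < norm x \<Longrightarrow> \<phi> x = 0" using test_support_ball[OF assms] by blast
  show ?thesis
  proof (rule Bochner_Integration.integrable_bound[OF integrable_const_cball[of B R]])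
    show "\<phi> \<in> borel_measurable lebesgue" by (rule test_measurable_lebesgue[OF assms])
    show "AE x in lebesgue. norm (\<phi> x) \<le> norm (B * indicator (cball 0 R) x)"
      using R B by (intro AE_I2) (auto simp: indicator_def)
  qed
qed

lemma integral_supported:
  fixes F :: "'a::euclidean_space \<Rightarrow> real"
  assumes "\<Omega> \<in> sets lebesgue" "\<And>x. x \<notin> \<Omega> \<Longrightarrow> F x = 0"
  shows "(LINT x|lebesgue_on \<Omega>. F x) = (LINT x|lebesgue. F x)"
  using assms by (subst integral_restrict_space) (auto intro!: Bochner_Integration.integral_cong simp: indicator_def)

text \<open>
  Translation invariance makes the integral of every difference quotient vanish; dominated
  convergence passes to the derivative.
\<close>

lemma integral_partial_lebesgue:
  assumes \<phi>: "\<phi> \<in> test_functions \<Omega>" and i: "i \<in> Basis"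
  shows "(LINT x|lebesgue. partial i \<phi> x) = 0"
proof -
  obtain B R where B: "\<And>h x. h \<noteq> 0 \<Longrightarrow> \<bar>h\<bar> \<le> 1 \<Longrightarrow> \<bar>diff_quot h i \<phi> x\<bar> \<le> B * indicator (cball 0 R) x"
    using diff_quot_bound[OF \<phi> i] by metis
  have [measurable]: "\<phi> \<in> borel_measurable lebesgue" by (rule test_measurable_lebesgue[OF \<phi>])
  have \<phi>': "\<phi> \<in> test_functions UNIV" using \<phi> test_mono by blast
  have lim: "(\<lambda>n. LINT x|lebesgue. diff_quot (1 / Suc n) i \<phi> x) \<longlonglongrightarrow> (LINT x|lebesgue. partial i \<phi> x)"
  proof (rule integral_dominated_convergence[OF _ _ integrable_const_cball[of B R]])
    show "AE x in lebesgue. (\<lambda>n. diff_quot (1 / Suc n) i \<phi> x) \<longlonglongrightarrow> partial i \<phi> x"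
      by (intro AE_I2 diff_quot_tendsto test_smooth[OF \<phi>] LIMSEQ_Suc[OF lim_1_over_n]) auto
    show "partial i \<phi> \<in> borel_measurable lebesgue"
      by (rule test_measurable_lebesgue[OF test_partial[OF \<phi> i]])
    show "diff_quot (1 / Suc n) i \<phi> \<in> borel_measurable lebesgue" for n
      by (rule test_measurable_lebesgue[OF diff_quot_test[OF \<phi>']])
    show "AE x in lebesgue. norm (diff_quot (1 / Suc n) i \<phi> x) \<le> B * indicator (cball 0 R) x" for n
      using B by (intro AE_I2) auto
  qed
  have "(LINT x|lebesgue. diff_quot (1 / Suc n) i \<phi> x) = 0" for n
    using test_integrable_lebesgue[OF \<phi>] integrable_translate[OF test_integrable_lebesgue[OF \<phi>]]
      integral_translate[of \<phi> "(1 / Suc n) *\<^sub>R i"]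
    unfolding diff_quot_def by simp
  with lim show ?thesis by (simp add: LIMSEQ_const_iff)
qed

lemma integral_partial:
  assumes "\<phi> \<in> test_functions \<Omega>" "i \<in> Basis" "open \<Omega>"
  shows "(LINT x|lebesgue_on \<Omega>. partial i \<phi> x) = 0"
  using integral_supported[of \<Omega> "partial i \<phi>"] integral_partial_lebesgue[OF assms(1,2)] assms
  by (simp add: partial_outside)

lemma test_times_smooth_integrable:
  assumes "\<phi> \<in> test_functions \<Omega>" "smooth g" "open \<Omega>'"
  shows "integrable (lebesgue_on \<Omega>') (\<lambda>x. \<phi> x * g x)"
  using test_integrable_lebesgue[OF test_mult[OF assms(1,2)]] assms(3)
  by (simp add: integrable_restrict_space integrable_mult_indicator del: real_scaleR_def)

lemma integral_by_parts:
  assumes \<phi>: "\<phi> \<in> test_functions \<Omega>" and \<psi>: "smooth \<psi>" and i: "i \<in> Basis" and \<Omega>: "open \<Omega>"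
  shows "(LINT x|lebesgue_on \<Omega>. \<psi> x * partial i \<phi> x) = - (LINT x|lebesgue_on \<Omega>. partial i \<psi> x * \<phi> x)"
proof -
  have "0 = (LINT x|lebesgue_on \<Omega>. partial i (\<lambda>x. \<phi> x * \<psi> x) x)"
    using integral_partial[OF test_mult[OF \<phi> \<psi>] i \<Omega>] by simp
  also have "\<dots> = (LINT x|lebesgue_on \<Omega>. \<phi> x * partial i \<psi> x + partial i \<phi> x * \<psi> x)"
    using test_smooth[OF \<phi>] \<psi> by (simp add: partial_mult smooth_differentiable)
  also have "\<dots> = (LINT x|lebesgue_on \<Omega>. \<phi> x * partial i \<psi> x) + (LINT x|lebesgue_on \<Omega>. partial i \<phi> x * \<psi> x)"
    by (intro Bochner_Integration.integral_add test_times_smooth_integrable[OF \<phi>] test_times_smooth_integrable[OF test_partial[OF \<phi> i]])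
       (use \<psi> i \<Omega> in auto)
  finally show ?thesis by (simp add: mult.commute)
qed

lemma diff_quot_tendsto_L2:
  assumes \<phi>: "\<phi> \<in> test_functions \<Omega>" and i: "i \<in> Basis" and h: "h \<longlonglongrightarrow> 0" "\<And>n. h n \<noteq> 0"
  shows "(\<lambda>n. nrm lebesgue (\<lambda>x. diff_quot (h n) i \<phi> x - partial i \<phi> x)) \<longlonglongrightarrow> 0"
proof -
  obtain B R where B: "\<And>h x. h \<noteq> 0 \<Longrightarrow> \<bar>h\<bar> \<le> 1 \<Longrightarrow> \<bar>diff_quot h i \<phi> x\<bar> \<le> B * indicator (cball 0 R) x"
      "\<And>x. \<bar>partial i \<phi> x\<bar> \<le> B * indicator (cball 0 R) x" "0 < B"
    using diff_quot_bound[OF \<phi> i] by metis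
  have \<phi>': "\<phi> \<in> test_functions UNIV" using \<phi> test_mono by blast
  have [measurable]: "partial i \<phi> \<in> borel_measurable lebesgue"
    by (rule test_measurable_lebesgue[OF test_partial[OF \<phi> i]])
  have [measurable]: "diff_quot h i \<phi> \<in> borel_measurable lebesgue" for h
    by (rule test_measurable_lebesgue[OF diff_quot_test[OF \<phi>']])
  have "\<forall>\<^sub>F n in sequentially. \<bar>h n\<bar> < 1"
    using tendstoD[OF h(1), of 1] by simp
  then obtain N where N: "\<And>n. N \<le> n \<Longrightarrow> \<bar>h n\<bar> < 1" by (auto simp: eventually_sequentially)
  have "(\<lambda>n. LINT x|lebesgue. (norm (diff_quot (h (n + N)) i \<phi> x - partial i \<phi> x))\<^sup>2) \<longlonglongrightarrow> (LINT x|(lebesgue :: 'a measure). 0)"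
  proof (rule integral_dominated_convergence[OF _ _ integrable_const_cball[of "(2 * B)\<^sup>2" R]])
    have "(\<lambda>n. (norm (diff_quot (h (n + N)) i \<phi> x - partial i \<phi> x))\<^sup>2) \<longlonglongrightarrow> (norm (partial i \<phi> x - partial i \<phi> x))\<^sup>2" for x
      by (intro tendsto_intros LIMSEQ_ignore_initial_segment diff_quot_tendsto test_smooth[OF \<phi>] h)
    then show "AE x in lebesgue. (\<lambda>n. (norm (diff_quot (h (n + N)) i \<phi> x - partial i \<phi> x))\<^sup>2) \<longlonglongrightarrow> 0" by simp
    fix n
    have "(norm (diff_quot (h (n + N)) i \<phi> x - partial i \<phi> x))\<^sup>2 \<le> (2 * B)\<^sup>2 * indicator (cball 0 R) x" for x
    proof -
      have "norm (diff_quot (h (n + N)) i \<phi> x - partial i \<phi> x) \<le> 2 * B * indicator (cball 0 R) x"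
        using B(1)[of "h (n + N)" x] B(2)[of x] h(2) N[of "n + N"] by (auto simp: less_imp_le)
      then have "(norm (diff_quot (h (n + N)) i \<phi> x - partial i \<phi> x))\<^sup>2 \<le> (2 * B * indicator (cball 0 R) x)\<^sup>2"
        by (rule power_mono) simp
      then show ?thesis by (cases "x \<in> cball 0 R") (simp_all add: power_mult_distrib)
    qed
    then show "AE x in lebesgue. norm ((norm (diff_quot (h (n + N)) i \<phi> x - partial i \<phi> x))\<^sup>2) \<le> (2 * B)\<^sup>2 * indicator (cball 0 R) x"
      by auto
  qed auto
  then have "(\<lambda>n. sqrt (LINT x|lebesgue. (norm (diff_quot (h (n + N)) i \<phi> x - partial i \<phi> x))\<^sup>2)) \<longlonglongrightarrow> sqrt 0"
    by (intro tendsto_real_sqrt) simp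
  then have "(\<lambda>n. nrm lebesgue (\<lambda>x. diff_quot (h (n + N)) i \<phi> x - partial i \<phi> x)) \<longlonglongrightarrow> 0"
    by (simp add: nrm_def)
  then show ?thesis by (rule LIMSEQ_offset)
qed

text \<open>
  The difference quotient with step \<open>h\<close> is the mean of two translates of the one with step \<open>h/2\<close>.
  Halving the step therefore does not decrease the norm, and in the limit the norm is that of the
  derivative.
\<close>

lemma nrm_diff_quot_test_le:
  assumes \<phi>: "\<phi> \<in> test_functions UNIV" and i: "i \<in> Basis" and h: "h \<noteq> 0"
  shows "nrm lebesgue (diff_quot h i \<phi>) \<le> nrm lebesgue (partial i \<phi>)"
proof -
  have sq: "sq_int lebesgue \<phi>" by (rule test_sq_int_lebesgue[OF \<phi>])
  have halve: "nrm lebesgue (diff_quot h i \<phi>) \<le> nrm lebesgue (diff_quot (h/2) i \<phi>)" for h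
  proof -
    have "diff_quot h i \<phi> = (\<lambda>x. (1/2) *\<^sub>R (diff_quot (h/2) i \<phi> (x + (h/2) *\<^sub>R i) + diff_quot (h/2) i \<phi> x))"
      by (cases "h = 0") (auto simp: diff_quot_def fun_eq_iff field_simps scaleR_add_left[symmetric] add.assoc)
    then have "nrm lebesgue (diff_quot h i \<phi>) = 1/2 * nrm lebesgue (\<lambda>x. diff_quot (h/2) i \<phi> (x + (h/2) *\<^sub>R i) + diff_quot (h/2) i \<phi> x)"
      by (simp only: nrm_scale)
    also have "\<dots> \<le> 1/2 * (nrm lebesgue (\<lambda>x. diff_quot (h/2) i \<phi> (x + (h/2) *\<^sub>R i)) + nrm lebesgue (diff_quot (h/2) i \<phi>))"
      using sq by (intro mult_left_mono nrm_triangle) auto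
    also have "\<dots> = nrm lebesgue (diff_quot (h/2) i \<phi>)"
      using nrm_translate[of "diff_quot (h/2) i \<phi>" "(h/2) *\<^sub>R i"] sq_int_diff_quot[OF sq] by simp
    finally show ?thesis .
  qed
  have le: "nrm lebesgue (diff_quot h i \<phi>) \<le> nrm lebesgue (diff_quot (h / 2 ^ n) i \<phi>)" for n
  proof (induction n)
    case (Suc n)
    with halve[of "h / 2 ^ n"] show ?case by (simp add: field_simps)
  qed simp
  have "(\<lambda>n. nrm lebesgue (diff_quot (h / 2 ^ n) i \<phi>)) \<longlonglongrightarrow> nrm lebesgue (partial i \<phi>)"
  proof (rule nrm_tendsto)
    have "(\<lambda>n. h / 2 ^ n) \<longlonglongrightarrow> 0" by real_asymp
    then show "(\<lambda>n. nrm lebesgue (\<lambda>x. diff_quot (h / 2 ^ n) i \<phi> x - partial i \<phi> x)) \<longlonglongrightarrow> 0"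
      using h by (intro diff_quot_tendsto_L2[OF \<phi> i]) auto
  qed (use sq test_sq_int_lebesgue[OF test_partial[OF \<phi> i]] in auto)
  then show ?thesis by (rule LIMSEQ_le_const) (use le in auto)
qed

section \<open>Sobolev functions with zero boundary values\<close>

definition grad :: "('a::euclidean_space \<Rightarrow> real) \<Rightarrow> 'a \<Rightarrow> 'a" where
  "grad \<phi> x = (\<Sum>i\<in>Basis. partial i \<phi> x *\<^sub>R i)"

definition jet :: "('a::euclidean_space \<Rightarrow> real) \<Rightarrow> 'a \<Rightarrow> real \<times> 'a" where
  "jet \<phi> x = (\<phi> x, grad \<phi> x)"

text \<open>
  A Sobolev function is represented together with its gradient, as a pair-valued
  function; the closure of the test functions in the Sobolev norm then becomes the closure of their
  jets in \<open>L\<^sup>2\<close>.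
\<close>

definition H0 :: "'a::euclidean_space set \<Rightarrow> ('a \<Rightarrow> real \<times> 'a) set" where
  "H0 \<Omega> = {U. sq_int (lebesgue_on \<Omega>) U \<and>
     (\<forall>e>0. \<exists>\<phi>\<in>test_functions \<Omega>. nrm (lebesgue_on \<Omega>) (\<lambda>x. U x - jet \<phi> x) < e)}"

lemma grad_inner [simp]: "i \<in> Basis \<Longrightarrow> grad \<phi> x \<bullet> i = partial i \<phi> x"
  by (simp add: grad_def inner_sum_left inner_Basis if_distrib sum.delta cong: if_cong)

lemma fst_jet [simp]: "fst (jet \<phi> x) = \<phi> x" and snd_jet [simp]: "snd (jet \<phi> x) = grad \<phi> x"
  by (simp_all add: jet_def)

lemma sq_int_scaleR_vector [intro]:
  fixes u :: "'a \<Rightarrow> real" and v :: "'b::euclidean_space"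
  assumes "sq_int M u" shows "sq_int M (\<lambda>x. u x *\<^sub>R v)"
proof (rule sq_int_norm_le[where c="norm v", OF assms])
  show "(\<lambda>x. u x *\<^sub>R v) \<in> borel_measurable M"
    using sq_int_measurable[OF assms] by measurable
qed (simp add: mult.commute)

lemma grad_sq_int [intro]:
  assumes "\<phi> \<in> test_functions \<Omega>'" "open \<Omega>" shows "sq_int (lebesgue_on \<Omega>) (grad \<phi>)"
  unfolding grad_def
proof (rule sq_int_sum)
  fix i :: 'a assume i: "i \<in> Basis"
  have "sq_int (lebesgue_on \<Omega>) (partial i \<phi>)" using test_partial[OF assms(1) i] assms(2) by auto
  then show "sq_int (lebesgue_on \<Omega>) (\<lambda>x. partial i \<phi> x *\<^sub>R i)"
    by (rule sq_int_scaleR_vector)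
qed

lemma jet_sq_int [intro]:
  assumes "\<phi> \<in> test_functions \<Omega>'" "open \<Omega>" shows "sq_int (lebesgue_on \<Omega>) (jet \<phi>)"
  unfolding jet_def using assms by auto

lemma grad_comb:
  assumes "smooth \<phi>" "smooth \<psi>"
  shows "grad (\<lambda>x. a * \<phi> x + b * \<psi> x) x = a *\<^sub>R grad \<phi> x + b *\<^sub>R grad \<psi> x"
proof -
  have s: "smooth (\<lambda>x. a * \<phi> x)" "smooth (\<lambda>x. b * \<psi> x)" using assms by auto
  have "partial i (\<lambda>x. a * \<phi> x + b * \<psi> x) = (\<lambda>x. a * partial i \<phi> x + b * partial i \<psi> x)" for i
    unfolding partial_add[OF s[THEN smooth_differentiable]] partial_cmult[OF assms(1)[THEN smooth_differentiable]]
      partial_cmult[OF assms(2)[THEN smooth_differentiable]] ..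
  then have "grad (\<lambda>x. a * \<phi> x + b * \<psi> x) x \<bullet> i = (a *\<^sub>R grad \<phi> x + b *\<^sub>R grad \<psi> x) \<bullet> i" if "i \<in> Basis" for i
    using that by (simp add: inner_add_left)
  then show ?thesis by (rule euclidean_eqI)
qed

lemma jet_comb:
  assumes "smooth \<phi>" "smooth \<psi>"
  shows "jet (\<lambda>x. a * \<phi> x + b * \<psi> x) x = a *\<^sub>R jet \<phi> x + b *\<^sub>R jet \<psi> x"
  by (simp add: jet_def grad_comb[OF assms])

lemma grad_mult:
  assumes "smooth \<phi>" "smooth \<psi>"
  shows "grad (\<lambda>x. \<phi> x * \<psi> x) x = \<phi> x *\<^sub>R grad \<psi> x + \<psi> x *\<^sub>R grad \<phi> x"
proof (rule euclidean_eqI)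
  fix i :: 'a assume "i \<in> Basis"
  then show "grad (\<lambda>x. \<phi> x * \<psi> x) x \<bullet> i = (\<phi> x *\<^sub>R grad \<psi> x + \<psi> x *\<^sub>R grad \<phi> x) \<bullet> i"
    by (simp add: partial_mult[OF assms[THEN smooth_differentiable]] inner_add_left mult.commute)
qed

lemma H0_sq_int: "U \<in> H0 \<Omega> \<Longrightarrow> sq_int (lebesgue_on \<Omega>) U"
  by (simp add: H0_def)

lemma jet_in_H0 [intro]: "\<phi> \<in> test_functions \<Omega> \<Longrightarrow> open \<Omega> \<Longrightarrow> jet \<phi> \<in> H0 \<Omega>"
  unfolding H0_def by (auto intro!: bexI[of _ \<phi>])

lemma H0_sequence:
  assumes "U \<in> H0 \<Omega>"
  obtains \<phi> where "\<And>n. \<phi> n \<in> test_functions \<Omega>"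
    "(\<lambda>n. nrm (lebesgue_on \<Omega>) (\<lambda>x. jet (\<phi> n) x - U x)) \<longlonglongrightarrow> 0"
proof -
  have *: "\<forall>e>0. \<exists>\<phi>\<in>test_functions \<Omega>. nrm (lebesgue_on \<Omega>) (\<lambda>x. U x - jet \<phi> x) < e"
    using assms by (simp add: H0_def)
  have "\<exists>\<phi>. \<phi> \<in> test_functions \<Omega> \<and> nrm (lebesgue_on \<Omega>) (\<lambda>x. U x - jet \<phi> x) < 1 / real (Suc n)" for n
    using *[rule_format, of "1 / real (Suc n)"] by auto
  then obtain \<phi> where \<phi>: "\<And>n. \<phi> n \<in> test_functions \<Omega>"
     "\<And>n. nrm (lebesgue_on \<Omega>) (\<lambda>x. U x - jet (\<phi> n) x) < 1 / real (Suc n)" by metis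
  have "(\<lambda>n. nrm (lebesgue_on \<Omega>) (\<lambda>x. jet (\<phi> n) x - U x)) \<longlonglongrightarrow> 0"
    by (rule tendsto_sandwich[OF _ _ tendsto_const LIMSEQ_Suc[OF lim_1_over_n]])
       (use \<phi>(2) in \<open>auto intro!: always_eventually less_imp_le simp: nrm_diff_commute[of _ "jet _"]\<close>)
  with \<phi>(1) show thesis by (rule that)
qed

lemma H0_closed:
  assumes "open \<Omega>" and U: "sq_int (lebesgue_on \<Omega>) U"
    and V: "\<And>n::nat. V n \<in> H0 \<Omega>" and lim: "(\<lambda>n. nrm (lebesgue_on \<Omega>) (\<lambda>x. V n x - U x)) \<longlonglongrightarrow> 0"
  shows "U \<in> H0 \<Omega>"
  unfolding H0_def
proof (safe intro!: U)
  fix e :: real assume e: "0 < e"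
  then have "\<forall>\<^sub>F n in sequentially. nrm (lebesgue_on \<Omega>) (\<lambda>x. V n x - U x) < e / 2"
    by (intro order_tendstoD(2)[OF lim]) simp
  then obtain n where n: "nrm (lebesgue_on \<Omega>) (\<lambda>x. V n x - U x) < e / 2" by (auto simp: eventually_sequentially)
  obtain \<phi> where \<phi>: "\<phi> \<in> test_functions \<Omega>" "nrm (lebesgue_on \<Omega>) (\<lambda>x. V n x - jet \<phi> x) < e / 2"
    using V[of n] e unfolding H0_def by (auto dest!: spec[of _ "e / 2"])
  have "nrm (lebesgue_on \<Omega>) (\<lambda>x. U x - jet \<phi> x) \<le> nrm (lebesgue_on \<Omega>) (\<lambda>x. U x - V n x) + nrm (lebesgue_on \<Omega>) (\<lambda>x. V n x - jet \<phi> x)"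
    using \<phi>(1) assms(1) by (intro nrm_diff_triangle U H0_sq_int[OF V]) auto
  with n \<phi>(2) have "nrm (lebesgue_on \<Omega>) (\<lambda>x. U x - jet \<phi> x) < e"
    by (simp add: nrm_diff_commute[of _ U])
  with \<phi>(1) show "\<exists>\<phi>\<in>test_functions \<Omega>. nrm (lebesgue_on \<Omega>) (\<lambda>x. U x - jet \<phi> x) < e" by blast
qed

lemma H0_comb:
  assumes \<Omega>: "open \<Omega>" and U: "U \<in> H0 \<Omega>" and V: "V \<in> H0 \<Omega>"
  shows "(\<lambda>x. a *\<^sub>R U x + b *\<^sub>R V x) \<in> H0 \<Omega>"
proof -
  let ?N = "nrm (lebesgue_on \<Omega>)"
  obtain \<phi> where \<phi>: "\<And>n. \<phi> n \<in> test_functions \<Omega>" "(\<lambda>n. ?N (\<lambda>x. jet (\<phi> n) x - U x)) \<longlonglongrightarrow> 0"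
    using H0_sequence[OF U] by blast
  obtain \<psi> where \<psi>: "\<And>n. \<psi> n \<in> test_functions \<Omega>" "(\<lambda>n. ?N (\<lambda>x. jet (\<psi> n) x - V x)) \<longlonglongrightarrow> 0"
    using H0_sequence[OF V] by blast
  have test: "(\<lambda>x. a * \<phi> n x + b * \<psi> n x) \<in> test_functions \<Omega>" for n by (intro test_add test_cmult \<phi>(1) \<psi>(1))
  show ?thesis
  proof (rule H0_closed[OF \<Omega> _ jet_in_H0[OF test \<Omega>]])
    show "sq_int (lebesgue_on \<Omega>) (\<lambda>x. a *\<^sub>R U x + b *\<^sub>R V x)" using H0_sq_int[OF U] H0_sq_int[OF V] by auto
    have *: "?N (\<lambda>x. jet (\<lambda>x. a * \<phi> n x + b * \<psi> n x) x - (a *\<^sub>R U x + b *\<^sub>R V x))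
      \<le> \<bar>a\<bar> * ?N (\<lambda>x. jet (\<phi> n) x - U x) + \<bar>b\<bar> * ?N (\<lambda>x. jet (\<psi> n) x - V x)" for n
    proof -
      have "(\<lambda>x. jet (\<lambda>x. a * \<phi> n x + b * \<psi> n x) x - (a *\<^sub>R U x + b *\<^sub>R V x))
        = (\<lambda>x. a *\<^sub>R (jet (\<phi> n) x - U x) + b *\<^sub>R (jet (\<psi> n) x - V x))"
        using test_smooth[OF \<phi>(1)] test_smooth[OF \<psi>(1)] by (simp add: jet_comb algebra_simps)
      moreover have "sq_int (lebesgue_on \<Omega>) (\<lambda>x. jet (\<phi> n) x - U x)" "sq_int (lebesgue_on \<Omega>) (\<lambda>x. jet (\<psi> n) x - V x)"
        using H0_sq_int[OF U] H0_sq_int[OF V] \<phi>(1) \<psi>(1) \<Omega> by auto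
      ultimately show ?thesis
        using nrm_triangle[of "lebesgue_on \<Omega>" "\<lambda>x. a *\<^sub>R (jet (\<phi> n) x - U x)" "\<lambda>x. b *\<^sub>R (jet (\<psi> n) x - V x)"]
          sq_int_scale by (simp only: nrm_scale) blast
    qed
    have "(\<lambda>n. \<bar>a\<bar> * ?N (\<lambda>x. jet (\<phi> n) x - U x) + \<bar>b\<bar> * ?N (\<lambda>x. jet (\<psi> n) x - V x)) \<longlonglongrightarrow> \<bar>a\<bar> * 0 + \<bar>b\<bar> * 0"
      by (intro tendsto_intros \<phi> \<psi>)
    then have lim: "(\<lambda>n. \<bar>a\<bar> * ?N (\<lambda>x. jet (\<phi> n) x - U x) + \<bar>b\<bar> * ?N (\<lambda>x. jet (\<psi> n) x - V x)) \<longlonglongrightarrow> 0"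
      by simp
    show "(\<lambda>n. ?N (\<lambda>x. jet (\<lambda>x. a * \<phi> n x + b * \<psi> n x) x - (a *\<^sub>R U x + b *\<^sub>R V x))) \<longlonglongrightarrow> 0"
      by (rule tendsto_sandwich[OF _ _ tendsto_const lim]) (use * in \<open>auto intro!: always_eventually\<close>)
  qed
qed

lemma H0_diff: "open \<Omega> \<Longrightarrow> U \<in> H0 \<Omega> \<Longrightarrow> V \<in> H0 \<Omega> \<Longrightarrow> (\<lambda>x. U x - V x) \<in> H0 \<Omega>"
  using H0_comb[of \<Omega> U V 1 "-1"] by simp

lemma H0_orthogonal:
  assumes \<Omega>: "open \<Omega>" and U: "U \<in> H0 \<Omega>" and P: "sq_int (lebesgue_on \<Omega>) P"
    and test: "\<And>\<phi>. \<phi> \<in> test_functions \<Omega> \<Longrightarrow> ip (lebesgue_on \<Omega>) P (jet \<phi>) = 0"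
  shows "ip (lebesgue_on \<Omega>) P U = 0"
proof -
  obtain \<phi> where \<phi>: "\<And>n. \<phi> n \<in> test_functions \<Omega>" "(\<lambda>n. nrm (lebesgue_on \<Omega>) (\<lambda>x. jet (\<phi> n) x - U x)) \<longlonglongrightarrow> 0"
    using H0_sequence[OF U] by blast
  have "(\<lambda>n. ip (lebesgue_on \<Omega>) (jet (\<phi> n)) P) \<longlonglongrightarrow> ip (lebesgue_on \<Omega>) U P"
    using \<phi>(1) \<Omega> by (intro ip_tendsto_left \<phi>(2) P H0_sq_int[OF U]) auto
  then show ?thesis using test[OF \<phi>(1)] by (simp add: ip_commute LIMSEQ_const_iff)
qed

text \<open>
  An equation that holds for test functions says that the pair \<open>(-g, G)\<close> is orthogonal to their
  jets, hence to the closure of these.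
\<close>

lemma H0_Green:
  assumes \<Omega>: "open \<Omega>" and U: "U \<in> H0 \<Omega>" and G: "sq_int (lebesgue_on \<Omega>) G" and g: "sq_int (lebesgue_on \<Omega>) g"
    and test: "\<And>\<phi>. \<phi> \<in> test_functions \<Omega> \<Longrightarrow> ip (lebesgue_on \<Omega>) G (grad \<phi>) = ip (lebesgue_on \<Omega>) g \<phi>"
  shows "ip (lebesgue_on \<Omega>) G (\<lambda>x. snd (U x)) = ip (lebesgue_on \<Omega>) g (\<lambda>x. fst (U x))"
proof -
  let ?P = "\<lambda>x. (- g x, G x)"
  have split: "ip (lebesgue_on \<Omega>) ?P V = ip (lebesgue_on \<Omega>) G (\<lambda>x. snd (V x)) - ip (lebesgue_on \<Omega>) g (\<lambda>x. fst (V x))"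
    if "sq_int (lebesgue_on \<Omega>) V" for V
    using ip_Pair[OF sq_int_minus[OF g] G sq_int_fst[OF that] sq_int_snd[OF that]] by simp
  have "ip (lebesgue_on \<Omega>) ?P U = 0"
  proof (rule H0_orthogonal[OF \<Omega> U])
    show "ip (lebesgue_on \<Omega>) ?P (jet \<phi>) = 0" if \<phi>: "\<phi> \<in> test_functions \<Omega>" for \<phi>
      using split[OF jet_sq_int[OF \<phi> \<Omega>]] test[OF \<phi>] by simp
  qed (use G g in auto)
  then show ?thesis using split[OF H0_sq_int[OF U]] by simp
qed

lemma H0_weak_gradient:
  assumes \<Omega>: "open \<Omega>" and U: "U \<in> H0 \<Omega>"
  shows "has_weak_gradient \<Omega> (\<lambda>x. fst (U x)) (\<lambda>x. snd (U x))"
  unfolding has_weak_gradient_def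
proof (intro ballI)
  fix \<psi> and i :: 'a assume \<psi>: "\<psi> \<in> test_functions \<Omega>" and i: "i \<in> Basis"
  let ?M = "lebesgue_on \<Omega>"
  have s: "sq_int ?M \<psi>" "sq_int ?M (partial i \<psi>)" using \<psi> \<Omega> test_partial[OF \<psi> i] by auto
  have si: "sq_int ?M (\<lambda>x. \<psi> x *\<^sub>R i)"
    by (rule sq_int_scaleR_vector[OF s(1)])
  have "ip ?M (\<lambda>x. \<psi> x *\<^sub>R i) (\<lambda>x. snd (U x)) = ip ?M (\<lambda>x. - partial i \<psi> x) (\<lambda>x. fst (U x))"
  proof (rule H0_Green[OF \<Omega> U si sq_int_minus[OF s(2)]])
    fix \<phi> assume \<phi>: "\<phi> \<in> test_functions \<Omega>"
    show "ip ?M (\<lambda>x. \<psi> x *\<^sub>R i) (grad \<phi>) = ip ?M (\<lambda>x. - partial i \<psi> x) \<phi>"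
      using integral_by_parts[OF \<phi> test_smooth[OF \<psi>] i \<Omega>] i by (simp add: ip_def inner_commute[of i])
  qed
  then show "(LINT x|?M. fst (U x) * partial i \<psi> x) = - (LINT x|?M. (snd (U x) \<bullet> i) * \<psi> x)"
    by (simp add: ip_def inner_commute[of i] mult.commute)
qed

text \<open>
  The difference of two weak gradients is orthogonal to all test functions. Since \<open>\<Omega>\<close> is bounded, its
  components are integrable, and the fundamental lemma applies.
\<close>

lemma weak_gradient_unique:
  fixes g :: "'a::euclidean_space \<Rightarrow> 'a"
  assumes \<Omega>: "open \<Omega>" "bounded \<Omega>" and g: "has_weak_gradient \<Omega> u g" "sq_int (lebesgue_on \<Omega>) g"
    and g': "has_weak_gradient \<Omega> u g'" "sq_int (lebesgue_on \<Omega>) g'"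
  shows "AE x in lebesgue_on \<Omega>. g x = g' x"
proof -
  let ?M = "lebesgue_on \<Omega>"
  have one: "sq_int ?M (\<lambda>x. 1::real)"
    using \<Omega> bounded_set_imp_lmeasurable[OF \<Omega>(2)]
    by (simp add: sq_int_def integrable_restrict_space lmeasurable_iff_integrable)
  have "AE x in ?M. (g x - g' x) \<bullet> i = 0" if i: "i \<in> Basis" for i
  proof (rule AE_zero_if_test_zero[OF \<Omega>(1)])
    have sq: "sq_int ?M (\<lambda>x. g x \<bullet> i)" "sq_int ?M (\<lambda>x. g' x \<bullet> i)" using g g' by auto
    show "integrable ?M (\<lambda>x. (g x - g' x) \<bullet> i)"
      using integrable_mult_sq[OF sq_int_inner_const[OF sq_int_diff[OF g(2) g'(2)]] one, of i] by simp
    fix \<zeta> assume \<zeta>: "\<zeta> \<in> test_functions \<Omega>"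
    have "sq_int ?M \<zeta>" using \<zeta> \<Omega> by auto
    then have "integrable ?M (\<lambda>x. (g x \<bullet> i) * \<zeta> x)" "integrable ?M (\<lambda>x. (g' x \<bullet> i) * \<zeta> x)"
      using sq by (auto intro: integrable_mult_sq)
    moreover have "(LINT x|?M. (g x \<bullet> i) * \<zeta> x) = (LINT x|?M. (g' x \<bullet> i) * \<zeta> x)"
      using g(1) g'(1) \<zeta> i unfolding has_weak_gradient_def by (metis minus_equation_iff)
    ultimately show "(LINT x|?M. ((g x - g' x) \<bullet> i) * \<zeta> x) = 0"
      by (simp add: inner_diff_left left_diff_distrib)
  qed
  then have "AE x in ?M. \<forall>i\<in>Basis. (g x - g' x) \<bullet> i = 0"
    by (intro AE_finite_allI) auto
  then show ?thesis
  proof eventually_elim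
    case (elim x)
    show "g x = g' x"
    proof (rule euclidean_eqI)
      fix i :: 'a assume "i \<in> Basis"
      with elim show "g x \<bullet> i = g' x \<bullet> i" by (simp add: inner_diff_left)
    qed
  qed
qed

lemma L2_iff: "u \<in> L2 \<Omega> \<longleftrightarrow> sq_int (lebesgue_on \<Omega>) u"
  by (simp add: L2_def sq_int_def)

lemma weak_grad_eq:
  assumes \<Omega>: "open \<Omega>" "bounded \<Omega>" and g: "has_weak_gradient \<Omega> u g" "sq_int (lebesgue_on \<Omega>) g"
  shows "sq_int (lebesgue_on \<Omega>) (weak_grad \<Omega> u)" "AE x in lebesgue_on \<Omega>. weak_grad \<Omega> u x = g x"
    "has_weak_gradient \<Omega> u (weak_grad \<Omega> u)"
proof -
  have *: "weak_grad \<Omega> u \<in> L2 \<Omega> \<and> has_weak_gradient \<Omega> u (weak_grad \<Omega> u)"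
    unfolding weak_grad_def by (rule someI[of _ g]) (use g in \<open>simp add: L2_iff\<close>)
  then show s: "sq_int (lebesgue_on \<Omega>) (weak_grad \<Omega> u)" "has_weak_gradient \<Omega> u (weak_grad \<Omega> u)"
    by (auto simp: L2_iff)
  show "AE x in lebesgue_on \<Omega>. weak_grad \<Omega> u x = g x"
    by (rule weak_gradient_unique[OF \<Omega> s(2,1) g])
qed

lemma weak_gradient_diff_test:
  assumes \<Omega>: "open \<Omega>" and g: "has_weak_gradient \<Omega> u g" "sq_int (lebesgue_on \<Omega>) u" "sq_int (lebesgue_on \<Omega>) g"
    and \<phi>: "\<phi> \<in> test_functions \<Omega>"
  shows "has_weak_gradient \<Omega> (\<lambda>x. u x - \<phi> x) (\<lambda>x. g x - grad \<phi> x)"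
  unfolding has_weak_gradient_def
proof (intro ballI)
  fix \<psi> and i :: 'a assume \<psi>: "\<psi> \<in> test_functions \<Omega>" and i: "i \<in> Basis"
  let ?M = "lebesgue_on \<Omega>"
  have s: "sq_int ?M \<psi>" "sq_int ?M (partial i \<psi>)" "sq_int ?M \<phi>" "sq_int ?M (partial i \<phi>)" "sq_int ?M (\<lambda>x. g x \<bullet> i)"
    using \<psi> \<phi> \<Omega> test_partial[OF \<psi> i] test_partial[OF \<phi> i] g(3) by auto
  have "(LINT x|?M. (u x - \<phi> x) * partial i \<psi> x) = (LINT x|?M. u x * partial i \<psi> x) - (LINT x|?M. \<phi> x * partial i \<psi> x)"
    using integrable_mult_sq[OF g(2) s(2)] integrable_mult_sq[OF s(3) s(2)] by (simp add: left_diff_distrib)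
  also have "\<dots> = - (LINT x|?M. (g x \<bullet> i) * \<psi> x) + (LINT x|?M. partial i \<phi> x * \<psi> x)"
    using g(1) \<psi> i integral_by_parts[OF \<psi> test_smooth[OF \<phi>] i \<Omega>] by (simp add: has_weak_gradient_def)
  also have "\<dots> = - (LINT x|?M. ((g x - grad \<phi> x) \<bullet> i) * \<psi> x)"
    using integrable_mult_sq[OF s(5) s(1)] integrable_mult_sq[OF s(4) s(1)] i
    by (simp add: inner_diff_left left_diff_distrib)
  finally show "(LINT x|?M. (u x - \<phi> x) * partial i \<psi> x) = - (LINT x|?M. ((g x - grad \<phi> x) \<bullet> i) * \<psi> x)" .
qed

lemma H1_norm_diff_test:
  assumes \<Omega>: "open \<Omega>" "bounded \<Omega>" and g: "has_weak_gradient \<Omega> u g" "sq_int (lebesgue_on \<Omega>) u" "sq_int (lebesgue_on \<Omega>) g"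
    and \<phi>: "\<phi> \<in> test_functions \<Omega>"
  shows "H1_norm \<Omega> (\<lambda>x. u x - \<phi> x) = nrm (lebesgue_on \<Omega>) (\<lambda>x. (u x, g x) - jet \<phi> x)"
proof -
  let ?M = "lebesgue_on \<Omega>"
  have s: "sq_int ?M (\<lambda>x. u x - \<phi> x)" "sq_int ?M (\<lambda>x. g x - grad \<phi> x)" using g \<phi> \<Omega> by auto
  note w = weak_grad_eq[OF \<Omega> weak_gradient_diff_test[OF \<Omega>(1) g \<phi>] s(2)]
  have "nrm ?M (weak_grad \<Omega> (\<lambda>x. u x - \<phi> x)) = nrm ?M (\<lambda>x. g x - grad \<phi> x)"
    by (rule nrm_cong_AE) (use w s in \<open>auto intro: sq_int_measurable\<close>)
  then have "H1_norm \<Omega> (\<lambda>x. u x - \<phi> x) = sqrt ((nrm ?M (\<lambda>x. u x - \<phi> x))\<^sup>2 + (nrm ?M (\<lambda>x. g x - grad \<phi> x))\<^sup>2)"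
    unfolding H1_norm_def by (simp add: nrm_sq_integral[symmetric]) (simp add: nrm_sq_integral)
  also have "\<dots> = sqrt ((nrm ?M (\<lambda>x. (u x - \<phi> x, g x - grad \<phi> x)))\<^sup>2)"
    by (simp only: nrm_Pair_sq[OF s])
  finally show ?thesis by (simp add: jet_def)
qed

text \<open>
  The next two lemmas identify the pairs in \<^const>\<open>H0\<close> with the functions in \<^const>\<open>H10\<close> together with
  their weak gradients.
\<close>

lemma H10_imp_H0:
  assumes \<Omega>: "open \<Omega>" "bounded \<Omega>" and u: "u \<in> H10 \<Omega>"
  shows "(\<lambda>x. (u x, weak_grad \<Omega> u x)) \<in> H0 \<Omega>"
proof -
  from u obtain g where g: "sq_int (lebesgue_on \<Omega>) g" "has_weak_gradient \<Omega> u g" and su: "sq_int (lebesgue_on \<Omega>) u"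
    by (auto simp: H10_def H1_def L2_iff)
  note w = weak_grad_eq[OF \<Omega> g(2,1)]
  have "\<exists>\<phi>\<in>test_functions \<Omega>. nrm (lebesgue_on \<Omega>) (\<lambda>x. (u x, weak_grad \<Omega> u x) - jet \<phi> x) < e" if "0 < e" for e
    using u that H1_norm_diff_test[OF \<Omega> w(3) su w(1)] by (auto simp: H10_def)
  then show ?thesis using su w(1) by (auto simp: H0_def)
qed

lemma H0_imp_H10:
  assumes \<Omega>: "open \<Omega>" "bounded \<Omega>" and U: "U \<in> H0 \<Omega>"
  shows "(\<lambda>x. fst (U x)) \<in> H10 \<Omega>" "AE x in lebesgue_on \<Omega>. weak_grad \<Omega> (\<lambda>x. fst (U x)) x = snd (U x)"
proof -
  note s = sq_int_fst[OF H0_sq_int[OF U]] sq_int_snd[OF H0_sq_int[OF U]]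
  note g = H0_weak_gradient[OF \<Omega>(1) U]
  show "AE x in lebesgue_on \<Omega>. weak_grad \<Omega> (\<lambda>x. fst (U x)) x = snd (U x)"
    by (rule weak_grad_eq(2)[OF \<Omega> g s(2)])
  show "(\<lambda>x. fst (U x)) \<in> H10 \<Omega>"
    using U s g H1_norm_diff_test[OF \<Omega> g s] by (auto simp: H10_def H1_def L2_iff H0_def)
qed

text \<open>
  Integrating \<open>\<phi> \<partial>\<^sub>i(x\<^sub>i \<phi>)\<close> by parts gives \<open>\<integral>\<phi>\<^sup>2 = -2 \<integral>x\<^sub>i \<phi> \<partial>\<^sub>i\<phi>\<close>, and \<open>|x\<^sub>i| \<le> R\<close> on \<open>\<Omega>\<close>.
\<close>

lemma Poincare_test:
  assumes \<Omega>: "open \<Omega>" and R: "\<And>x. x \<in> \<Omega> \<Longrightarrow> norm x \<le> R" "0 \<le> R" and \<phi>: "\<phi> \<in> test_functions \<Omega>"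
  shows "nrm (lebesgue_on \<Omega>) \<phi> \<le> 2 * R * nrm (lebesgue_on \<Omega>) (grad \<phi>)"
proof -
  let ?M = "lebesgue_on \<Omega>"
  obtain i :: 'a where i: "i \<in> Basis" by (meson nonempty_Basis ex_in_conv)
  have sm: "smooth \<phi>" using \<phi> by (rule test_smooth)
  have p: "partial i (\<lambda>x. (x \<bullet> i) * \<phi> x) = (\<lambda>x. (x \<bullet> i) * partial i \<phi> x + \<phi> x)"
    using i by (simp add: partial_mult smooth_differentiable smooth_coord sm partial_coord)
  have x\<phi>: "(\<lambda>x. (x \<bullet> i) * \<phi> x) \<in> test_functions \<Omega>"
    using test_mult[OF \<phi> smooth_coord[of i]] by (simp add: mult.commute)
  have s: "sq_int ?M \<phi>" "sq_int ?M (\<lambda>x. (x \<bullet> i) * \<phi> x)" "sq_int ?M (partial i \<phi>)" "sq_int ?M (grad \<phi>)"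
    using \<phi> x\<phi> test_partial[OF \<phi> i] \<Omega> by auto
  have "(LINT x|?M. \<phi> x * partial i (\<lambda>x. (x \<bullet> i) * \<phi> x) x) = - (LINT x|?M. partial i \<phi> x * ((x \<bullet> i) * \<phi> x))"
    using integral_by_parts[OF x\<phi> sm i \<Omega>] by simp
  moreover have "(LINT x|?M. \<phi> x * partial i (\<lambda>x. (x \<bullet> i) * \<phi> x) x)
     = (LINT x|?M. ((x \<bullet> i) * \<phi> x) * partial i \<phi> x) + (LINT x|?M. \<phi> x * \<phi> x)"
    unfolding p using integrable_mult_sq[OF s(2,3)] integrable_mult_sq[OF s(1,1)]
    by (simp add: distrib_left mult_ac)
  ultimately have "(nrm ?M \<phi>)\<^sup>2 = - 2 * ip ?M (\<lambda>x. (x \<bullet> i) * \<phi> x) (partial i \<phi>)"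
    by (simp add: nrm_sq ip_def mult_ac)
  also have "\<dots> \<le> 2 * (nrm ?M (\<lambda>x. (x \<bullet> i) * \<phi> x) * nrm ?M (partial i \<phi>))"
    using ip_Cauchy_Schwarz[OF s(2,3)] by linarith
  also have "\<dots> \<le> 2 * ((R * nrm ?M \<phi>) * (1 * nrm ?M (grad \<phi>)))"
  proof (intro mult_left_mono mult_mono)
    show "nrm ?M (\<lambda>x. (x \<bullet> i) * \<phi> x) \<le> R * nrm ?M \<phi>"
    proof (rule nrm_mono[OF s(1) sq_int_measurable[OF s(2)]])
      have "norm ((x \<bullet> i) * \<phi> x) \<le> R * norm (\<phi> x)" for x
      proof (cases "x \<in> \<Omega>")
        case True
        have "\<bar>x \<bullet> i\<bar> \<le> norm x" using i by (rule Basis_le_norm)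
        also have "\<dots> \<le> R" using R True by simp
        finally show ?thesis by (simp add: abs_mult mult_right_mono)
      qed (simp add: test_outside[OF \<phi>])
      then show "AE x in ?M. norm ((x \<bullet> i) * \<phi> x) \<le> R * norm (\<phi> x)" by simp
    qed (rule R)
    show "nrm ?M (partial i \<phi>) \<le> 1 * nrm ?M (grad \<phi>)"
    proof (rule nrm_mono[OF s(4) sq_int_measurable[OF s(3)]])
      show "AE x in ?M. norm (partial i \<phi> x) \<le> 1 * norm (grad \<phi> x)"
        using Basis_le_norm[OF i, of "grad \<phi> _"] i by simp
    qed simp
  qed (use R in auto)
  finally have "nrm ?M \<phi> * nrm ?M \<phi> \<le> nrm ?M \<phi> * (2 * R * nrm ?M (grad \<phi>))"
    by (simp add: power2_eq_square mult_ac)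
  then show ?thesis
    using nrm_nonneg[of ?M \<phi>] R(2) by (cases "nrm ?M \<phi> = 0") (auto simp: mult_le_cancel_left_pos order_less_le)
qed

lemma Poincare:
  fixes \<Omega> :: "'a::euclidean_space set"
  assumes \<Omega>: "open \<Omega>" "bounded \<Omega>"
  obtains C where "0 < C" "\<And>U. U \<in> H0 \<Omega> \<Longrightarrow>
    nrm (lebesgue_on \<Omega>) (\<lambda>x. fst (U x)) \<le> C * nrm (lebesgue_on \<Omega>) (\<lambda>x. snd (U x))"
proof -
  let ?N = "nrm (lebesgue_on \<Omega>)"
  obtain R where R: "0 < R" "\<And>x. x \<in> \<Omega> \<Longrightarrow> norm x \<le> R" using \<Omega>(2) by (auto simp: bounded_pos)
  show thesis
  proof
    show "0 < 2 * R" using R by simp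
    fix U assume U: "U \<in> H0 \<Omega>"
    obtain \<phi> where \<phi>: "\<And>n. \<phi> n \<in> test_functions \<Omega>" "(\<lambda>n. ?N (\<lambda>x. jet (\<phi> n) x - U x)) \<longlonglongrightarrow> 0"
      using H0_sequence[OF U] by blast
    have s: "sq_int (lebesgue_on \<Omega>) (\<lambda>x. jet (\<phi> n) x - U x)" for n
      using \<phi>(1) \<Omega> H0_sq_int[OF U] by auto
    have lim1: "(\<lambda>n. ?N (\<phi> n)) \<longlonglongrightarrow> ?N (\<lambda>x. fst (U x))"
    proof (rule nrm_tendsto)
      show "(\<lambda>n. ?N (\<lambda>x. \<phi> n x - fst (U x))) \<longlonglongrightarrow> 0"
        by (rule tendsto_sandwich[OF _ _ tendsto_const \<phi>(2)]) (use nrm_fst_le[OF s] in auto)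
    qed (use \<phi>(1) \<Omega> sq_int_fst[OF H0_sq_int[OF U]] in auto)
    have lim2: "(\<lambda>n. ?N (grad (\<phi> n))) \<longlonglongrightarrow> ?N (\<lambda>x. snd (U x))"
    proof (rule nrm_tendsto)
      show "(\<lambda>n. ?N (\<lambda>x. grad (\<phi> n) x - snd (U x))) \<longlonglongrightarrow> 0"
        by (rule tendsto_sandwich[OF _ _ tendsto_const \<phi>(2)]) (use nrm_snd_le[OF s] in auto)
    qed (use \<phi>(1) \<Omega> sq_int_snd[OF H0_sq_int[OF U]] in auto)
    show "?N (\<lambda>x. fst (U x)) \<le> 2 * R * ?N (\<lambda>x. snd (U x))"
      by (rule LIMSEQ_le[OF lim1 tendsto_mult[OF tendsto_const lim2]])
         (use Poincare_test[OF \<Omega>(1) R(2) _ \<phi>(1)] R in auto)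
  qed
qed

section \<open>Gradient and Laplacian on the zero set\<close>

lemma sq_int_indicator [intro]: "A \<in> lmeasurable \<Longrightarrow> sq_int lebesgue (indicator A :: 'a::euclidean_space \<Rightarrow> real)"
proof -
  assume A: "A \<in> lmeasurable"
  have "(\<lambda>x::'a. (norm (indicator A x :: real))\<^sup>2) = indicator A"
    by (auto simp: indicator_def)
  with A show ?thesis by (simp add: sq_int_def lmeasurable_iff_integrable borel_measurable_integrable)
qed

lemma test_approx_indicator_L2:
  fixes A :: "'a::euclidean_space set"
  assumes A: "A \<in> lmeasurable"
  obtains \<zeta> :: "nat \<Rightarrow> 'a \<Rightarrow> real" where "\<And>n. \<zeta> n \<in> test_functions UNIV"
    "(\<lambda>n. nrm lebesgue (\<lambda>x. \<zeta> n x - indicator A x)) \<longlonglongrightarrow> 0"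
proof -
  obtain \<zeta> :: "nat \<Rightarrow> 'a \<Rightarrow> real" where \<zeta>: "\<And>n. \<zeta> n \<in> test_functions UNIV"
    "\<And>n x. 0 \<le> \<zeta> n x" "\<And>n x. \<zeta> n x \<le> 1"
    "\<And>n. integrable lebesgue (\<lambda>x. \<bar>\<zeta> n x - indicator A x\<bar>)"
    "(\<lambda>n. LINT x|lebesgue. \<bar>\<zeta> n x - indicator A x\<bar>) \<longlonglongrightarrow> 0"
    "AE x in lebesgue. (\<lambda>n. \<zeta> n x) \<longlonglongrightarrow> indicator A x"
    by (rule test_approx_indicator[OF open_UNIV A subset_UNIV]) (rule that)
  have "nrm lebesgue (\<lambda>x. \<zeta> n x - indicator A x) \<le> sqrt (LINT x|lebesgue. \<bar>\<zeta> n x - indicator A x\<bar>)" for n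
    unfolding nrm_def
  proof (intro real_sqrt_le_mono integral_mono)
    show "integrable lebesgue (\<lambda>x. (norm (\<zeta> n x - indicator A x))\<^sup>2)"
      by (rule sq_int_integrable, rule sq_int_diff) (use test_sq_int_lebesgue[OF \<zeta>(1)] A in auto)
    show "(norm (\<zeta> n x - indicator A x))\<^sup>2 \<le> \<bar>\<zeta> n x - indicator A x\<bar>" for x
    proof -
      have "\<bar>\<zeta> n x - indicator A x\<bar> \<le> 1" using \<zeta>(2,3)[of n x] by (auto simp: indicator_def)
      then have "\<bar>\<zeta> n x - indicator A x\<bar> * \<bar>\<zeta> n x - indicator A x\<bar> \<le> \<bar>\<zeta> n x - indicator A x\<bar> * 1"
        by (intro mult_left_mono) auto
      then show ?thesis by (simp add: power2_eq_square)
    qed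
  qed (rule \<zeta>)
  moreover have "(\<lambda>n. sqrt (LINT x|lebesgue. \<bar>\<zeta> n x - indicator A x\<bar>)) \<longlonglongrightarrow> sqrt 0"
    by (intro tendsto_real_sqrt \<zeta>(5))
  then have lim: "(\<lambda>n. sqrt (LINT x|lebesgue. \<bar>\<zeta> n x - indicator A x\<bar>)) \<longlonglongrightarrow> 0" by simp
  ultimately have "(\<lambda>n. nrm lebesgue (\<lambda>x. \<zeta> n x - indicator A x)) \<longlonglongrightarrow> 0"
    by (intro tendsto_sandwich[OF _ _ tendsto_const lim]) auto
  with \<zeta>(1) show thesis by (rule that)
qed

text \<open>
  Translations are continuous in \<open>L\<^sup>2\<close>: the estimate by the difference quotient proves this for test
  functions, and density extends it to indicators.
\<close>

lemma indicator_translate_tendsto: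
  fixes A :: "'a::euclidean_space set" and h :: "nat \<Rightarrow> real"
  assumes A: "A \<in> lmeasurable" and i: "i \<in> Basis" and h: "h \<longlonglongrightarrow> 0" "\<And>n. h n \<noteq> 0"
  shows "(\<lambda>n. nrm lebesgue (\<lambda>x. indicator A (x + h n *\<^sub>R i) - indicator A x :: real)) \<longlonglongrightarrow> 0"
proof (rule LIMSEQ_I)
  let ?N = "nrm (lebesgue :: 'a measure)" and ?I = "indicator A :: 'a \<Rightarrow> real"
  fix e :: real assume e: "0 < e"
  have sI: "sq_int lebesgue ?I" using A by auto
  obtain \<zeta> where \<zeta>: "\<And>n. \<zeta> n \<in> test_functions UNIV" "(\<lambda>n. ?N (\<lambda>x. \<zeta> n x - indicator A x)) \<longlonglongrightarrow> 0"
    by (rule test_approx_indicator_L2[OF A]) (rule that)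
  have "\<forall>\<^sub>F n in sequentially. ?N (\<lambda>x. \<zeta> n x - indicator A x) < e / 4"
    using e by (intro order_tendstoD(2)[OF \<zeta>(2)]) simp
  then obtain m where m: "?N (\<lambda>x. \<zeta> m x - indicator A x) < e / 4" by (auto simp: eventually_sequentially)
  define \<phi> where "\<phi> = \<zeta> m"
  have \<phi>: "\<phi> \<in> test_functions UNIV" using \<zeta>(1) by (simp add: \<phi>_def)
  have s\<phi>: "sq_int lebesgue \<phi>" by (rule test_sq_int_lebesgue[OF \<phi>])
  have bound: "?N (\<lambda>x. ?I (x + h n *\<^sub>R i) - ?I x) \<le> 2 * ?N (\<lambda>x. \<phi> x - ?I x) + \<bar>h n\<bar> * ?N (partial i \<phi>)" for n
  proof -
    let ?t = "h n *\<^sub>R i"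
    have s: "sq_int lebesgue (\<lambda>x. ?I (x + ?t))" "sq_int lebesgue (\<lambda>x. \<phi> (x + ?t))" "sq_int lebesgue (\<lambda>x. \<phi> x - ?I x)"
      using sI s\<phi> by auto
    have "?N (\<lambda>x. ?I (x + ?t) - ?I x) \<le> ?N (\<lambda>x. ?I (x + ?t) - \<phi> (x + ?t)) + ?N (\<lambda>x. \<phi> (x + ?t) - ?I x)"
      by (rule nrm_diff_triangle[OF s(1,2) sI])
    also have "?N (\<lambda>x. \<phi> (x + ?t) - ?I x) \<le> ?N (\<lambda>x. \<phi> (x + ?t) - \<phi> x) + ?N (\<lambda>x. \<phi> x - ?I x)"
      by (rule nrm_diff_triangle[OF s(2) s\<phi> sI])
    also have "?N (\<lambda>x. ?I (x + ?t) - \<phi> (x + ?t)) = ?N (\<lambda>x. \<phi> x - ?I x)"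
      using nrm_translate[OF s(3), of ?t] by (simp add: nrm_diff_commute[of _ "\<lambda>x. \<phi> (x + ?t)"])
    also have "(\<lambda>x. \<phi> (x + ?t) - \<phi> x) = (\<lambda>x. h n *\<^sub>R diff_quot (h n) i \<phi> x)"
      using h(2)[of n] by (simp add: diff_quot_def)
    also have "?N (\<lambda>x. h n *\<^sub>R diff_quot (h n) i \<phi> x) \<le> \<bar>h n\<bar> * ?N (partial i \<phi>)"
      unfolding nrm_scale by (intro mult_left_mono nrm_diff_quot_test_le[OF \<phi> i h(2)]) auto
    finally show ?thesis by simp
  qed
  have "(\<lambda>n. 2 * ?N (\<lambda>x. \<phi> x - ?I x) + \<bar>h n\<bar> * ?N (partial i \<phi>)) \<longlonglongrightarrow> 2 * ?N (\<lambda>x. \<phi> x - ?I x) + \<bar>0\<bar> * ?N (partial i \<phi>)"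
    by (intro tendsto_intros h)
  moreover have "2 * ?N (\<lambda>x. \<phi> x - ?I x) + \<bar>0\<bar> * ?N (partial i \<phi>) < e" using m e by (simp add: \<phi>_def)
  ultimately have "\<forall>\<^sub>F n in sequentially. 2 * ?N (\<lambda>x. \<phi> x - ?I x) + \<bar>h n\<bar> * ?N (partial i \<phi>) < e"
    by (rule order_tendstoD(2))
  then obtain N where N: "\<And>n. N \<le> n \<Longrightarrow> 2 * ?N (\<lambda>x. \<phi> x - ?I x) + \<bar>h n\<bar> * ?N (partial i \<phi>) < e"
    by (auto simp: eventually_sequentially)
  then have "?N (\<lambda>x. ?I (x + h n *\<^sub>R i) - ?I x) < e" if "N \<le> n" for n
    using bound[of n] that by (meson order.strict_trans1)
  then show "\<exists>N. \<forall>n\<ge>N. norm (?N (\<lambda>x. ?I (x + h n *\<^sub>R i) - ?I x) - 0) < e" by auto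
qed

text \<open>
  If a bounded sequence converges weakly to \<open>q\<close> and each of its members vanishes on \<open>A\<close> outside a
  small set, then \<open>q\<close> has integral zero over \<open>A\<close>. The small set is controlled by the functions \<open>e n\<close>,
  which are at least \<open>1\<close> on it. Weak convergence is required against test functions only; the
  bound \<open>C\<close> extends it to the indicator of \<open>A\<close>.
\<close>

lemma weak_limit_zero_on_set:
  fixes q :: "'a::euclidean_space \<Rightarrow> real" and Q e :: "nat \<Rightarrow> 'a \<Rightarrow> real"
  assumes A: "A \<in> lmeasurable" and q: "sq_int lebesgue q" and Q: "\<And>n. sq_int lebesgue (Q n)"
    and C: "\<And>n. nrm lebesgue (Q n) \<le> C"
    and weak: "\<And>\<psi>. \<psi> \<in> test_functions UNIV \<Longrightarrow> (\<lambda>n. ip lebesgue (Q n) \<psi>) \<longlonglongrightarrow> ip lebesgue q \<psi>"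
    and e: "\<And>n. sq_int lebesgue (e n)" "(\<lambda>n. nrm lebesgue (e n)) \<longlonglongrightarrow> 0"
    and van: "\<And>n x. x \<in> A \<Longrightarrow> Q n x \<noteq> 0 \<Longrightarrow> 1 \<le> \<bar>e n x\<bar>"
  shows "ip lebesgue q (indicator A) = 0"
proof -
  let ?N = "nrm (lebesgue :: 'a measure)" and ?I = "indicator A :: 'a \<Rightarrow> real"
  have sI: "sq_int lebesgue ?I" using A by auto
  have C0: "0 \<le> C" using C nrm_nonneg order_trans by blast
  have lim0: "(\<lambda>n. ip lebesgue (Q n) ?I) \<longlonglongrightarrow> 0"
  proof (rule Lim_null_comparison)
    show "\<forall>\<^sub>F n in sequentially. norm (ip lebesgue (Q n) ?I) \<le> C * ?N (e n)"
    proof (rule always_eventually, rule)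
      fix n
      have abs: "sq_int lebesgue (\<lambda>x. \<bar>Q n x\<bar>)" "sq_int lebesgue (\<lambda>x. \<bar>e n x\<bar>)"
        using sq_int_norm_le[of lebesgue "Q n" "\<lambda>x. \<bar>Q n x\<bar>" 1] sq_int_norm_le[of lebesgue "e n" "\<lambda>x. \<bar>e n x\<bar>" 1]
          Q[of n] e(1)[of n] sq_int_measurable[OF Q[of n]] sq_int_measurable[OF e(1)[of n]] by auto
      have "norm (ip lebesgue (Q n) ?I) \<le> (LINT x|lebesgue. norm (Q n x * ?I x))"
        unfolding ip_def inner_real_def by (rule integral_norm_bound)
      also have "\<dots> \<le> (LINT x|lebesgue. \<bar>Q n x\<bar> * \<bar>e n x\<bar>)"
      proof (rule integral_mono)
        show "integrable lebesgue (\<lambda>x. norm (Q n x * ?I x))"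
          using integrable_mult_sq[OF Q sI] by auto
        show "integrable lebesgue (\<lambda>x. \<bar>Q n x\<bar> * \<bar>e n x\<bar>)"
          by (rule integrable_mult_sq[OF abs])
        show "norm (Q n x * ?I x) \<le> \<bar>Q n x\<bar> * \<bar>e n x\<bar>" for x
          using van[of x n] mult_left_mono[of 1 "\<bar>e n x\<bar>" "\<bar>Q n x\<bar>"]
          by (cases "x \<in> A"; cases "Q n x = 0") auto
      qed
      also have "\<dots> = ip lebesgue (\<lambda>x. \<bar>Q n x\<bar>) (\<lambda>x. \<bar>e n x\<bar>)" by (simp add: ip_def)
      also have "\<dots> \<le> ?N (\<lambda>x. \<bar>Q n x\<bar>) * ?N (\<lambda>x. \<bar>e n x\<bar>)" using ip_Cauchy_Schwarz[OF abs] by linarith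
      also have "\<dots> = ?N (Q n) * ?N (e n)" by (simp add: nrm_def)
      also have "\<dots> \<le> C * ?N (e n)" by (intro mult_right_mono C) auto
      finally show "norm (ip lebesgue (Q n) ?I) \<le> C * ?N (e n)" .
    qed
    show "(\<lambda>n. C * ?N (e n)) \<longlonglongrightarrow> 0" using tendsto_mult_right_zero[OF e(2)] by simp
  qed
  obtain \<zeta> where \<zeta>: "\<And>n. \<zeta> n \<in> test_functions UNIV" "(\<lambda>n. ?N (\<lambda>x. \<zeta> n x - indicator A x)) \<longlonglongrightarrow> 0"
    by (rule test_approx_indicator_L2[OF A]) (rule that)
  have bound: "\<bar>ip lebesgue q ?I\<bar> \<le> (?N q + C) * ?N (\<lambda>x. \<zeta> m x - ?I x)" for m
  proof -
    let ?d = "\<lambda>x. \<zeta> m x - ?I x"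
    have s\<zeta>: "sq_int lebesgue (\<zeta> m)" by (rule test_sq_int_lebesgue[OF \<zeta>(1)])
    have sd: "sq_int lebesgue ?d" using s\<zeta> sI by auto
    have "(\<lambda>n. \<bar>ip lebesgue (Q n) ?I - (ip lebesgue (Q n) (\<zeta> m) - ip lebesgue q (\<zeta> m)) - ip lebesgue q ?I\<bar>)
       \<longlonglongrightarrow> \<bar>0 - (ip lebesgue q (\<zeta> m) - ip lebesgue q (\<zeta> m)) - ip lebesgue q ?I\<bar>"
      by (intro tendsto_intros lim0 weak \<zeta>(1))
    moreover have "\<bar>ip lebesgue (Q n) ?I - (ip lebesgue (Q n) (\<zeta> m) - ip lebesgue q (\<zeta> m)) - ip lebesgue q ?I\<bar>
       \<le> (?N q + C) * ?N ?d" for n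
    proof -
      have "ip lebesgue (Q n) ?I - (ip lebesgue (Q n) (\<zeta> m) - ip lebesgue q (\<zeta> m)) - ip lebesgue q ?I
        = ip lebesgue q ?d - ip lebesgue (Q n) ?d"
        using ip_diff_right[OF s\<zeta> sI q] ip_diff_right[OF s\<zeta> sI Q[of n]] by simp
      moreover have "\<bar>ip lebesgue (Q n) ?d\<bar> \<le> C * ?N ?d"
        using ip_Cauchy_Schwarz[OF Q[of n] sd] mult_right_mono[OF C[of n] nrm_nonneg[of lebesgue ?d]] by linarith
      ultimately show ?thesis
        using ip_Cauchy_Schwarz[OF q sd] by (simp add: distrib_right)
    qed
    ultimately have "\<bar>0 - (ip lebesgue q (\<zeta> m) - ip lebesgue q (\<zeta> m)) - ip lebesgue q ?I\<bar> \<le> (?N q + C) * ?N ?d"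
      by (intro LIMSEQ_le_const2) auto
    then show ?thesis by simp
  qed
  have "(\<lambda>m. (?N q + C) * ?N (\<lambda>x. \<zeta> m x - ?I x)) \<longlonglongrightarrow> (?N q + C) * 0"
    by (intro tendsto_intros \<zeta>(2))
  then have "\<bar>ip lebesgue q ?I\<bar> \<le> (?N q + C) * 0" by (rule LIMSEQ_le_const) (use bound in auto)
  then show ?thesis by simp
qed

lemma AE_zero_on_zero_set:
  fixes q w :: "'a::euclidean_space \<Rightarrow> real"
  assumes q: "sq_int lebesgue q" and w: "w \<in> borel_measurable lebesgue"
    and zero: "\<And>A. A \<in> lmeasurable \<Longrightarrow> (\<And>x. x \<in> A \<Longrightarrow> w x = 0) \<Longrightarrow> ip lebesgue q (indicator A) = 0"
  shows "AE x in lebesgue. w x = 0 \<longrightarrow> q x = 0"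
proof -
  have half: "AE x in lebesgue. w x = 0 \<longrightarrow> p x \<le> 0"
    if p: "sq_int lebesgue p" and zp: "\<And>A. A \<in> lmeasurable \<Longrightarrow> (\<And>x. x \<in> A \<Longrightarrow> w x = 0) \<Longrightarrow> ip lebesgue p (indicator A) = 0"
    for p :: "'a \<Rightarrow> real"
  proof -
    have [measurable]: "p \<in> borel_measurable lebesgue" "w \<in> borel_measurable lebesgue"
      using p w by (auto intro: sq_int_measurable)
    have "AE x in lebesgue. x \<in> ball 0 (real n) \<longrightarrow> w x = 0 \<longrightarrow> p x \<le> 0" for n
    proof -
      define A where "A = {x \<in> space lebesgue. w x = 0 \<and> 0 < p x} \<inter> ball 0 (real n)"
      have "{x \<in> space lebesgue. w x = 0 \<and> 0 < p x} \<in> sets lebesgue" by measurable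
      then have A: "A \<in> lmeasurable"
        unfolding A_def by (intro bounded_set_imp_lmeasurable) (auto intro: bounded_Int)
      have int: "integrable lebesgue (\<lambda>x. p x * indicator A x)" using p A by (intro integrable_mult_sq) auto
      have "(LINT x|lebesgue. p x * indicator A x) = 0"
        using zp[OF A] by (simp add: ip_def A_def)
      moreover have "AE x in lebesgue. 0 \<le> p x * indicator A x"
        by (auto simp: A_def indicator_def)
      ultimately have "AE x in lebesgue. p x * indicator A x = 0"
        using integral_nonneg_eq_0_iff_AE[OF int] by simp
      then show ?thesis by eventually_elim (auto simp: A_def indicator_def split: if_splits)
    qed
    then have "AE x in lebesgue. \<forall>n::nat. x \<in> ball 0 (real n) \<longrightarrow> w x = 0 \<longrightarrow> p x \<le> 0"
      unfolding AE_all_countable by blast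
    then show ?thesis
    proof eventually_elim
      case (elim x)
      obtain n where "norm x < real n" using reals_Archimedean2 by blast
      with elim show ?case by auto
    qed
  qed
  have "AE x in lebesgue. w x = 0 \<longrightarrow> q x \<le> 0" by (rule half[OF q zero])
  moreover have "AE x in lebesgue. w x = 0 \<longrightarrow> - q x \<le> 0"
    by (rule half) (use q zero in auto)
  ultimately show ?thesis by eventually_elim auto
qed

lemma H0_UNIV_components:
  assumes "W \<in> H0 UNIV"
  shows "sq_int lebesgue W" "sq_int lebesgue (\<lambda>x. fst (W x))" "sq_int lebesgue (\<lambda>x. snd (W x))"
  using H0_sq_int[OF assms] by (auto simp: lebesgue_on_UNIV_eq)

lemma H0_UNIV_sequence:
  assumes "W \<in> H0 UNIV"
  obtains \<phi> where "\<And>n. \<phi> n \<in> test_functions UNIV" "\<And>n. sq_int lebesgue (jet (\<phi> n))"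
    "(\<lambda>n. nrm lebesgue (\<lambda>x. jet (\<phi> n) x - W x)) \<longlonglongrightarrow> 0"
proof -
  obtain \<phi> where \<phi>: "\<And>n. \<phi> n \<in> test_functions UNIV"
    "(\<lambda>n. nrm (lebesgue_on UNIV) (\<lambda>x. jet (\<phi> n) x - W x)) \<longlonglongrightarrow> 0"
    by (rule H0_sequence[OF assms]) (rule that)
  moreover have "sq_int lebesgue (jet (\<phi> n))" for n
    using jet_sq_int[OF \<phi>(1) open_UNIV, of n] by (simp add: lebesgue_on_UNIV_eq)
  ultimately show thesis using that[of \<phi>] by (simp add: lebesgue_on_UNIV_eq)
qed

text \<open>
  The bound for test functions survives the limit, because for a fixed step \<open>h\<close> the difference
  quotient is a bounded operator.
\<close>

lemma nrm_diff_quot_le: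
  assumes W: "W \<in> H0 UNIV" and i: "i \<in> Basis" and h: "h \<noteq> 0"
  shows "nrm lebesgue (diff_quot h i (\<lambda>x. fst (W x))) \<le> nrm lebesgue (\<lambda>x. snd (W x) \<bullet> i)"
proof -
  let ?N = "nrm lebesgue"
  note s = H0_UNIV_components[OF W]
  obtain \<phi> where \<phi>: "\<And>n. \<phi> n \<in> test_functions UNIV" "\<And>n. sq_int lebesgue (jet (\<phi> n))"
    "(\<lambda>n. ?N (\<lambda>x. jet (\<phi> n) x - W x)) \<longlonglongrightarrow> 0"
    by (rule H0_UNIV_sequence[OF W]) (rule that)
  have s\<phi>: "sq_int lebesgue (\<phi> n)" "sq_int lebesgue (partial i (\<phi> n))" for n
    using test_sq_int_lebesgue[OF \<phi>(1)] test_sq_int_lebesgue[OF test_partial[OF \<phi>(1) i]] by auto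
  have sd: "sq_int lebesgue (\<lambda>x. jet (\<phi> n) x - W x)" for n using \<phi>(2) s(1) by auto
  have lim1: "(\<lambda>n. ?N (diff_quot h i (\<phi> n))) \<longlonglongrightarrow> ?N (diff_quot h i (\<lambda>x. fst (W x)))"
  proof (rule nrm_tendsto)
    have "?N (\<lambda>x. diff_quot h i (\<phi> n) x - diff_quot h i (\<lambda>x. fst (W x)) x) \<le> 2 / \<bar>h\<bar> * ?N (\<lambda>x. jet (\<phi> n) x - W x)" for n
    proof -
      have "?N (diff_quot h i (\<lambda>x. \<phi> n x - fst (W x))) \<le> 2 / \<bar>h\<bar> * ?N (\<lambda>x. \<phi> n x - fst (W x))"
        using s\<phi>(1)[of n] s(2) by (intro nrm_diff_quot_crude) auto
      also have "\<dots> \<le> 2 / \<bar>h\<bar> * ?N (\<lambda>x. jet (\<phi> n) x - W x)"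
        using nrm_fst_le[OF sd[of n]] by (intro mult_left_mono) auto
      finally show ?thesis by (simp add: diff_quot_diff)
    qed
    moreover have "(\<lambda>n. 2 / \<bar>h\<bar> * ?N (\<lambda>x. jet (\<phi> n) x - W x)) \<longlonglongrightarrow> 2 / \<bar>h\<bar> * 0"
      by (intro tendsto_mult_left \<phi>(3))
    then have lim: "(\<lambda>n. 2 / \<bar>h\<bar> * ?N (\<lambda>x. jet (\<phi> n) x - W x)) \<longlonglongrightarrow> 0" by simp
    ultimately show "(\<lambda>n. ?N (\<lambda>x. diff_quot h i (\<phi> n) x - diff_quot h i (\<lambda>x. fst (W x)) x)) \<longlonglongrightarrow> 0"
      by (intro tendsto_sandwich[OF _ _ tendsto_const lim]) auto
  qed (use s\<phi> s in auto)
  have lim2: "(\<lambda>n. ?N (partial i (\<phi> n))) \<longlonglongrightarrow> ?N (\<lambda>x. snd (W x) \<bullet> i)"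
  proof (rule nrm_tendsto)
    have "?N (\<lambda>x. partial i (\<phi> n) x - snd (W x) \<bullet> i) \<le> 1 * ?N (\<lambda>x. jet (\<phi> n) x - W x)" for n
    proof (rule nrm_mono[OF sd])
      show "(\<lambda>x. partial i (\<phi> n) x - snd (W x) \<bullet> i) \<in> borel_measurable lebesgue"
        by (rule sq_int_measurable) (use s\<phi>(2)[of n] s(3) in auto)
      have "norm (partial i (\<phi> n) x - snd (W x) \<bullet> i) \<le> 1 * norm (jet (\<phi> n) x - W x)" for x
        using Basis_le_norm[OF i, of "snd (jet (\<phi> n) x - W x)"] norm_snd_le'[of "jet (\<phi> n) x - W x"] i
        by (simp add: inner_diff_left)
      then show "AE x in lebesgue. norm (partial i (\<phi> n) x - snd (W x) \<bullet> i) \<le> 1 * norm (jet (\<phi> n) x - W x)"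
        by auto
    qed simp
    then show "(\<lambda>n. ?N (\<lambda>x. partial i (\<phi> n) x - snd (W x) \<bullet> i)) \<longlonglongrightarrow> 0"
      by (intro tendsto_sandwich[OF _ _ tendsto_const \<phi>(3)]) auto
  qed (use s\<phi> s in auto)
  show ?thesis
    by (rule LIMSEQ_le[OF lim1 lim2]) (use nrm_diff_quot_test_le[OF \<phi>(1) i h] in auto)
qed

lemma ip_partial_H0:
  assumes W: "W \<in> H0 UNIV" and i: "i \<in> Basis" and \<psi>: "\<psi> \<in> test_functions UNIV"
  shows "ip lebesgue (\<lambda>x. fst (W x)) (partial i \<psi>) = - ip lebesgue (\<lambda>x. snd (W x) \<bullet> i) \<psi>"
  using H0_weak_gradient[OF open_UNIV W] \<psi> i
  by (simp add: has_weak_gradient_def lebesgue_on_UNIV_eq ip_def)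

text \<open>
  For \<open>x\<close> in a set \<open>A\<close> on which \<open>w\<close> vanishes, the difference quotient of \<open>w\<close> is zero unless
  \<open>x + h i\<close> lies outside \<open>A\<close>, which happens on a set of small measure. Weakly, the difference
  quotients tend to the partial derivative.
\<close>

lemma gradient_zero_on_zero_set:
  assumes W: "W \<in> H0 UNIV" and i: "i \<in> Basis"
  shows "AE x in lebesgue. fst (W x) = 0 \<longrightarrow> snd (W x) \<bullet> i = 0"
proof (rule AE_zero_on_zero_set)
  note s = H0_UNIV_components[OF W]
  let ?w = "\<lambda>x. fst (W x)"
  show "sq_int lebesgue (\<lambda>x. snd (W x) \<bullet> i)" "?w \<in> borel_measurable lebesgue"
    using s sq_int_measurable[OF s(2)] by auto
  fix A assume A: "A \<in> lmeasurable" "\<And>x. x \<in> A \<Longrightarrow> ?w x = 0"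
  define h :: "nat \<Rightarrow> real" where "h n = 1 / Suc n" for n
  have h: "h \<longlonglongrightarrow> 0" "h n \<noteq> 0" for n
    unfolding h_def by (rule LIMSEQ_Suc[OF lim_1_over_n]) simp
  show "ip lebesgue (\<lambda>x. snd (W x) \<bullet> i) (indicator A) = 0"
  proof (rule weak_limit_zero_on_set[OF A(1), where Q="\<lambda>n. diff_quot (h n) i ?w"
      and e="\<lambda>n x. indicator A (x + h n *\<^sub>R i) - indicator A x"])
    show "sq_int lebesgue (\<lambda>x. indicator A (x + h n *\<^sub>R i) - indicator A x :: real)" for n
      using sq_int_indicator[OF A(1)] by (intro sq_int_diff sq_int_translate)
    show "nrm lebesgue (diff_quot (h n) i ?w) \<le> nrm lebesgue (\<lambda>x. snd (W x) \<bullet> i)" for n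
      by (rule nrm_diff_quot_le[OF W i h(2)])
    show "(\<lambda>n. nrm lebesgue (\<lambda>x. indicator A (x + h n *\<^sub>R i) - indicator A x :: real)) \<longlonglongrightarrow> 0"
      by (rule indicator_translate_tendsto[OF A(1) i h])
    show "1 \<le> \<bar>indicator A (x + h n *\<^sub>R i) - indicator A x :: real\<bar>" if "x \<in> A" "diff_quot (h n) i ?w x \<noteq> 0" for n x
      using that A(2)[of x] A(2)[of "x + h n *\<^sub>R i"] by (auto simp: diff_quot_def indicator_def)
    fix \<psi> :: "'a \<Rightarrow> real" assume \<psi>: "\<psi> \<in> test_functions UNIV"
    have s\<psi>: "sq_int lebesgue \<psi>" "sq_int lebesgue (partial i \<psi>)"
      using test_sq_int_lebesgue[OF \<psi>] test_sq_int_lebesgue[OF test_partial[OF \<psi> i]] by auto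
    have "(\<lambda>n. - ip lebesgue (diff_quot (- h n) i \<psi>) ?w) \<longlonglongrightarrow> - ip lebesgue (partial i \<psi>) ?w"
      using h tendsto_minus[OF h(1)] s\<psi> s
      by (intro tendsto_minus ip_tendsto_left diff_quot_tendsto_L2[OF \<psi> i]) auto
    then show "(\<lambda>n. ip lebesgue (diff_quot (h n) i ?w) \<psi>) \<longlonglongrightarrow> ip lebesgue (\<lambda>x. snd (W x) \<bullet> i) \<psi>"
      using ip_partial_H0[OF W i \<psi>] ip_diff_quot[OF s\<psi>(1) s(2)] by (simp add: ip_commute)
  qed (use s in auto)
qed

lemma H0_UNIV_translate:
  assumes W: "W \<in> H0 UNIV" shows "(\<lambda>x. W (x + a)) \<in> H0 UNIV"
  unfolding H0_def lebesgue_on_UNIV_eq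
proof safe
  note s = H0_UNIV_components[OF W]
  show "sq_int lebesgue (\<lambda>x. W (x + a))" using s(1) by auto
  fix e :: real assume "0 < e"
  then obtain \<phi> where \<phi>: "\<phi> \<in> test_functions UNIV" "nrm lebesgue (\<lambda>x. W x - jet \<phi> x) < e"
    using W by (auto simp: H0_def lebesgue_on_UNIV_eq)
  have "sq_int lebesgue (jet \<phi>)" using jet_sq_int[OF \<phi>(1) open_UNIV] by (simp add: lebesgue_on_UNIV_eq)
  then have "nrm lebesgue (\<lambda>x. W (x + a) - jet \<phi> (x + a)) < e"
    using nrm_translate[OF sq_int_diff[OF s(1)], of "jet \<phi>" a] \<phi>(2) by simp
  moreover have "jet (\<lambda>x. \<phi> (x + a)) x = jet \<phi> (x + a)" for x
    by (simp add: jet_def grad_def partial_translate[OF test_smooth[OF \<phi>(1)]])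
  ultimately show "\<exists>\<phi>\<in>test_functions UNIV. nrm lebesgue (\<lambda>x. W (x + a) - jet \<phi> x) < e"
    using test_translate[OF \<phi>(1), of a] by (intro bexI[of _ "\<lambda>x. \<phi> (x + a)"]) auto
qed

lemma H0_UNIV_diff_quot: "W \<in> H0 UNIV \<Longrightarrow> diff_quot h i W \<in> H0 UNIV"
proof -
  assume W: "W \<in> H0 UNIV"
  have "(\<lambda>x. (1 / h) *\<^sub>R W (x + h *\<^sub>R i) + (- 1 / h) *\<^sub>R W x) \<in> H0 UNIV"
    by (rule H0_comb[OF open_UNIV H0_UNIV_translate[OF W] W])
  then show ?thesis by (simp add: diff_quot_def[abs_def] scaleR_diff_right)
qed

lemma fst_diff_quot: "fst (diff_quot h i W x) = diff_quot h i (\<lambda>x. fst (W x)) x"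
  and snd_diff_quot: "snd (diff_quot h i W x) = diff_quot h i (\<lambda>x. snd (W x)) x"
  by (simp_all add: diff_quot_def)

text \<open>
  This is the difference quotient method of elliptic regularity: testing the equation with the second
  difference \<open>S\<close> of \<open>w\<close> gives \<open>\<parallel>D \<nabla>w\<parallel>\<^sup>2 = -\<integral>k S \<le> \<parallel>k\<parallel> \<parallel>S\<parallel>\<close>, where \<open>D\<close> is the difference quotient, and
  \<open>\<parallel>S\<parallel> \<le> \<parallel>D \<nabla>w\<parallel>\<close>.
\<close>

lemma second_difference_bound:
  assumes W: "W \<in> H0 UNIV" and i: "i \<in> Basis" and h: "h \<noteq> 0" and k: "sq_int lebesgue k"
    and eq: "\<And>\<psi>. \<psi> \<in> test_functions UNIV \<Longrightarrow> ip lebesgue (\<lambda>x. snd (W x)) (grad \<psi>) = ip lebesgue k \<psi>"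
  shows "nrm lebesgue (diff_quot (- h) i (diff_quot h i (\<lambda>x. fst (W x)))) \<le> nrm lebesgue k"
proof -
  let ?N = "nrm lebesgue"
  let ?S = "diff_quot (- h) i (diff_quot h i (\<lambda>x. fst (W x)))" and ?D = "diff_quot h i (\<lambda>x. snd (W x))"
  note s = H0_UNIV_components[OF W]
  have D: "sq_int lebesgue ?D" using s by auto
  have S: "sq_int lebesgue ?S" using s by auto
  have "ip lebesgue (\<lambda>x. snd (W x)) (\<lambda>x. snd (diff_quot (- h) i (diff_quot h i W) x)) = ip lebesgue k (\<lambda>x. fst (diff_quot (- h) i (diff_quot h i W) x))"
    using H0_Green[OF open_UNIV H0_UNIV_diff_quot[OF H0_UNIV_diff_quot[OF W]], of "\<lambda>x. snd (W x)" k] s k eq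
    by (simp add: lebesgue_on_UNIV_eq)
  then have "ip lebesgue (\<lambda>x. snd (W x)) (diff_quot (- h) i ?D) = ip lebesgue k ?S"
    by (simp add: fst_diff_quot snd_diff_quot)
  then have "(?N ?D)\<^sup>2 = - ip lebesgue k ?S"
    using ip_diff_quot[OF s(3) D, of "- h" i] by (simp add: nrm_sq)
  also have "\<dots> \<le> ?N k * ?N ?S" using ip_Cauchy_Schwarz[OF k S] by linarith
  finally have 1: "(?N ?D)\<^sup>2 \<le> ?N k * ?N ?S" .
  have "?N ?S \<le> ?N (\<lambda>x. ?D x \<bullet> i)"
    using nrm_diff_quot_le[OF H0_UNIV_diff_quot[OF W] i, of "- h" h i] h by (simp add: fst_diff_quot snd_diff_quot)
  also have "\<dots> \<le> 1 * ?N ?D"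
    using Basis_le_norm[OF i] sq_int_measurable[OF sq_int_inner_const[OF D, of i]]
    by (intro nrm_mono[OF D]) auto
  finally have 2: "?N ?S \<le> ?N ?D" by simp
  have "?N ?D * ?N ?D \<le> ?N k * ?N ?D"
    using 1 mult_left_mono[OF 2, of "?N k"] by (simp add: power2_eq_square)
  then have "?N ?D \<le> ?N k"
    by (cases "?N ?D = 0") (auto simp: mult_le_cancel_right order_less_le)
  with 2 show ?thesis by linarith
qed

lemma second_diff_quot_tendsto_L2:
  assumes \<psi>: "\<psi> \<in> test_functions UNIV" and i: "i \<in> Basis" and h: "h \<longlonglongrightarrow> 0" "\<And>n. h n \<noteq> 0"
  shows "(\<lambda>n. nrm lebesgue (\<lambda>x. diff_quot (- h n) i (diff_quot (h n) i \<psi>) x - partial i (partial i \<psi>) x)) \<longlonglongrightarrow> 0"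
proof -
  let ?N = "nrm lebesgue" and ?p = "partial i \<psi>"
  have p: "?p \<in> test_functions UNIV" by (rule test_partial[OF \<psi> i])
  have pp: "partial i ?p \<in> test_functions UNIV" by (rule test_partial[OF p i])
  have bound: "?N (\<lambda>x. diff_quot (- h n) i (diff_quot (h n) i \<psi>) x - partial i ?p x)
     \<le> ?N (\<lambda>x. diff_quot (h n) i ?p x - partial i ?p x) + ?N (\<lambda>x. diff_quot (- h n) i ?p x - partial i ?p x)" for n
  proof -
    have t: "(\<lambda>x. diff_quot (h n) i \<psi> x - ?p x) \<in> test_functions UNIV" using \<psi> p by auto
    have "?N (\<lambda>x. diff_quot (- h n) i (diff_quot (h n) i \<psi>) x - partial i ?p x)
      \<le> ?N (\<lambda>x. diff_quot (- h n) i (diff_quot (h n) i \<psi>) x - diff_quot (- h n) i ?p x) + ?N (\<lambda>x. diff_quot (- h n) i ?p x - partial i ?p x)"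
      using test_sq_int_lebesgue[OF \<psi>] test_sq_int_lebesgue[OF p] test_sq_int_lebesgue[OF pp]
      by (intro nrm_diff_triangle) auto
    also have "?N (\<lambda>x. diff_quot (- h n) i (diff_quot (h n) i \<psi>) x - diff_quot (- h n) i ?p x) = ?N (diff_quot (- h n) i (\<lambda>x. diff_quot (h n) i \<psi> x - ?p x))"
      by (simp add: diff_quot_diff)
    also have "\<dots> \<le> ?N (partial i (\<lambda>x. diff_quot (h n) i \<psi> x - ?p x))"
      using h(2) by (intro nrm_diff_quot_test_le[OF t i]) simp
    also have "partial i (\<lambda>x. diff_quot (h n) i \<psi> x - ?p x) = (\<lambda>x. diff_quot (h n) i ?p x - partial i ?p x)"
      using partial_diff[OF smooth_differentiable smooth_differentiable, OF test_smooth test_smooth, OF diff_quot_test[OF \<psi>] p]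
      by (simp add: partial_diff_quot[OF test_smooth[OF \<psi>]])
    finally show ?thesis by simp
  qed
  have "(\<lambda>n. ?N (\<lambda>x. diff_quot (h n) i ?p x - partial i ?p x) + ?N (\<lambda>x. diff_quot (- h n) i ?p x - partial i ?p x)) \<longlonglongrightarrow> 0 + 0"
    using h tendsto_minus[OF h(1)] by (intro tendsto_add diff_quot_tendsto_L2[OF p i]) auto
  then have lim: "(\<lambda>n. ?N (\<lambda>x. diff_quot (h n) i ?p x - partial i ?p x) + ?N (\<lambda>x. diff_quot (- h n) i ?p x - partial i ?p x)) \<longlonglongrightarrow> 0"
    by simp
  show ?thesis by (rule tendsto_sandwich[OF _ _ tendsto_const lim]) (use bound in auto)
qed

lemma nrm_sum_le:
  assumes "finite I" "\<And>i. i \<in> I \<Longrightarrow> sq_int M (f i)"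
  shows "nrm M (\<lambda>x. \<Sum>i\<in>I. f i x) \<le> (\<Sum>i\<in>I. nrm M (f i))"
  using assms
proof (induction I rule: finite_induct)
  case (insert j I)
  have "nrm M (\<lambda>x. f j x + (\<Sum>i\<in>I. f i x)) \<le> nrm M (f j) + nrm M (\<lambda>x. \<Sum>i\<in>I. f i x)"
    using insert.prems by (intro nrm_triangle) auto
  with insert show ?case by simp
qed simp

lemma ip_sum_left:
  assumes "\<And>i. i \<in> I \<Longrightarrow> sq_int M (f i)" "sq_int M g"
  shows "ip M (\<lambda>x. \<Sum>i\<in>I. f i x) g = (\<Sum>i\<in>I. ip M (f i) g)"
  using integrable_inner[OF assms(1) assms(2)] by (simp add: ip_def inner_sum_left)

lemma ip_grad:
  assumes "sq_int M G" "\<And>i. i \<in> Basis \<Longrightarrow> sq_int M (partial i \<psi>)"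
  shows "ip M G (grad \<psi>) = (\<Sum>i\<in>Basis. ip M (\<lambda>x. G x \<bullet> i) (partial i \<psi>))"
proof -
  have "integrable M (\<lambda>x. (G x \<bullet> i) * partial i \<psi> x)" if "i \<in> Basis" for i
    using assms that by (intro integrable_mult_sq) auto
  moreover have "ip M G (grad \<psi>) = (LINT x|M. (\<Sum>i\<in>Basis. (G x \<bullet> i) * partial i \<psi> x))"
    by (simp add: ip_def grad_def inner_sum_right mult.commute)
  ultimately show ?thesis
    by (simp add: ip_def Bochner_Integration.integral_sum)
qed

text \<open>
  A function whose Laplacian \<open>-k\<close> is square-integrable satisfies \<open>k = 0\<close> almost everywhere on its zero
  set. Its second differences are bounded in \<open>L\<^sup>2\<close> and their sum over the coordinate directions
  converges weakly to \<open>-k\<close>; on a set \<open>A\<close> of zeros they vanish except where one of the translates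
  \<open>x \<plusminus> h i\<close> leaves \<open>A\<close>.
\<close>

lemma source_zero_on_zero_set:
  fixes W :: "'a::euclidean_space \<Rightarrow> real \<times> 'a"
  assumes W: "W \<in> H0 UNIV" and k: "sq_int lebesgue k"
    and eq: "\<And>\<psi>. \<psi> \<in> test_functions UNIV \<Longrightarrow> ip lebesgue (\<lambda>x. snd (W x)) (grad \<psi>) = ip lebesgue k \<psi>"
  shows "AE x in lebesgue. fst (W x) = 0 \<longrightarrow> k x = 0"
proof -
  note s = H0_UNIV_components[OF W]
  let ?w = "\<lambda>x. fst (W x)"
  have "AE x in lebesgue. ?w x = 0 \<longrightarrow> - k x = 0"
  proof (rule AE_zero_on_zero_set)
    show "sq_int lebesgue (\<lambda>x. - k x)" "?w \<in> borel_measurable lebesgue"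
      using k sq_int_measurable[OF s(2)] by auto
    fix A assume A: "A \<in> lmeasurable" "\<And>x. x \<in> A \<Longrightarrow> ?w x = 0"
    define h :: "nat \<Rightarrow> real" where "h n = 1 / Suc n" for n
    have h: "h \<longlonglongrightarrow> 0" "h n \<noteq> 0" for n
      unfolding h_def by (rule LIMSEQ_Suc[OF lim_1_over_n]) simp
    have h': "(\<lambda>n. - h n) \<longlonglongrightarrow> 0" "- h n \<noteq> 0" for n
      using tendsto_minus[OF h(1)] h(2) by auto
    define S where "S n i = diff_quot (- h n) i (diff_quot (h n) i ?w)" for n i
    have sS: "sq_int lebesgue (S n i)" for n i unfolding S_def using s by auto
    define d where "d t i x = \<bar>indicator A (x + t *\<^sub>R i) - indicator A x :: real\<bar>" for t i x
    have sI: "sq_int lebesgue (indicator A :: 'a \<Rightarrow> real)" using A by auto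
    have sd: "sq_int lebesgue (d t i)" for t i
    proof (rule sq_int_norm_le[where c=1])
      show *: "sq_int lebesgue (\<lambda>x. indicator A (x + t *\<^sub>R i) - indicator A x :: real)"
        using sI by auto
      show "d t i \<in> borel_measurable lebesgue"
        using sq_int_measurable[OF *] unfolding d_def by measurable
    qed (simp add: d_def)
    have lim_d: "(\<lambda>n. nrm lebesgue (d (t n) i)) \<longlonglongrightarrow> 0" if "i \<in> Basis" "t \<longlonglongrightarrow> 0" "\<And>n. t n \<noteq> 0" for t i
      using indicator_translate_tendsto[OF A(1) that] by (simp add: nrm_def d_def)
    \<comment> \<open>At a point of \<open>A\<close> this counts the translates that leave \<open>A\<close>.\<close>
    define e where "e n x = (\<Sum>i\<in>Basis. d (h n) i x + d (- h n) i x)" for n x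
    show "ip lebesgue (\<lambda>x. - k x) (indicator A) = 0"
    proof (rule weak_limit_zero_on_set[OF A(1), where Q="\<lambda>n x. \<Sum>i\<in>Basis. S n i x" and e=e])
      show "sq_int lebesgue (\<lambda>x. - k x)" using k by auto
      show "sq_int lebesgue (\<lambda>x. \<Sum>i\<in>Basis. S n i x)" for n using sS by auto
      show "sq_int lebesgue (e n)" for n unfolding e_def by (intro sq_int_sum sq_int_add sd)
      show "nrm lebesgue (\<lambda>x. \<Sum>i\<in>Basis. S n i x) \<le> (\<Sum>i\<in>(Basis::'a set). nrm lebesgue k)" for n
      proof -
        have "nrm lebesgue (\<lambda>x. \<Sum>i\<in>Basis. S n i x) \<le> (\<Sum>i\<in>Basis. nrm lebesgue (S n i))"
          by (rule nrm_sum_le) (use sS in auto)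
        also have "\<dots> \<le> (\<Sum>i\<in>(Basis::'a set). nrm lebesgue k)"
          unfolding S_def by (intro sum_mono second_difference_bound[OF W _ h(2) k eq])
        finally show ?thesis .
      qed
      have lim: "(\<lambda>n. \<Sum>i\<in>(Basis::'a set). nrm lebesgue (d (h n) i) + nrm lebesgue (d (- h n) i)) \<longlonglongrightarrow> (\<Sum>i\<in>(Basis::'a set). 0 + 0)"
        by (intro tendsto_sum tendsto_add lim_d h h')
      show "(\<lambda>n. nrm lebesgue (e n)) \<longlonglongrightarrow> 0"
      proof (rule tendsto_sandwich[OF _ _ tendsto_const])
        show "(\<lambda>n. \<Sum>i\<in>(Basis::'a set). nrm lebesgue (d (h n) i) + nrm lebesgue (d (- h n) i)) \<longlonglongrightarrow> 0"
          using lim by simp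
        have "nrm lebesgue (e n) \<le> (\<Sum>i\<in>(Basis::'a set). nrm lebesgue (d (h n) i) + nrm lebesgue (d (- h n) i))" for n
        proof -
          have "nrm lebesgue (e n) \<le> (\<Sum>i\<in>(Basis::'a set). nrm lebesgue (\<lambda>x. d (h n) i x + d (- h n) i x))"
            unfolding e_def by (rule nrm_sum_le) (use sd in auto)
          also have "\<dots> \<le> (\<Sum>i\<in>(Basis::'a set). nrm lebesgue (d (h n) i) + nrm lebesgue (d (- h n) i))"
            by (intro sum_mono nrm_triangle sd)
          finally show ?thesis .
        qed
        then show "\<forall>\<^sub>F n in sequentially. nrm lebesgue (e n) \<le> (\<Sum>i\<in>(Basis::'a set). nrm lebesgue (d (h n) i) + nrm lebesgue (d (- h n) i))"
          by auto
      qed simp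
      show "1 \<le> \<bar>e n x\<bar>" if x: "x \<in> A" and ne: "(\<Sum>i\<in>Basis. S n i x) \<noteq> 0" for n x
      proof -
        obtain i :: 'a where i: "i \<in> Basis" "S n i x \<noteq> 0" using ne by (meson sum.neutral)
        have "\<not> (x + h n *\<^sub>R i \<in> A \<and> x - h n *\<^sub>R i \<in> A)"
        proof
          assume "x + h n *\<^sub>R i \<in> A \<and> x - h n *\<^sub>R i \<in> A"
          then have "?w (x + h n *\<^sub>R i) = 0" "?w (x - h n *\<^sub>R i) = 0" "?w x = 0" using A(2) x by auto
          then have "S n i x = 0" by (simp add: S_def diff_quot_def)
          with i show False by simp
        qed
        then have "1 \<le> d (h n) i x + d (- h n) i x" using x by (auto simp: d_def indicator_def)
        also have "\<dots> \<le> e n x" unfolding e_def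
          by (rule member_le_sum[OF i(1)]) (auto simp: d_def)
        finally show ?thesis by simp
      qed
      fix \<psi> :: "'a \<Rightarrow> real" assume \<psi>: "\<psi> \<in> test_functions UNIV"
      have s\<psi>: "sq_int lebesgue \<psi>" by (rule test_sq_int_lebesgue[OF \<psi>])
      have "(\<lambda>n. ip lebesgue (S n i) \<psi>) \<longlonglongrightarrow> - ip lebesgue (\<lambda>x. snd (W x) \<bullet> i) (partial i \<psi>)"
        if i: "i \<in> Basis" for i
      proof -
        have p: "partial i \<psi> \<in> test_functions UNIV" by (rule test_partial[OF \<psi> i])
        have pp: "partial i (partial i \<psi>) \<in> test_functions UNIV" by (rule test_partial[OF p i])
        have "(\<lambda>n. ip lebesgue (diff_quot (- h n) i (diff_quot (h n) i \<psi>)) ?w) \<longlonglongrightarrow> ip lebesgue (partial i (partial i \<psi>)) ?w"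
          by (rule ip_tendsto_left[OF _ _ second_diff_quot_tendsto_L2[OF \<psi> i h]])
             (use s\<psi> test_sq_int_lebesgue[OF pp] s in auto)
        moreover have "ip lebesgue (partial i (partial i \<psi>)) ?w = - ip lebesgue (\<lambda>x. snd (W x) \<bullet> i) (partial i \<psi>)"
          using ip_partial_H0[OF W i p] by (simp add: ip_commute)
        moreover have "ip lebesgue (diff_quot (- h n) i (diff_quot (h n) i \<psi>)) ?w = ip lebesgue (S n i) \<psi>" for n
        proof -
          have "ip lebesgue \<psi> (diff_quot (- h n) i (diff_quot (h n) i ?w)) = - ip lebesgue (diff_quot (h n) i \<psi>) (diff_quot (h n) i ?w)"
            using ip_diff_quot[OF s\<psi> sq_int_diff_quot[OF s(2)], of "- h n" i "h n" i] by simp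
          also have "\<dots> = ip lebesgue (diff_quot (- h n) i (diff_quot (h n) i \<psi>)) ?w"
            using ip_diff_quot[OF sq_int_diff_quot[OF s\<psi>] s(2), of "h n" i "h n" i] by simp
          finally show ?thesis by (simp add: S_def ip_commute)
        qed
        ultimately show ?thesis by simp
      qed
      then have "(\<lambda>n. \<Sum>i\<in>Basis. ip lebesgue (S n i) \<psi>) \<longlonglongrightarrow> (\<Sum>i\<in>Basis. - ip lebesgue (\<lambda>x. snd (W x) \<bullet> i) (partial i \<psi>))"
        by (intro tendsto_sum)
      moreover have "ip lebesgue (\<lambda>x. snd (W x)) (grad \<psi>) = (\<Sum>i\<in>Basis. ip lebesgue (\<lambda>x. snd (W x) \<bullet> i) (partial i \<psi>))"
        using test_sq_int_lebesgue[OF test_partial[OF \<psi>]] s by (intro ip_grad) auto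
      ultimately show "(\<lambda>n. ip lebesgue (\<lambda>x. \<Sum>i\<in>Basis. S n i x) \<psi>) \<longlonglongrightarrow> ip lebesgue (\<lambda>x. - k x) \<psi>"
        using eq[OF \<psi>] sS s\<psi> by (simp add: ip_sum_left sum_negf)
    qed
  qed
  then show ?thesis by simp
qed

section \<open>Localization and the Laplacian on level sets\<close>

lemma sq_int_extend:
  fixes u :: "'a::euclidean_space \<Rightarrow> 'b::euclidean_space"
  assumes \<Omega>: "\<Omega> \<in> sets lebesgue" and u: "sq_int (lebesgue_on \<Omega>) u" and out: "\<And>x. x \<notin> \<Omega> \<Longrightarrow> u x = 0"
  shows "sq_int lebesgue u"
  unfolding sq_int_def
proof
  have 1: "(\<lambda>x. if x \<in> \<Omega> then u x else 0) = u" using out by auto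
  show "u \<in> borel_measurable lebesgue"
    using borel_measurable_if_I[OF sq_int_measurable[OF u] \<Omega>] by (simp only: 1)
  have 2: "(\<lambda>x. if x \<in> \<Omega> then (norm (u x))\<^sup>2 else 0) = (\<lambda>x. (norm (u x))\<^sup>2)" using out by auto
  show "integrable lebesgue (\<lambda>x. (norm (u x))\<^sup>2)"
    using sq_int_integrable[OF u] Lebesgue_Measure.integrable_restrict_UNIV[OF \<Omega>, of "\<lambda>x. (norm (u x))\<^sup>2"]
    by (simp only: 2)
qed

lemma ip_extend:
  assumes "\<Omega> \<in> sets lebesgue" "\<And>x. x \<notin> \<Omega> \<Longrightarrow> u x \<bullet> v x = 0"
  shows "ip lebesgue u v = ip (lebesgue_on \<Omega>) u v"
  unfolding ip_def by (rule integral_supported[symmetric]) (use assms in auto)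

lemma nrm_extend:
  assumes "\<Omega> \<in> sets lebesgue" "\<And>x. x \<notin> \<Omega> \<Longrightarrow> u x = 0"
  shows "nrm lebesgue u = nrm (lebesgue_on \<Omega>) u"
  unfolding nrm_def by (subst integral_supported) (use assms in auto)

lemma H0_extend:
  assumes \<Omega>: "open \<Omega>" and W: "W \<in> H0 \<Omega>" and out: "\<And>x. x \<notin> \<Omega> \<Longrightarrow> W x = 0"
  shows "W \<in> H0 UNIV"
  unfolding H0_def lebesgue_on_UNIV_eq
proof safe
  have \<Omega>m: "\<Omega> \<in> sets lebesgue" using \<Omega> by simp
  show "sq_int lebesgue W" by (rule sq_int_extend[OF \<Omega>m H0_sq_int[OF W] out])
  fix e :: real assume "0 < e"
  then obtain \<phi> where \<phi>: "\<phi> \<in> test_functions \<Omega>" "nrm (lebesgue_on \<Omega>) (\<lambda>x. W x - jet \<phi> x) < e"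
    using W by (auto simp: H0_def)
  have "jet \<phi> x = 0" if "x \<notin> \<Omega>" for x
    using that by (simp add: jet_def grad_def test_outside[OF \<phi>(1)] partial_outside[OF \<phi>(1)] zero_prod_def)
  then have "nrm lebesgue (\<lambda>x. W x - jet \<phi> x) = nrm (lebesgue_on \<Omega>) (\<lambda>x. W x - jet \<phi> x)"
    using out by (intro nrm_extend \<Omega>m) auto
  with \<phi> test_mono[OF subset_UNIV \<phi>(1)] show "\<exists>\<phi>\<in>test_functions UNIV. nrm lebesgue (\<lambda>x. W x - jet \<phi> x) < e"
    by (intro bexI[of _ \<phi>]) simp_all
qed

text \<open>
  For \<open>U = (u, \<nabla>u)\<close> this is the pair belonging to \<open>\<zeta> (u - c)\<close>.
\<close>

definition cut :: "('a::euclidean_space \<Rightarrow> real) \<Rightarrow> real \<Rightarrow> ('a \<Rightarrow> real \<times> 'a) \<Rightarrow> 'a \<Rightarrow> real \<times> 'a" where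
  "cut \<zeta> c U x = (\<zeta> x * (fst (U x) - c), \<zeta> x *\<^sub>R snd (U x) + (fst (U x) - c) *\<^sub>R grad \<zeta> x)"

lemma grad_outside: "\<phi> \<in> test_functions \<Omega> \<Longrightarrow> x \<notin> \<Omega> \<Longrightarrow> grad \<phi> x = 0"
  by (simp add: grad_def partial_outside)

lemma test_grad_bounded:
  assumes "\<phi> \<in> test_functions \<Omega>" obtains B where "0 < B" "\<And>x. norm (grad \<phi> x) \<le> B"
proof -
  have "\<exists>B. \<forall>x. \<bar>partial i \<phi> x\<bar> \<le> B" if "i \<in> Basis" for i
    using test_bounded[OF test_partial[OF assms that]] by metis
  then obtain B where B: "\<And>i x. i \<in> Basis \<Longrightarrow> \<bar>partial i \<phi> x\<bar> \<le> B i" by metis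
  have "norm (grad \<phi> x) \<le> (\<Sum>i\<in>Basis. B i)" for x
  proof -
    have "norm (grad \<phi> x) \<le> (\<Sum>i\<in>Basis. \<bar>partial i \<phi> x\<bar>)"
      using norm_le_l1[of "grad \<phi> x"] by simp
    also have "\<dots> \<le> (\<Sum>i\<in>Basis. B i)" by (intro sum_mono B)
    finally show ?thesis .
  qed
  then have "norm (grad \<phi> x) \<le> \<bar>\<Sum>i\<in>Basis. B i\<bar> + 1" for x by (smt (verit))
  then show thesis by (intro that[of "\<bar>\<Sum>i\<in>Basis. B i\<bar> + 1"]) auto
qed

lemma sq_int_test_mult:
  fixes u :: "'a::euclidean_space \<Rightarrow> 'b::euclidean_space"
  assumes "sq_int (lebesgue_on \<Omega>) u" "\<zeta> \<in> test_functions \<Omega>'"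
  shows "sq_int (lebesgue_on \<Omega>) (\<lambda>x. \<zeta> x *\<^sub>R u x)"
proof -
  obtain B where "\<And>x. \<bar>\<zeta> x\<bar> \<le> B" using test_bounded[OF assms(2)] by blast
  then show ?thesis
    by (intro sq_int_bounded_mult[OF assms(1) test_measurable[OF assms(2)]]) auto
qed

lemma grad_measurable:
  "\<phi> \<in> test_functions \<Omega>' \<Longrightarrow> grad \<phi> \<in> borel_measurable (lebesgue_on \<Omega>)"
  unfolding grad_def
  by (intro borel_measurable_sum borel_measurable_scaleR borel_measurable_const test_measurable[of _ \<Omega>'] test_partial)

lemma sq_int_mult_grad:
  fixes u :: "'a::euclidean_space \<Rightarrow> real"
  assumes u: "sq_int (lebesgue_on \<Omega>) u" and \<zeta>: "\<zeta> \<in> test_functions \<Omega>'"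
  shows "sq_int (lebesgue_on \<Omega>) (\<lambda>x. u x *\<^sub>R grad \<zeta> x)"
proof -
  obtain B where B: "0 < B" "\<And>x. norm (grad \<zeta> x) \<le> B" using test_grad_bounded[OF \<zeta>] by blast
  show ?thesis
  proof (rule sq_int_norm_le[where c=B, OF u])
    show "(\<lambda>x. u x *\<^sub>R grad \<zeta> x) \<in> borel_measurable (lebesgue_on \<Omega>)"
      using sq_int_measurable[OF u] grad_measurable[OF \<zeta>] by (rule borel_measurable_scaleR)
    show "AE x in lebesgue_on \<Omega>. norm (u x *\<^sub>R grad \<zeta> x) \<le> B * norm (u x)"
      unfolding norm_scaleR mult.commute[of B] by (intro AE_I2 mult_mono) (use B in auto)
  qed
qed

lemma jet_mult_shift:
  assumes "smooth \<zeta>" "smooth \<phi>"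
  shows "jet (\<lambda>x. \<zeta> x * (\<phi> x - c)) = cut \<zeta> c (jet \<phi>)"
proof
  fix x
  have "partial i (\<lambda>x. \<phi> x - c) = partial i \<phi>" for i
    using partial_diff[OF smooth_differentiable[OF assms(2)] smooth_differentiable[OF smooth_const], of i c]
    by (simp add: partial_const)
  then have "grad (\<lambda>x. \<phi> x - c) x = grad \<phi> x" by (simp add: grad_def)
  then have "grad (\<lambda>x. \<zeta> x * (\<phi> x - c)) x = \<zeta> x *\<^sub>R grad \<phi> x + (\<phi> x - c) *\<^sub>R grad \<zeta> x"
    using grad_mult[OF assms(1) smooth_diff[OF assms(2) smooth_const], of c x] by simp
  then show "jet (\<lambda>x. \<zeta> x * (\<phi> x - c)) x = cut \<zeta> c (jet \<phi>) x"
    by (simp add: jet_def cut_def)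
qed

lemma const_sq_int: "bounded \<Omega> \<Longrightarrow> open \<Omega> \<Longrightarrow> sq_int (lebesgue_on \<Omega>) (\<lambda>x. c::real)"
  using bounded_set_imp_lmeasurable[of \<Omega>] 
  by (simp add: sq_int_def integrable_restrict_space lmeasurable_iff_integrable)

lemma cut_in_H0:
  assumes \<Omega>: "open \<Omega>" "bounded \<Omega>" and U: "U \<in> H0 \<Omega>" and \<zeta>: "\<zeta> \<in> test_functions \<Omega>"
  shows "cut \<zeta> c U \<in> H0 \<Omega>"
proof -
  let ?M = "lebesgue_on \<Omega>"
  obtain \<phi> where \<phi>: "\<And>n. \<phi> n \<in> test_functions \<Omega>" "(\<lambda>n. nrm ?M (\<lambda>x. jet (\<phi> n) x - U x)) \<longlonglongrightarrow> 0"
    by (rule H0_sequence[OF U]) (rule that)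
  note s = H0_sq_int[OF U] sq_int_fst[OF H0_sq_int[OF U]] sq_int_snd[OF H0_sq_int[OF U]]
  have sq: "sq_int ?M (cut \<zeta> c V)" if V: "sq_int ?M V" for V
  proof -
    have 1: "sq_int ?M (\<lambda>x. fst (V x) - c)" using V const_sq_int[OF \<Omega>(2,1)] by auto
    have "sq_int ?M (\<lambda>x. \<zeta> x * (fst (V x) - c))" using sq_int_test_mult[OF 1 \<zeta>] by simp
    moreover have "sq_int ?M (\<lambda>x. \<zeta> x *\<^sub>R snd (V x) + (fst (V x) - c) *\<^sub>R grad \<zeta> x)"
      by (intro sq_int_add sq_int_test_mult[OF _ \<zeta>] sq_int_mult_grad[OF _ \<zeta>] sq_int_snd V 1)
    ultimately show ?thesis unfolding cut_def by (rule sq_int_Pair)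
  qed
  obtain B where B: "0 < B" "\<And>x. \<bar>\<zeta> x\<bar> \<le> B" using test_bounded[OF \<zeta>] by blast
  obtain B' where B': "0 < B'" "\<And>x. norm (grad \<zeta> x) \<le> B'" using test_grad_bounded[OF \<zeta>] by blast
  show ?thesis
  proof (rule H0_closed[OF \<Omega>(1) sq[OF s(1)]])
    show "cut \<zeta> c (jet (\<phi> n)) \<in> H0 \<Omega>" for n
      using jet_in_H0[OF test_mult[OF \<zeta> smooth_diff[OF test_smooth[OF \<phi>(1)] smooth_const]] \<Omega>(1), of n c]
        jet_mult_shift[OF test_smooth[OF \<zeta>] test_smooth[OF \<phi>(1)]] by simp
    have "nrm ?M (\<lambda>x. cut \<zeta> c (jet (\<phi> n)) x - cut \<zeta> c U x) \<le> (B + (B + B')) * nrm ?M (\<lambda>x. jet (\<phi> n) x - U x)" for n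
    proof (rule nrm_mono)
      have sj: "sq_int ?M (jet (\<phi> n))" using \<phi>(1) \<Omega> by auto
      then show "sq_int ?M (\<lambda>x. jet (\<phi> n) x - U x)" using s(1) by auto
      show "(\<lambda>x. cut \<zeta> c (jet (\<phi> n)) x - cut \<zeta> c U x) \<in> borel_measurable ?M"
        by (rule sq_int_measurable, rule sq_int_diff) (use sq sj s(1) in auto)
      have "norm (cut \<zeta> c (jet (\<phi> n)) x - cut \<zeta> c U x) \<le> (B + (B + B')) * norm (jet (\<phi> n) x - U x)" for x
      proof -
        let ?a = "fst (jet (\<phi> n) x - U x)" and ?b = "snd (jet (\<phi> n) x - U x)"
        have eq: "cut \<zeta> c (jet (\<phi> n)) x - cut \<zeta> c U x = (\<zeta> x * ?a, \<zeta> x *\<^sub>R ?b + ?a *\<^sub>R grad \<zeta> x)"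
          by (simp add: cut_def algebra_simps)
        have "norm (\<zeta> x * ?a) \<le> B * norm (jet (\<phi> n) x - U x)"
          unfolding norm_mult using B norm_fst_le'[of "jet (\<phi> n) x - U x"] by (intro mult_mono) auto
        moreover have "norm (\<zeta> x *\<^sub>R ?b) \<le> B * norm (jet (\<phi> n) x - U x)"
          unfolding norm_scaleR using B norm_snd_le'[of "jet (\<phi> n) x - U x"] by (intro mult_mono) auto
        moreover have "norm (?a *\<^sub>R grad \<zeta> x) \<le> norm (jet (\<phi> n) x - U x) * B'"
          unfolding norm_scaleR using B' norm_fst_le'[of "jet (\<phi> n) x - U x"] by (intro mult_mono) auto
        moreover have "norm (\<zeta> x * ?a, \<zeta> x *\<^sub>R ?b + ?a *\<^sub>R grad \<zeta> x)
            \<le> norm (\<zeta> x * ?a) + (norm (\<zeta> x *\<^sub>R ?b) + norm (?a *\<^sub>R grad \<zeta> x))"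
          using norm_Pair_le[of "\<zeta> x * ?a" "\<zeta> x *\<^sub>R ?b + ?a *\<^sub>R grad \<zeta> x"] norm_triangle_ineq[of "\<zeta> x *\<^sub>R ?b" "?a *\<^sub>R grad \<zeta> x"]
          by linarith
        ultimately show ?thesis unfolding eq by (simp add: algebra_simps)
      qed
      then show "AE x in ?M. norm (cut \<zeta> c (jet (\<phi> n)) x - cut \<zeta> c U x) \<le> (B + (B + B')) * norm (jet (\<phi> n) x - U x)"
        by auto
    qed (use B B' in auto)
    moreover have "(\<lambda>n. (B + (B + B')) * nrm ?M (\<lambda>x. jet (\<phi> n) x - U x)) \<longlonglongrightarrow> (B + (B + B')) * 0"
      by (intro tendsto_mult_left \<phi>(2))
    then have lim: "(\<lambda>n. (B + (B + B')) * nrm ?M (\<lambda>x. jet (\<phi> n) x - U x)) \<longlonglongrightarrow> 0" by simp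
    ultimately show "(\<lambda>n. nrm ?M (\<lambda>x. cut \<zeta> c (jet (\<phi> n)) x - cut \<zeta> c U x)) \<longlonglongrightarrow> 0"
      by (intro tendsto_sandwich[OF _ _ tendsto_const lim]) auto
  qed
qed

definition laplacian :: "('a::euclidean_space \<Rightarrow> real) \<Rightarrow> 'a \<Rightarrow> real" where
  "laplacian \<phi> x = (\<Sum>i\<in>Basis. partial i (partial i \<phi>) x)"

lemma test_sum: "(\<And>i. i \<in> I \<Longrightarrow> \<phi> i \<in> test_functions \<Omega>) \<Longrightarrow> (\<lambda>x. \<Sum>i\<in>I. \<phi> i x) \<in> test_functions \<Omega>"
  by (induction I rule: infinite_finite_induct) auto

lemma laplacian_test: "\<phi> \<in> test_functions \<Omega> \<Longrightarrow> laplacian \<phi> \<in> test_functions \<Omega>"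
  unfolding laplacian_def[abs_def] by (intro test_sum test_partial)

lemma ip_grad_H0:
  assumes \<Omega>: "open \<Omega>" and V: "V \<in> H0 \<Omega>" and \<phi>: "\<phi> \<in> test_functions \<Omega>"
  shows "ip (lebesgue_on \<Omega>) (\<lambda>x. snd (V x)) (grad \<phi>) = - ip (lebesgue_on \<Omega>) (\<lambda>x. fst (V x)) (laplacian \<phi>)"
proof -
  let ?M = "lebesgue_on \<Omega>"
  note s = sq_int_fst[OF H0_sq_int[OF V]] sq_int_snd[OF H0_sq_int[OF V]]
  have p: "partial i \<phi> \<in> test_functions \<Omega>" if "i \<in> Basis" for i by (rule test_partial[OF \<phi> that])
  have sp: "sq_int ?M (partial i \<phi>)" "sq_int ?M (partial i (partial i \<phi>))" if "i \<in> Basis" for i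
    using p[OF that] test_partial[OF p[OF that] that] \<Omega> by auto
  have "ip ?M (\<lambda>x. snd (V x)) (grad \<phi>) = (\<Sum>i\<in>Basis. ip ?M (\<lambda>x. snd (V x) \<bullet> i) (partial i \<phi>))"
    by (rule ip_grad[OF s(2) sp(1)])
  also have "\<dots> = (\<Sum>i\<in>Basis. - ip ?M (partial i (partial i \<phi>)) (\<lambda>x. fst (V x)))"
  proof (rule sum.cong[OF refl])
    fix i :: 'a assume i: "i \<in> Basis"
    show "ip ?M (\<lambda>x. snd (V x) \<bullet> i) (partial i \<phi>) = - ip ?M (partial i (partial i \<phi>)) (\<lambda>x. fst (V x))"
      using H0_weak_gradient[OF \<Omega> V] p[OF i] i by (simp add: has_weak_gradient_def ip_def mult.commute)
  qed
  also have "\<dots> = - ip ?M (laplacian \<phi>) (\<lambda>x. fst (V x))"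
    unfolding laplacian_def[abs_def] by (subst ip_sum_left) (use sp s in \<open>auto simp: sum_negf\<close>)
  finally show ?thesis by (simp add: ip_commute)
qed

text \<open>
  The function \<open>w = \<zeta> (u - c)\<close>, extended by zero, satisfies
  \<open>-\<Delta>w = k = \<zeta> g - 2 \<nabla>u \<cdot> \<nabla>\<zeta> - (u - c) \<Delta>\<zeta>\<close> in the whole space. On the zero set of \<open>w\<close> both \<open>\<nabla>w\<close> and
  \<open>k\<close> vanish; where \<open>u = c\<close> and \<open>\<zeta> \<noteq> 0\<close> this leaves first \<open>\<nabla>u = 0\<close> and then \<open>g = 0\<close>.
\<close>

lemma source_zero_on_level_set:
  assumes \<Omega>: "open \<Omega>" "bounded \<Omega>" and U: "U \<in> H0 \<Omega>" and g: "sq_int (lebesgue_on \<Omega>) g"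
    and eq: "\<And>\<phi>. \<phi> \<in> test_functions \<Omega> \<Longrightarrow> ip (lebesgue_on \<Omega>) (\<lambda>x. snd (U x)) (grad \<phi>) = ip (lebesgue_on \<Omega>) g \<phi>"
  shows "AE x in lebesgue_on \<Omega>. fst (U x) = c \<longrightarrow> g x = 0"
proof -
  let ?M = "lebesgue_on \<Omega>"
  define u G where "u x = fst (U x)" and "G x = snd (U x)" for x
  have su: "sq_int ?M u" and sG: "sq_int ?M G"
    using H0_sq_int[OF U] unfolding u_def G_def by auto
  have \<Omega>m: "\<Omega> \<in> sets lebesgue" using \<Omega> by simp
  have sc: "sq_int ?M (\<lambda>x. u x - c)" using su const_sq_int[OF \<Omega>(2,1)] by auto
  have local: "AE x in ?M. u x = c \<longrightarrow> \<zeta> x \<noteq> 0 \<longrightarrow> g x = 0" if \<zeta>: "\<zeta> \<in> test_functions \<Omega>" for \<zeta>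
  proof -
    define k where "k x = \<zeta> x * g x - 2 * (G x \<bullet> grad \<zeta> x) - (u x - c) * laplacian \<zeta> x" for x
    have l: "laplacian \<zeta> \<in> test_functions \<Omega>" by (rule laplacian_test[OF \<zeta>])
    have sGz: "sq_int ?M (\<lambda>x. G x \<bullet> grad \<zeta> x)"
    proof -
      have "G x \<bullet> grad \<zeta> x = (\<Sum>i\<in>Basis. partial i \<zeta> x * (G x \<bullet> i))" for x
        by (simp add: grad_def inner_sum_right)
      moreover have "sq_int ?M (\<lambda>x. \<Sum>i\<in>Basis. partial i \<zeta> x * (G x \<bullet> i))"
        using sq_int_test_mult[OF sq_int_inner_const[OF sG] test_partial[OF \<zeta>]] by (intro sq_int_sum) auto
      ultimately show ?thesis by simp
    qed
    have skM: "sq_int ?M (\<lambda>x. \<zeta> x * g x)" "sq_int ?M (\<lambda>x. laplacian \<zeta> x * (u x - c))"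
      using sq_int_test_mult[OF g \<zeta>] sq_int_test_mult[OF sc l] by simp_all
    have sk: "sq_int ?M k"
      unfolding k_def mult.commute[of "u _ - c"] by (intro sq_int_diff sq_int_cmult skM sGz)
    have k_out: "k x = 0" if "x \<notin> \<Omega>" for x
      using that by (simp add: k_def test_outside[OF \<zeta>] grad_outside[OF \<zeta>] test_outside[OF l])
    let ?W = "cut \<zeta> c U"
    have W_out: "?W x = 0" if "x \<notin> \<Omega>" for x
      using that by (simp add: cut_def test_outside[OF \<zeta>] grad_outside[OF \<zeta>] zero_prod_def)
    have W: "?W \<in> H0 UNIV"
      by (rule H0_extend[OF \<Omega>(1) cut_in_H0[OF \<Omega> U \<zeta>] W_out])
    have weq: "ip lebesgue (\<lambda>x. snd (?W x)) (grad \<psi>) = ip lebesgue k \<psi>" if \<psi>: "\<psi> \<in> test_functions UNIV" for \<psi>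
    proof -
      have \<zeta>\<psi>: "(\<lambda>x. \<zeta> x * \<psi> x) \<in> test_functions \<Omega>" by (rule test_mult[OF \<zeta> test_smooth[OF \<psi>]])
      have s\<psi>: "sq_int ?M \<psi>" "sq_int ?M (grad \<psi>)" "\<And>i. i \<in> Basis \<Longrightarrow> sq_int ?M (partial i \<psi>)"
        using \<psi> \<Omega> test_partial[OF \<psi>] by auto
      have s1: "sq_int ?M (\<lambda>x. \<zeta> x *\<^sub>R G x)" "sq_int ?M (\<lambda>x. (u x - c) *\<^sub>R grad \<zeta> x)" 
          "sq_int ?M (\<lambda>x. \<zeta> x *\<^sub>R grad \<psi> x)" "sq_int ?M (\<lambda>x. \<psi> x *\<^sub>R grad \<zeta> x)"
        using sq_int_test_mult[OF sG \<zeta>] sq_int_mult_grad[OF sc \<zeta>] sq_int_test_mult[OF s\<psi>(2) \<zeta>] sq_int_mult_grad[OF s\<psi>(1) \<zeta>]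
        by auto
      \<comment> \<open>\<open>\<zeta> \<psi>\<close> is a test function on \<open>\<Omega>\<close>, so the equation for \<open>u\<close> applies to it.\<close>
      have "ip ?M G (grad (\<lambda>x. \<zeta> x * \<psi> x)) = ip ?M g (\<lambda>x. \<zeta> x * \<psi> x)"
        using eq[OF \<zeta>\<psi>] by (simp add: G_def[abs_def])
      moreover have "ip ?M G (grad (\<lambda>x. \<zeta> x * \<psi> x)) = ip ?M (\<lambda>x. \<zeta> x *\<^sub>R G x) (grad \<psi>) + ip ?M (\<lambda>x. G x \<bullet> grad \<zeta> x) \<psi>"
      proof -
        have "grad (\<lambda>x. \<zeta> x * \<psi> x) = (\<lambda>x. \<zeta> x *\<^sub>R grad \<psi> x + \<psi> x *\<^sub>R grad \<zeta> x)"
          using grad_mult[OF test_smooth[OF \<zeta>] test_smooth[OF \<psi>]] by auto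
        then have "ip ?M G (grad (\<lambda>x. \<zeta> x * \<psi> x)) = ip ?M G (\<lambda>x. \<zeta> x *\<^sub>R grad \<psi> x) + ip ?M G (\<lambda>x. \<psi> x *\<^sub>R grad \<zeta> x)"
          using ip_add_right[OF s1(3,4) sG] by simp
        then show ?thesis by (simp add: ip_def mult.commute)
      qed
      moreover have "ip ?M g (\<lambda>x. \<zeta> x * \<psi> x) = ip ?M (\<lambda>x. \<zeta> x * g x) \<psi>"
        by (simp add: ip_def mult_ac)
      ultimately have part1: "ip ?M (\<lambda>x. \<zeta> x *\<^sub>R G x) (grad \<psi>) = ip ?M (\<lambda>x. \<zeta> x * g x) \<psi> - ip ?M (\<lambda>x. G x \<bullet> grad \<zeta> x) \<psi>"
        by simp
      \<comment> \<open>Here the derivative is moved from \<open>\<psi>\<close> onto \<open>(u - c) \<partial>\<^sub>i\<zeta>\<close>, using the weak gradient of \<open>u\<close>.\<close>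
      have comp: "ip ?M (\<lambda>x. partial i \<zeta> x * (u x - c)) (partial i \<psi>)
          = - ip ?M (\<lambda>x. partial i \<zeta> x * (G x \<bullet> i)) \<psi> - ip ?M (\<lambda>x. partial i (partial i \<zeta>) x * (u x - c)) \<psi>"
        if i: "i \<in> Basis" for i
      proof -
        have z: "partial i \<zeta> \<in> test_functions \<Omega>" by (rule test_partial[OF \<zeta> i])
        have zz: "partial i (partial i \<zeta>) \<in> test_functions \<Omega>" by (rule test_partial[OF z i])
        let ?\<theta> = "\<lambda>x. partial i \<zeta> x * \<psi> x"
        have \<theta>: "?\<theta> \<in> test_functions \<Omega>" by (rule test_mult[OF z test_smooth[OF \<psi>]])
        have p\<theta>: "partial i ?\<theta> = (\<lambda>x. partial i \<zeta> x * partial i \<psi> x + partial i (partial i \<zeta>) x * \<psi> x)"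
          by (rule partial_mult[OF smooth_differentiable[OF test_smooth[OF z]] smooth_differentiable[OF test_smooth[OF \<psi>]]])
        have s\<theta>: "sq_int ?M (partial i ?\<theta>)" using test_partial[OF \<theta> i] \<Omega> by auto
        have "ip ?M u (partial i ?\<theta>) = - ip ?M (\<lambda>x. G x \<bullet> i) ?\<theta>"
          using H0_weak_gradient[OF \<Omega>(1) U] \<theta> i by (simp add: has_weak_gradient_def ip_def u_def G_def)
        moreover have "ip ?M (\<lambda>x. c) (partial i ?\<theta>) = 0"
          using integral_partial[OF \<theta> i \<Omega>(1)] by (simp add: ip_def)
        ultimately have "ip ?M (\<lambda>x. u x - c) (partial i ?\<theta>) = - ip ?M (\<lambda>x. G x \<bullet> i) ?\<theta>"
          using ip_diff_left[OF su const_sq_int[OF \<Omega>(2,1)] s\<theta>, of c] by simp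
        moreover have "ip ?M (\<lambda>x. u x - c) (partial i ?\<theta>)
           = ip ?M (\<lambda>x. u x - c) (\<lambda>x. partial i \<zeta> x * partial i \<psi> x) + ip ?M (\<lambda>x. u x - c) (\<lambda>x. partial i (partial i \<zeta>) x * \<psi> x)"
          unfolding p\<theta> using sq_int_test_mult[OF s\<psi>(3)[OF i] z] sq_int_test_mult[OF s\<psi>(1) zz] sc
          by (intro ip_add_right) auto
        ultimately show ?thesis by (simp add: ip_def mult_ac)
      qed
      have "ip ?M (\<lambda>x. (u x - c) *\<^sub>R grad \<zeta> x) (grad \<psi>) = (\<Sum>i\<in>Basis. ip ?M (\<lambda>x. partial i \<zeta> x * (u x - c)) (partial i \<psi>))"
        by (subst ip_grad[OF s1(2) s\<psi>(3)]) (auto simp: mult.commute intro!: sum.cong)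
      also have "\<dots> = (\<Sum>i\<in>Basis. - ip ?M (\<lambda>x. partial i \<zeta> x * (G x \<bullet> i)) \<psi> - ip ?M (\<lambda>x. partial i (partial i \<zeta>) x * (u x - c)) \<psi>)"
        by (intro sum.cong refl comp)
      also have "\<dots> = - (\<Sum>i\<in>Basis. ip ?M (\<lambda>x. partial i \<zeta> x * (G x \<bullet> i)) \<psi>) - (\<Sum>i\<in>Basis. ip ?M (\<lambda>x. partial i (partial i \<zeta>) x * (u x - c)) \<psi>)"
        by (simp add: sum_subtractf sum_negf)
      also have "(\<Sum>i\<in>Basis. ip ?M (\<lambda>x. partial i \<zeta> x * (G x \<bullet> i)) \<psi>) = ip ?M (\<lambda>x. G x \<bullet> grad \<zeta> x) \<psi>"
      proof -
        have "ip ?M (\<lambda>x. \<Sum>i\<in>Basis. partial i \<zeta> x * (G x \<bullet> i)) \<psi> = (\<Sum>i\<in>Basis. ip ?M (\<lambda>x. partial i \<zeta> x * (G x \<bullet> i)) \<psi>)"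
          using sq_int_test_mult[OF sq_int_inner_const[OF sG] test_partial[OF \<zeta>]] s\<psi>(1) by (intro ip_sum_left) auto
        then show ?thesis by (simp add: grad_def inner_sum_right)
      qed
      also have "(\<Sum>i\<in>Basis. ip ?M (\<lambda>x. partial i (partial i \<zeta>) x * (u x - c)) \<psi>) = ip ?M (\<lambda>x. laplacian \<zeta> x * (u x - c)) \<psi>"
      proof -
        have "ip ?M (\<lambda>x. \<Sum>i\<in>Basis. partial i (partial i \<zeta>) x * (u x - c)) \<psi> = (\<Sum>i\<in>Basis. ip ?M (\<lambda>x. partial i (partial i \<zeta>) x * (u x - c)) \<psi>)"
          using sq_int_test_mult[OF sc test_partial[OF test_partial[OF \<zeta>]]] s\<psi>(1) by (intro ip_sum_left) auto
        then show ?thesis by (simp add: laplacian_def sum_distrib_right)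
      qed
      finally have part2: "ip ?M (\<lambda>x. (u x - c) *\<^sub>R grad \<zeta> x) (grad \<psi>) = - ip ?M (\<lambda>x. G x \<bullet> grad \<zeta> x) \<psi> - ip ?M (\<lambda>x. laplacian \<zeta> x * (u x - c)) \<psi>" .
      have "ip lebesgue (\<lambda>x. snd (?W x)) (grad \<psi>) = ip ?M (\<lambda>x. snd (?W x)) (grad \<psi>)"
        using W_out by (intro ip_extend \<Omega>m) auto
      also have "\<dots> = ip ?M (\<lambda>x. \<zeta> x *\<^sub>R G x) (grad \<psi>) + ip ?M (\<lambda>x. (u x - c) *\<^sub>R grad \<zeta> x) (grad \<psi>)"
        using ip_add_left[OF s1(1,2) s\<psi>(2)] by (simp add: cut_def u_def G_def)
      also have "\<dots> = ip ?M (\<lambda>x. \<zeta> x * g x) \<psi> - 2 * ip ?M (\<lambda>x. G x \<bullet> grad \<zeta> x) \<psi> - ip ?M (\<lambda>x. laplacian \<zeta> x * (u x - c)) \<psi>"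
        unfolding part1 part2 by simp
      also have "\<dots> = ip ?M k \<psi>"
      proof -
        have "ip ?M (\<lambda>x. (\<zeta> x * g x - 2 * (G x \<bullet> grad \<zeta> x)) - laplacian \<zeta> x * (u x - c)) \<psi>
          = ip ?M (\<lambda>x. \<zeta> x * g x) \<psi> - ip ?M (\<lambda>x. 2 * (G x \<bullet> grad \<zeta> x)) \<psi> - ip ?M (\<lambda>x. laplacian \<zeta> x * (u x - c)) \<psi>"
          using skM sGz s\<psi>(1) by (simp only: ip_diff_left sq_int_diff sq_int_cmult)
        moreover have "k = (\<lambda>x. (\<zeta> x * g x - 2 * (G x \<bullet> grad \<zeta> x)) - laplacian \<zeta> x * (u x - c))"
          by (simp add: k_def fun_eq_iff mult.commute)
        ultimately show ?thesis by (simp only: ip_cmult_left)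
      qed
      also have "\<dots> = ip lebesgue k \<psi>"
        using k_out by (intro ip_extend[symmetric] \<Omega>m) auto
      finally show ?thesis .
    qed
    have "AE x in lebesgue. fst (?W x) = 0 \<longrightarrow> k x = 0"
      by (rule source_zero_on_zero_set[OF W sq_int_extend[OF \<Omega>m sk k_out] weq])
    moreover have "AE x in lebesgue. \<forall>i\<in>Basis. fst (?W x) = 0 \<longrightarrow> snd (?W x) \<bullet> i = 0"
      using gradient_zero_on_zero_set[OF W] by (intro AE_finite_allI) auto
    ultimately have "AE x in lebesgue. u x = c \<longrightarrow> \<zeta> x \<noteq> 0 \<longrightarrow> g x = 0"
    proof eventually_elim
      case (elim x)
      show ?case
      proof (intro impI)
        assume x: "u x = c" "\<zeta> x \<noteq> 0"
        then have "fst (?W x) = 0" by (simp add: cut_def u_def)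
        with elim have "k x = 0" "\<forall>i\<in>Basis. snd (?W x) \<bullet> i = 0" by auto
        then have "snd (?W x) = 0" using euclidean_all_zero_iff by blast
        then have "\<zeta> x *\<^sub>R G x = 0" using x(1) by (simp add: cut_def u_def G_def)
        with x(2) have "G x = 0" by simp
        with \<open>k x = 0\<close> x show "g x = 0" by (simp add: k_def)
      qed
    qed
    then show ?thesis using \<Omega>m by (auto simp: AE_restrict_space_iff elim: eventually_mono)
  qed
  obtain \<zeta> :: "nat \<Rightarrow> 'a \<Rightarrow> real" where \<zeta>: "\<And>n. \<zeta> n \<in> test_functions \<Omega>"
    "\<And>n x. 0 \<le> \<zeta> n x" "\<And>n x. \<zeta> n x \<le> 1" "\<And>x. (\<lambda>n. \<zeta> n x) \<longlonglongrightarrow> indicator \<Omega> x"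
    by (rule open_set_bumps[OF \<Omega>(1)]) (rule that)
  have "AE x in ?M. \<forall>n. u x = c \<longrightarrow> \<zeta> n x \<noteq> 0 \<longrightarrow> g x = 0"
    unfolding AE_all_countable using local[OF \<zeta>(1)] by blast
  then show ?thesis using AE_space
  proof eventually_elim
    case (elim x)
    then have "x \<in> \<Omega>" by simp
    then have "\<forall>\<^sub>F n in sequentially. 0 < \<zeta> n x"
      using \<zeta>(4)[of x] by (intro order_tendstoD(1)[of _ 1]) auto
    then obtain n where "0 < \<zeta> n x" by (auto simp: eventually_sequentially)
    with elim(1)[rule_format, of n] show ?case by (auto simp: u_def)
  qed
qed

section \<open>The minimizer\<close>

text \<open>
  The excess of \<open>\<bar>v\<bar>\<close> over \<open>b\<close> is at most \<open>\<bar>u n - v\<bar> + \<bar>m n - b\<bar>\<close>, whose norm tends to zero.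
\<close>

lemma AE_le_of_L2_limit:
  fixes u :: "nat \<Rightarrow> 'a \<Rightarrow> real"
  assumes u: "\<And>n. sq_int M (u n)" "sq_int M v" "(\<lambda>n. nrm M (\<lambda>x. u n x - v x)) \<longlonglongrightarrow> 0"
    and m: "m \<longlonglongrightarrow> b" and one: "sq_int M (\<lambda>x. 1::real)"
    and le: "\<And>n. AE x in M. \<bar>u n x\<bar> \<le> m n"
  shows "AE x in M. \<bar>v x\<bar> \<le> b"
proof -
  define p where "p x = max 0 (\<bar>v x\<bar> - b)" for x
  have [measurable]: "v \<in> borel_measurable M" "u n \<in> borel_measurable M" for n
    using u by (auto intro: sq_int_measurable)
  have pm: "p \<in> borel_measurable M" unfolding p_def by measurable
  have bound: "AE x in M. norm (p x) \<le> norm (\<bar>u n x - v x\<bar> + \<bar>m n - b\<bar> * 1)" for n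
    using le[of n] by eventually_elim (auto simp: p_def)
  have s: "sq_int M (\<lambda>x. \<bar>u n x - v x\<bar>)" for n
    by (rule sq_int_norm_le[where c=1 and v="\<lambda>x. u n x - v x"]) (use u in auto)
  have s2: "sq_int M (\<lambda>x. \<bar>u n x - v x\<bar> + \<bar>m n - b\<bar> * 1)" for n
    by (intro sq_int_add sq_int_cmult s one)
  have sp: "sq_int M p"
    by (rule sq_int_norm_le[where c=1, OF s2[of 0] pm]) (use bound[of 0] in simp)
  have le: "nrm M p \<le> nrm M (\<lambda>x. u n x - v x) + \<bar>m n - b\<bar> * nrm M (\<lambda>x. 1::real)" for n
  proof -
    have "nrm M p \<le> 1 * nrm M (\<lambda>x. \<bar>u n x - v x\<bar> + \<bar>m n - b\<bar> * 1)"
      by (rule nrm_mono[OF s2 pm]) (use bound in auto)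
    also have "\<dots> \<le> nrm M (\<lambda>x. \<bar>u n x - v x\<bar>) + nrm M (\<lambda>x. \<bar>m n - b\<bar> * 1)"
      using nrm_triangle[OF s sq_int_cmult[OF one]] by simp
    also have "\<dots> = nrm M (\<lambda>x. u n x - v x) + \<bar>m n - b\<bar> * nrm M (\<lambda>x. 1::real)"
      unfolding nrm_cmult by (simp add: nrm_def)
    finally show ?thesis .
  qed
  have "(\<lambda>n. nrm M (\<lambda>x. u n x - v x) + \<bar>m n - b\<bar> * nrm M (\<lambda>x. 1::real)) \<longlonglongrightarrow> 0 + \<bar>b - b\<bar> * nrm M (\<lambda>x. 1::real)"
    by (intro tendsto_intros u m)
  then have "nrm M p \<le> 0 + \<bar>b - b\<bar> * nrm M (\<lambda>x. 1::real)"
    by (rule LIMSEQ_le_const) (use le in auto)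
  then have "nrm M p = 0" using nrm_nonneg[of M p] by simp
  then have "AE x in M. p x = 0" by (rule nrm_eq_0_AE[OF sp])
  then show ?thesis by eventually_elim (auto simp: p_def max_def split: if_splits)
qed

lemma small_linear_nonneg:
  fixes a b :: real
  assumes "\<And>t. 0 < t \<Longrightarrow> t \<le> 1 \<Longrightarrow> 0 \<le> t * a + t\<^sup>2 * b"
  shows "0 \<le> a"
proof -
  have "0 \<le> a + (1 / real (Suc n)) * b" for n
  proof -
    have pos: "0 < 1 / real (Suc n)" by simp
    have "0 \<le> (1 / real (Suc n)) * (a + (1 / real (Suc n)) * b)"
      using assms[OF pos] by (simp add: power2_eq_square distrib_left)
    then show ?thesis using pos by (simp only: zero_le_mult_iff) linarith
  qed
  moreover have "(\<lambda>n. a + (1 / real (Suc n)) * b) \<longlonglongrightarrow> a + 0 * b"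
    by (intro tendsto_intros LIMSEQ_Suc[OF lim_1_over_n])
  ultimately show ?thesis by (intro LIMSEQ_le_const[of _ a]) auto
qed

locale source_problem =
  fixes \<Omega> :: "'a::euclidean_space set" and f :: "'a \<Rightarrow> real"
  assumes \<Omega>: "open \<Omega>" "bounded \<Omega>" and f: "sq_int (lebesgue_on \<Omega>) f"
begin

abbreviation \<mu> :: "'a measure" where "\<mu> \<equiv> lebesgue_on \<Omega>"

text \<open>
  The functional \<^const>\<open>J1\<close> is treated as \<open>bounded_J1 U m\<close>, in which a real bound \<open>m\<close> for \<open>\<bar>u\<bar>\<close> replaces the
  supremum norm. It is a quadratic polynomial in the pair \<open>(U, m)\<close>, and minimizing over \<open>m\<close> as well
  restores the norm.
\<close>

definition feasible :: "('a \<Rightarrow> real \<times> 'a) \<Rightarrow> real \<Rightarrow> bool" where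
  "feasible U m \<longleftrightarrow> U \<in> H0 \<Omega> \<and> 0 \<le> m \<and> (AE x in \<mu>. \<bar>fst (U x)\<bar> \<le> m)"

definition bounded_J1 :: "('a \<Rightarrow> real \<times> 'a) \<Rightarrow> real \<Rightarrow> real" where
  "bounded_J1 U m = ip \<mu> (\<lambda>x. snd (U x)) (\<lambda>x. snd (U x)) / 2 + m\<^sup>2 / 2 - ip \<mu> f (\<lambda>x. fst (U x))"

lemma H0_comp:
  assumes "U \<in> H0 \<Omega>"
  shows "sq_int \<mu> (\<lambda>x. fst (U x))" "sq_int \<mu> (\<lambda>x. snd (U x))"
  using H0_sq_int[OF assms] by auto

lemma feasible_affine:
  assumes U: "feasible U m" and V: "feasible V n" and t: "0 \<le> t" "t \<le> 1"
  shows "feasible (\<lambda>x. (1 - t) *\<^sub>R U x + t *\<^sub>R V x) ((1 - t) * m + t * n)"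
  unfolding feasible_def
proof (intro conjI)
  show "(\<lambda>x. (1 - t) *\<^sub>R U x + t *\<^sub>R V x) \<in> H0 \<Omega>"
    using U V by (intro H0_comb \<Omega>) (auto simp: feasible_def)
  show "0 \<le> (1 - t) * m + t * n" using U V t by (auto simp: feasible_def)
  have "AE x in \<mu>. \<bar>fst (U x)\<bar> \<le> m" "AE x in \<mu>. \<bar>fst (V x)\<bar> \<le> n" using U V by (auto simp: feasible_def)
  then show "AE x in \<mu>. \<bar>fst ((1 - t) *\<^sub>R U x + t *\<^sub>R V x)\<bar> \<le> (1 - t) * m + t * n"
  proof eventually_elim
    case (elim x)
    have "\<bar>fst ((1 - t) *\<^sub>R U x + t *\<^sub>R V x)\<bar> \<le> \<bar>(1 - t) * fst (U x)\<bar> + \<bar>t * fst (V x)\<bar>" by simp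
    also have "\<dots> \<le> (1 - t) * m + t * n"
      using elim t by (auto simp: abs_mult intro!: add_mono mult_left_mono)
    finally show ?case .
  qed
qed

lemma bounded_J1_affine:
  assumes U: "U \<in> H0 \<Omega>" and V: "V \<in> H0 \<Omega>"
  shows "bounded_J1 (\<lambda>x. (1 - t) *\<^sub>R U x + t *\<^sub>R V x) k = bounded_J1 U m
    + t * (ip \<mu> (\<lambda>x. snd (U x)) (\<lambda>x. snd (V x) - snd (U x)) - ip \<mu> f (\<lambda>x. fst (V x) - fst (U x)))
    + t\<^sup>2 / 2 * ip \<mu> (\<lambda>x. snd (V x) - snd (U x)) (\<lambda>x. snd (V x) - snd (U x)) + (k\<^sup>2 - m\<^sup>2) / 2"
proof -
  note s = H0_comp[OF U] H0_comp[OF V]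
  have d: "sq_int \<mu> (\<lambda>x. snd (V x) - snd (U x))" "sq_int \<mu> (\<lambda>x. fst (V x) - fst (U x))" using s by auto
  have eq: "(\<lambda>x. snd ((1 - t) *\<^sub>R U x + t *\<^sub>R V x)) = (\<lambda>x. snd (U x) + t *\<^sub>R (snd (V x) - snd (U x)))"
    "(\<lambda>x. fst ((1 - t) *\<^sub>R U x + t *\<^sub>R V x)) = (\<lambda>x. fst (U x) + t * (fst (V x) - fst (U x)))"
    by (auto simp: algebra_simps)
  have "ip \<mu> f (\<lambda>x. fst (U x) + t * (fst (V x) - fst (U x))) = ip \<mu> f (\<lambda>x. fst (U x)) + t * ip \<mu> f (\<lambda>x. fst (V x) - fst (U x))"
    using ip_add_right[OF s(1) sq_int_cmult[OF d(2)] f] by simp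
  then show ?thesis
    unfolding bounded_J1_def eq ip_add_self[OF s(2) d(1)] by (simp add: field_simps)
qed

text \<open>
  The parallelogram identity; it provides the convexity defect for the direct method and, applied to
  two minimizers, uniqueness.
\<close>

lemma bounded_J1_midpoint:
  assumes U: "U \<in> H0 \<Omega>" and V: "V \<in> H0 \<Omega>"
  shows "bounded_J1 (\<lambda>x. (1 - 1/2) *\<^sub>R U x + (1/2) *\<^sub>R V x) ((1 - 1/2) * m + (1/2) * n)
    + ((nrm \<mu> (\<lambda>x. snd (U x) - snd (V x)))\<^sup>2 + (m - n)\<^sup>2) / 8 = (bounded_J1 U m + bounded_J1 V n) / 2"
proof -
  note s = H0_comp[OF U] H0_comp[OF V]
  have "bounded_J1 V n = bounded_J1 (\<lambda>x. (1 - 1) *\<^sub>R U x + 1 *\<^sub>R V x) n" by simp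
  also have "\<dots> = bounded_J1 U m
    + 1 * (ip \<mu> (\<lambda>x. snd (U x)) (\<lambda>x. snd (V x) - snd (U x)) - ip \<mu> f (\<lambda>x. fst (V x) - fst (U x)))
    + 1\<^sup>2 / 2 * ip \<mu> (\<lambda>x. snd (V x) - snd (U x)) (\<lambda>x. snd (V x) - snd (U x)) + (n\<^sup>2 - m\<^sup>2) / 2"
    by (rule bounded_J1_affine[OF U V])
  finally show ?thesis
    unfolding bounded_J1_affine[OF U V, of "1/2" _ m] nrm_diff_commute[of _ "\<lambda>x. snd (U x)"] nrm_sq
    by (simp add: power2_eq_square field_simps)
qed

lemma sq_int_one: "sq_int \<mu> (\<lambda>x. 1::real)"
  by (rule const_sq_int[OF \<Omega>(2,1)])

lemma jet_zero_H0: "(\<lambda>x. 0) \<in> H0 \<Omega>"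
proof -
  have "jet (\<lambda>x. 0) = (\<lambda>x::'a. 0)" by (auto simp: jet_def grad_def partial_const zero_prod_def)
  then show ?thesis using jet_in_H0[OF test_zero \<Omega>(1)] by simp
qed

text \<open>
  The defect controls the gradients and the bounds; the Poincare inequality supplies the control of the
  functions themselves and the bound from below.
\<close>

lemma exists_minimizer:
  obtains U m where "feasible U m" "\<And>V n. feasible V n \<Longrightarrow> bounded_J1 U m \<le> bounded_J1 V n"
proof -
  obtain C where C: "0 < C" "\<And>U. U \<in> H0 \<Omega> \<Longrightarrow> nrm \<mu> (\<lambda>x. fst (U x)) \<le> C * nrm \<mu> (\<lambda>x. snd (U x))"
    by (rule Poincare[OF \<Omega>]) (rule that)
  define S where "S = {(U, m). feasible U m}"
  define d where "d i j = ((nrm \<mu> (\<lambda>x. snd (fst i x) - snd (fst j x)))\<^sup>2 + (snd i - snd j)\<^sup>2) / 8"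
    for i j :: "('a \<Rightarrow> real \<times> 'a) \<times> real"
  have ne: "S \<noteq> {}"
    using jet_zero_H0 by (auto simp: S_def feasible_def intro!: exI[of _ "\<lambda>x. 0"] exI[of _ 0])
  have low: "- ((nrm \<mu> f * C)\<^sup>2 / 2) \<le> bounded_J1 (fst i) (snd i)" if "i \<in> S" for i
  proof -
    have U: "fst i \<in> H0 \<Omega>" using that by (auto simp: S_def feasible_def)
    let ?G = "nrm \<mu> (\<lambda>x. snd (fst i x))"
    have "ip \<mu> f (\<lambda>x. fst (fst i x)) \<le> nrm \<mu> f * nrm \<mu> (\<lambda>x. fst (fst i x))"
      using ip_Cauchy_Schwarz[OF f H0_comp(1)[OF U]] by linarith
    also have "\<dots> \<le> nrm \<mu> f * (C * ?G)" by (intro mult_left_mono C U) simp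
    finally have "?G\<^sup>2 / 2 - nrm \<mu> f * (C * ?G) \<le> bounded_J1 (fst i) (snd i)"
      using zero_le_power2[of "snd i"] unfolding bounded_J1_def nrm_sq by linarith
    moreover have "0 \<le> (?G - nrm \<mu> f * C)\<^sup>2" by simp
    ultimately show ?thesis by (simp add: power2_diff algebra_simps)
  qed
  have mid: "\<exists>k\<in>S. bounded_J1 (fst k) (snd k) + d i j \<le> (bounded_J1 (fst i) (snd i) + bounded_J1 (fst j) (snd j)) / 2"
    if "i \<in> S" "j \<in> S" for i j
  proof
    let ?k = "((\<lambda>x. (1 - 1/2) *\<^sub>R fst i x + (1/2) *\<^sub>R fst j x), (1 - 1/2) * snd i + (1/2) * snd j)"
    show "?k \<in> S"
      using that feasible_affine[of "fst i" "snd i" "fst j" "snd j" "1/2"] by (auto simp: S_def)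
    show "bounded_J1 (fst ?k) (snd ?k) + d i j \<le> (bounded_J1 (fst i) (snd i) + bounded_J1 (fst j) (snd j)) / 2"
      using bounded_J1_midpoint[of "fst i" "fst j" "snd i" "snd j"] that
      unfolding fst_conv snd_conv d_def by (auto simp: S_def feasible_def)
  qed
  obtain s where s: "\<And>n::nat. s n \<in> S"
    and lim: "(\<lambda>n. bounded_J1 (fst (s n)) (snd (s n))) \<longlonglongrightarrow> (INF i\<in>S. bounded_J1 (fst i) (snd i))"
    and Cauchy: "\<And>e. 0 < e \<Longrightarrow> \<exists>N. \<forall>m\<ge>N. \<forall>n\<ge>N. d (s m) (s n) < e"
    using minimizing_sequence[OF ne low mid] by blast
  define W where "W n = fst (s n)" for n
  define m where "m n = snd (s n)" for n
  have W: "feasible (W n) (m n)" for n using s[of n] by (auto simp: S_def W_def m_def)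
  then have WH: "W n \<in> H0 \<Omega>" for n by (simp add: feasible_def)
  obtain U where U: "sq_int \<mu> U" "(\<lambda>n. nrm \<mu> (\<lambda>x. W n x - U x)) \<longlonglongrightarrow> 0"
  proof (rule L2_complete[of \<mu> W])
    show "sq_int \<mu> (W n)" for n by (rule H0_sq_int[OF WH])
    fix e :: real assume e: "0 < e"
    show "\<exists>N. \<forall>i\<ge>N. \<forall>j\<ge>N. nrm \<mu> (\<lambda>x. W i x - W j x) < e"
    proof (rule L2_Cauchy_of_bound[OF _ Cauchy _ _ e])
      show "(nrm \<mu> (\<lambda>x. W i x - W j x))\<^sup>2 \<le> ((C\<^sup>2 + 1) * 8) * d (s i) (s j)" for i j
      proof -
        let ?D = "\<lambda>x. W i x - W j x"
        have D: "?D \<in> H0 \<Omega>" by (rule H0_diff[OF \<Omega>(1) WH WH])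
        have "(nrm \<mu> ?D)\<^sup>2 = (nrm \<mu> (\<lambda>x. fst (?D x)))\<^sup>2 + (nrm \<mu> (\<lambda>x. snd (?D x)))\<^sup>2"
          using nrm_Pair_sq[OF H0_comp[OF D]] by (simp only: prod.collapse)
        also have "\<dots> \<le> (C * nrm \<mu> (\<lambda>x. snd (?D x)))\<^sup>2 + (nrm \<mu> (\<lambda>x. snd (?D x)))\<^sup>2"
          by (intro add_right_mono power_mono C(2)[OF D]) simp
        also have "\<dots> = (C\<^sup>2 + 1) * (nrm \<mu> (\<lambda>x. snd (?D x)))\<^sup>2" by (simp add: power_mult_distrib algebra_simps)
        also have "\<dots> \<le> (C\<^sup>2 + 1) * (8 * d (s i) (s j))"
          by (intro mult_left_mono) (auto simp: d_def W_def)
        finally show ?thesis by (simp only: mult.assoc)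
      qed
      show "0 < (C\<^sup>2 + 1) * 8" by (simp add: add_nonneg_pos)
    qed (auto simp: d_def)
  qed
  have UH: "U \<in> H0 \<Omega>" by (rule H0_closed[OF \<Omega>(1) U(1) WH U(2)])
  have "Cauchy m"
  proof (rule CauchyI)
    fix e :: real assume e: "0 < e"
    then obtain N where N: "\<forall>i\<ge>N. \<forall>j\<ge>N. d (s i) (s j) < e\<^sup>2 / 8" using Cauchy[of "e\<^sup>2 / 8"] by auto
    have "norm (m i - m j) < e" if "N \<le> i" "N \<le> j" for i j
    proof -
      have "(m i - m j)\<^sup>2 \<le> 8 * d (s i) (s j)" by (simp add: d_def m_def)
      also have "\<dots> < e\<^sup>2" using N[rule_format, OF that] by simp
      finally have "(norm (m i - m j))\<^sup>2 < e\<^sup>2" by simp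
      then show ?thesis by (rule power2_less_imp_less[OF _ less_imp_le[OF e]])
    qed
    then show "\<exists>M. \<forall>m'\<ge>M. \<forall>n\<ge>M. norm (m m' - m n) < e" by blast
  qed
  then obtain b where b: "m \<longlonglongrightarrow> b" by (auto simp: Cauchy_convergent_iff convergent_def)
  have sd: "sq_int \<mu> (\<lambda>x. W n x - U x)" for n using H0_sq_int[OF WH] U(1) by auto
  have lf: "(\<lambda>n. nrm \<mu> (\<lambda>x. fst (W n x) - fst (U x))) \<longlonglongrightarrow> 0"
    by (rule tendsto_sandwich[OF _ _ tendsto_const U(2)]) (use nrm_fst_le[OF sd] in auto)
  have ls: "(\<lambda>n. nrm \<mu> (\<lambda>x. snd (W n x) - snd (U x))) \<longlonglongrightarrow> 0"
    by (rule tendsto_sandwich[OF _ _ tendsto_const U(2)]) (use nrm_snd_le[OF sd] in auto)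
  have feas: "feasible U b"
    unfolding feasible_def
  proof (intro conjI UH)
    show "0 \<le> b" by (rule LIMSEQ_le_const[OF b]) (use W in \<open>auto simp: feasible_def\<close>)
    show "AE x in \<mu>. \<bar>fst (U x)\<bar> \<le> b"
      by (rule AE_le_of_L2_limit[OF H0_comp(1)[OF WH] H0_comp(1)[OF UH] lf b sq_int_one])
         (use W in \<open>auto simp: feasible_def\<close>)
  qed
  have "(\<lambda>n. ip \<mu> (\<lambda>x. snd (W n x)) (\<lambda>x. snd (W n x))) \<longlonglongrightarrow> ip \<mu> (\<lambda>x. snd (U x)) (\<lambda>x. snd (U x))"
    by (intro ip_tendsto H0_comp[OF WH] H0_comp[OF UH] ls)
  moreover have "(\<lambda>n. ip \<mu> (\<lambda>x. fst (W n x)) f) \<longlonglongrightarrow> ip \<mu> (\<lambda>x. fst (U x)) f"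
    by (intro ip_tendsto_left H0_comp[OF WH] H0_comp[OF UH] lf f)
  ultimately have "(\<lambda>n. bounded_J1 (W n) (m n)) \<longlonglongrightarrow> bounded_J1 U b"
    unfolding bounded_J1_def ip_commute[of \<mu> f] by (intro tendsto_intros b) auto
  then have Qeq: "bounded_J1 U b = (INF i\<in>S. bounded_J1 (fst i) (snd i))"
    using lim LIMSEQ_unique unfolding W_def m_def by blast
  have bdd: "bdd_below ((\<lambda>i. bounded_J1 (fst i) (snd i)) ` S)" using low by (rule bdd_belowI2)
  have "bounded_J1 U b \<le> bounded_J1 V n" if "feasible V n" for V n
  proof -
    have "(INF i\<in>S. bounded_J1 (fst i) (snd i)) \<le> bounded_J1 (fst (V, n)) (snd (V, n))"
      by (rule cINF_lower[OF bdd]) (use that in \<open>simp add: S_def\<close>)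
    then show ?thesis using Qeq by simp
  qed
  with feas show thesis by (rule that)
qed

lemma minimizer_unique:
  assumes U: "feasible U m" "\<And>V n. feasible V n \<Longrightarrow> bounded_J1 U m \<le> bounded_J1 V n" and V: "feasible V n" "bounded_J1 V n \<le> bounded_J1 U m"
  shows "AE x in \<mu>. fst (V x) = fst (U x)"
proof -
  have UH: "U \<in> H0 \<Omega>" and VH: "V \<in> H0 \<Omega>" using U V by (auto simp: feasible_def)
  have D: "(\<lambda>x. V x - U x) \<in> H0 \<Omega>" by (rule H0_diff[OF \<Omega>(1) VH UH])
  have "feasible (\<lambda>x. (1 - 1/2) *\<^sub>R U x + (1/2) *\<^sub>R V x) ((1 - 1/2) * m + (1/2) * n)"
    by (rule feasible_affine[OF U(1) V(1)]) auto
  from U(2)[OF this] have "(nrm \<mu> (\<lambda>x. snd (U x) - snd (V x)))\<^sup>2 + (m - n)\<^sup>2 \<le> 0"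
    using bounded_J1_midpoint[OF UH VH, of m n] V(2) by argo
  then have "(nrm \<mu> (\<lambda>x. snd (U x) - snd (V x)))\<^sup>2 \<le> 0"
    using zero_le_power2[of "m - n"] by linarith
  then have 0: "nrm \<mu> (\<lambda>x. snd (V x - U x)) = 0"
    by (simp add: nrm_diff_commute[of _ "\<lambda>x. snd (U x)"])
  obtain C where C: "0 < C" "\<And>U. U \<in> H0 \<Omega> \<Longrightarrow> nrm \<mu> (\<lambda>x. fst (U x)) \<le> C * nrm \<mu> (\<lambda>x. snd (U x))"
    by (rule Poincare[OF \<Omega>]) (rule that)
  have "nrm \<mu> (\<lambda>x. fst (V x - U x)) = 0"
    using C(2)[OF D] 0 nrm_nonneg[of \<mu> "\<lambda>x. fst (V x - U x)"] by (intro antisym) auto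
  then have "AE x in \<mu>. fst (V x - U x) = 0"
    by (rule nrm_eq_0_AE[OF H0_comp(1)[OF D]])
  then show ?thesis by eventually_elim simp
qed

text \<open>
  The weak solution \<open>v\<close> of \<open>v - l \<Delta>v = u\<close>, obtained from the Riesz representation theorem for the
  inner product \<open>\<integral>v \<psi> + l \<integral>\<nabla>v \<cdot> \<nabla>\<psi>\<close>; the factor \<open>c = \<surd>l\<close> turns it into the standard one.
\<close>

lemma resolvent:
  assumes u: "sq_int \<mu> u" and l: "0 < l"
  obtains V \<phi> where "V \<in> H0 \<Omega>" "\<And>n. \<phi> n \<in> test_functions \<Omega>" "(\<lambda>n. nrm \<mu> (\<lambda>x. jet (\<phi> n) x - V x)) \<longlonglongrightarrow> 0"
    "\<And>\<psi>. \<psi> \<in> test_functions \<Omega> \<Longrightarrow> l * ip \<mu> (\<lambda>x. snd (V x)) (grad \<psi>) = ip \<mu> (\<lambda>x. u x - fst (V x)) \<psi>"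
proof -
  define c where "c = sqrt l"
  have c: "0 < c" "c * c = l" using l by (auto simp: c_def)
  define j where "j \<phi> x = (\<phi> x, c *\<^sub>R grad \<phi> x)" for \<phi> :: "'a \<Rightarrow> real" and x
  have sj: "sq_int \<mu> (j \<phi>)" if "\<phi> \<in> test_functions \<Omega>" for \<phi>
    unfolding j_def by (intro sq_int_Pair sq_int_scale test_sq_int[OF that] grad_sq_int[OF that] \<Omega>)
  define S where "S = j ` test_functions \<Omega>"
  obtain p s where p: "sq_int \<mu> p" "\<And>n. s n \<in> S" "(\<lambda>n. nrm \<mu> (\<lambda>x. s n x - p x)) \<longlonglongrightarrow> 0"
    "\<And>w. w \<in> S \<Longrightarrow> ip \<mu> p w = ip \<mu> u (\<lambda>x. fst (w x))"
  proof (rule L2_Riesz[of S \<mu> "\<lambda>w. ip \<mu> u (\<lambda>x. fst (w x))" "nrm \<mu> u"])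
    show "S \<noteq> {}" unfolding S_def using test_zero by blast
    show sS: "sq_int \<mu> w" if "w \<in> S" for w using that sj by (auto simp: S_def)
    fix v w a b assume vw: "v \<in> S" "w \<in> S"
    then obtain \<phi> \<psi> where \<phi>: "\<phi> \<in> test_functions \<Omega>" "\<psi> \<in> test_functions \<Omega>" "v = j \<phi>" "w = j \<psi>" by (auto simp: S_def)
    have "j (\<lambda>x. a * \<phi> x + b * \<psi> x) = (\<lambda>x. a *\<^sub>R v x + b *\<^sub>R w x)"
      using \<phi>(3,4) by (auto simp: j_def grad_comb[OF test_smooth[OF \<phi>(1)] test_smooth[OF \<phi>(2)]] scaleR_add_right mult.commute)
    moreover have "(\<lambda>x. a * \<phi> x + b * \<psi> x) \<in> test_functions \<Omega>" using \<phi>(1,2) by (intro test_add test_cmult)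
    ultimately show "(\<lambda>x. a *\<^sub>R v x + b *\<^sub>R w x) \<in> S" unfolding S_def by (metis imageI)
    show "ip \<mu> u (\<lambda>x. fst (a *\<^sub>R v x + b *\<^sub>R w x)) = a * ip \<mu> u (\<lambda>x. fst (v x)) + b * ip \<mu> u (\<lambda>x. fst (w x))"
      using ip_add_right[OF sq_int_cmult sq_int_cmult u, OF sq_int_fst sq_int_fst, OF sS[OF vw(1)] sS[OF vw(2)]] by simp
  next
    fix w assume "w \<in> S"
    then have s: "sq_int \<mu> w" using sj by (auto simp: S_def)
    show "\<bar>ip \<mu> u (\<lambda>x. fst (w x))\<bar> \<le> nrm \<mu> u * nrm \<mu> w"
      using ip_Cauchy_Schwarz[OF u sq_int_fst[OF s]] mult_left_mono[OF nrm_fst_le[OF s] nrm_nonneg[of \<mu> u]] by linarith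
  qed (rule that)
  from p(2) have "\<exists>\<phi>. \<phi> \<in> test_functions \<Omega> \<and> s n = j \<phi>" for n by (auto simp: S_def)
  then obtain \<phi> where \<phi>: "\<And>n. \<phi> n \<in> test_functions \<Omega>" "\<And>n. s n = j (\<phi> n)" by metis
  define V where "V x = (fst (p x), (1 / c) *\<^sub>R snd (p x))" for x
  have sV: "sq_int \<mu> V" unfolding V_def by (intro sq_int_Pair sq_int_scale sq_int_fst sq_int_snd p)
  have lim: "(\<lambda>n. nrm \<mu> (\<lambda>x. jet (\<phi> n) x - V x)) \<longlonglongrightarrow> 0"
  proof -
    have le: "nrm \<mu> (\<lambda>x. jet (\<phi> n) x - V x) \<le> (1 + 1 / c) * nrm \<mu> (\<lambda>x. s n x - p x)" for n
    proof (rule nrm_mono)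
      show "sq_int \<mu> (\<lambda>x. s n x - p x)" using \<phi> sj p(1) by auto
      show "(\<lambda>x. jet (\<phi> n) x - V x) \<in> borel_measurable \<mu>"
        by (rule sq_int_measurable) (use \<phi>(1) \<Omega> sV in auto)
      have "norm (jet (\<phi> n) x - V x) \<le> (1 + 1 / c) * norm (s n x - p x)" for x
      proof -
        have "jet (\<phi> n) x - V x = (fst (s n x - p x), (1 / c) *\<^sub>R snd (s n x - p x))"
          using c(1) by (simp add: jet_def V_def \<phi>(2) j_def algebra_simps)
        also have "norm \<dots> \<le> norm (fst (s n x - p x)) + norm ((1 / c) *\<^sub>R snd (s n x - p x))"
          by (rule norm_Pair_le)
        also have "\<dots> \<le> norm (s n x - p x) + (1 / c) * norm (s n x - p x)"
          unfolding norm_scaleR using c(1) by (intro add_mono mult_mono norm_fst_le' norm_snd_le') auto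
        finally show ?thesis by (simp add: algebra_simps)
      qed
      then show "AE x in \<mu>. norm (jet (\<phi> n) x - V x) \<le> (1 + 1 / c) * norm (s n x - p x)" by auto
    qed (use c in auto)
    have "(\<lambda>n. (1 + 1 / c) * nrm \<mu> (\<lambda>x. s n x - p x)) \<longlonglongrightarrow> (1 + 1 / c) * 0"
      by (intro tendsto_mult_left p)
    then have l: "(\<lambda>n. (1 + 1 / c) * nrm \<mu> (\<lambda>x. s n x - p x)) \<longlonglongrightarrow> 0" by simp
    show ?thesis by (rule tendsto_sandwich[OF _ _ tendsto_const l]) (use le in auto)
  qed
  show thesis
  proof (rule that[OF H0_closed[OF \<Omega>(1) sV jet_in_H0[OF \<phi>(1) \<Omega>(1)] lim] \<phi>(1) lim])
    fix \<psi> assume \<psi>: "\<psi> \<in> test_functions \<Omega>"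
    have s: "sq_int \<mu> \<psi>" "sq_int \<mu> (\<lambda>x. c *\<^sub>R grad \<psi> x)" "sq_int \<mu> (\<lambda>x. fst (p x))" "sq_int \<mu> (\<lambda>x. snd (p x))"
      using \<psi> \<Omega> p(1) by auto
    have "ip \<mu> p (j \<psi>) = ip \<mu> u \<psi>" using p(4)[of "j \<psi>"] \<psi> by (simp add: S_def j_def)
    moreover have "ip \<mu> p (j \<psi>) = ip \<mu> (\<lambda>x. fst (p x)) \<psi> + c * ip \<mu> (\<lambda>x. snd (p x)) (grad \<psi>)"
      using ip_Pair[OF s(3,4,1,2)] by (simp add: j_def[abs_def])
    moreover have "l * ip \<mu> (\<lambda>x. snd (V x)) (grad \<psi>) = c * ip \<mu> (\<lambda>x. snd (p x)) (grad \<psi>)"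
      using c by (simp add: V_def c(2)[symmetric])
    ultimately show "l * ip \<mu> (\<lambda>x. snd (V x)) (grad \<psi>) = ip \<mu> (\<lambda>x. u x - fst (V x)) \<psi>"
      using ip_diff_left[OF u s(3,1)] by (simp add: V_def)
  qed
qed

text \<open>
  The maximum principle for the resolvent. For a smooth nondecreasing \<open>\<beta>\<close> vanishing exactly on
  \<open>[-m, m]\<close>, testing with \<open>\<beta>(v)\<close> gives \<open>\<integral>(v - u) \<beta>(v) = -l \<integral>\<beta>'(v) \<bar>\<nabla>v\<bar>\<^sup>2 \<le> 0\<close>, while the integrand on
  the left is positive where \<open>\<bar>v\<bar> > m\<close>. The test uses \<open>\<beta>(\<phi> n)\<close> for the approximating test functions
  \<open>\<phi> n\<close>, for which the chain rule is the classical one.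
\<close>

lemma resolvent_bounded:
  assumes u: "sq_int \<mu> u" "AE x in \<mu>. \<bar>u x\<bar> \<le> m" and m: "0 \<le> m" and l: "0 < l"
    and V: "V \<in> H0 \<Omega>" and \<phi>: "\<And>n. \<phi> n \<in> test_functions \<Omega>" "(\<lambda>n. nrm \<mu> (\<lambda>x. jet (\<phi> n) x - V x)) \<longlonglongrightarrow> 0"
    and eq: "\<And>\<psi>. \<psi> \<in> test_functions \<Omega> \<Longrightarrow> l * ip \<mu> (\<lambda>x. snd (V x)) (grad \<psi>) = ip \<mu> (\<lambda>x. u x - fst (V x)) \<psi>"
  shows "AE x in \<mu>. \<bar>fst (V x)\<bar> \<le> m"
proof -
  obtain D where D: "\<And>t. (flat has_real_derivative D t) (at t)" "\<And>t. 0 \<le> D t" "\<And>t. D t \<le> 2"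
    by (rule flat_deriv) (rule that)
  define \<beta> where "\<beta> t = flat (t - m) - flat (- t - m)" for t
  define \<beta>' where "\<beta>' t = D (t - m) + D (- t - m)" for t
  have \<beta>: "(\<beta> has_real_derivative \<beta>' t) (at t)" for t
    unfolding \<beta>_def \<beta>'_def
    by (auto intro!: derivative_eq_intros DERIV_chain2[OF D(1)])
  have \<beta>'0: "0 \<le> \<beta>' t" "\<beta>' t \<le> 4" for t
    using D(2)[of "t - m"] D(2)[of "- t - m"] D(3)[of "t - m"] D(3)[of "- t - m"] by (simp_all add: \<beta>'_def)
  have Lip: "\<bar>\<beta> s - \<beta> t\<bar> \<le> 4 * \<bar>s - t\<bar>" for s t
    using field_differentiable_bound[of UNIV \<beta> \<beta>' 4 s t] \<beta> \<beta>'0 by (auto simp: real_norm_def)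
  have \<beta>_0: "\<beta> 0 = 0" by (simp add: \<beta>_def)
  have \<beta>_cont: "continuous_on UNIV \<beta>" using \<beta> by (meson DERIV_continuous_on has_field_derivative_at_within)
  note sV = H0_comp[OF V]
  define v where "v x = fst (V x)" for x
  have sv: "sq_int \<mu> v" unfolding v_def by (rule sV)
  have comp: "sq_int \<mu> (\<lambda>x. \<beta> (w x))" if "sq_int \<mu> w" for w
  proof (rule sq_int_norm_le[where c=4, OF that])
    show "(\<lambda>x. \<beta> (w x)) \<in> borel_measurable \<mu>"
      using borel_measurable_continuous_on[OF \<beta>_cont sq_int_measurable[OF that]] .
    show "AE x in \<mu>. norm (\<beta> (w x)) \<le> 4 * norm (w x)" using Lip[of "w _" 0] \<beta>_0 by auto
  qed
  have s\<phi>: "sq_int \<mu> (\<phi> n)" "sq_int \<mu> (grad (\<phi> n))" for n using \<phi>(1) \<Omega> by auto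
  have sd: "sq_int \<mu> (\<lambda>x. jet (\<phi> n) x - V x)" for n using \<phi>(1) \<Omega> H0_sq_int[OF V] by auto
  have lf: "(\<lambda>n. nrm \<mu> (\<lambda>x. \<phi> n x - v x)) \<longlonglongrightarrow> 0"
    by (rule tendsto_sandwich[OF _ _ tendsto_const \<phi>(2)]) (use nrm_fst_le[OF sd] in \<open>auto simp: v_def\<close>)
  have ls: "(\<lambda>n. nrm \<mu> (\<lambda>x. grad (\<phi> n) x - snd (V x))) \<longlonglongrightarrow> 0"
    by (rule tendsto_sandwich[OF _ _ tendsto_const \<phi>(2)]) (use nrm_snd_le[OF sd] in auto)
  have test: "(\<lambda>x. \<beta> (\<phi> n x)) \<in> test_functions \<Omega>" for n
    unfolding \<beta>_def by (rule test_flat[OF \<phi>(1) m])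
  have g\<beta>: "grad (\<lambda>x. \<beta> (\<phi> n x)) x = \<beta>' (\<phi> n x) *\<^sub>R grad (\<phi> n) x" for n x
  proof -
    have "partial i (\<lambda>x. \<beta> (\<phi> n x)) x = \<beta>' (\<phi> n x) * partial i (\<phi> n) x" for i
      using partial_eq[OF has_derivative_compose_real[OF smooth_differentiable[OF test_smooth[OF \<phi>(1)]] \<beta>]]
      by (simp add: partial_def)
    then show ?thesis by (simp add: grad_def scaleR_sum_right)
  qed
  have bound: "ip \<mu> (\<lambda>x. v x - u x) (\<lambda>x. \<beta> (\<phi> n x))
      \<le> l * (nrm \<mu> (\<lambda>x. grad (\<phi> n) x - snd (V x)) * (4 * nrm \<mu> (grad (\<phi> n))))" for n
  proof -
    let ?B = "\<lambda>x. \<beta> (\<phi> n x)"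
    have sB: "sq_int \<mu> ?B" "sq_int \<mu> (grad ?B)" using test \<Omega> by auto
    have sg: "sq_int \<mu> (\<lambda>x. grad (\<phi> n) x - snd (V x))" using s\<phi> sV by auto
    have "0 \<le> ip \<mu> (grad (\<phi> n)) (grad ?B)"
      unfolding ip_def g\<beta> using \<beta>'0 by (intro Bochner_Integration.integral_nonneg) auto
    moreover have "ip \<mu> (grad (\<phi> n)) (grad ?B) = ip \<mu> (\<lambda>x. snd (V x)) (grad ?B) + ip \<mu> (\<lambda>x. grad (\<phi> n) x - snd (V x)) (grad ?B)"
      using ip_diff_left[OF s\<phi>(2) sV(2) sB(2)] by simp
    moreover have "ip \<mu> (\<lambda>x. grad (\<phi> n) x - snd (V x)) (grad ?B) \<le> nrm \<mu> (\<lambda>x. grad (\<phi> n) x - snd (V x)) * (4 * nrm \<mu> (grad (\<phi> n)))"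
    proof -
      have "nrm \<mu> (grad ?B) \<le> 4 * nrm \<mu> (grad (\<phi> n))"
        using \<beta>'0 by (intro nrm_mono s\<phi> sq_int_measurable[OF sB(2)]) (auto simp: g\<beta> intro!: mult_right_mono)
      then have "nrm \<mu> (\<lambda>x. grad (\<phi> n) x - snd (V x)) * nrm \<mu> (grad ?B) \<le> nrm \<mu> (\<lambda>x. grad (\<phi> n) x - snd (V x)) * (4 * nrm \<mu> (grad (\<phi> n)))"
        by (rule mult_left_mono) simp
      with ip_Cauchy_Schwarz[OF sg sB(2)] show ?thesis by linarith
    qed
    ultimately have "- ip \<mu> (\<lambda>x. snd (V x)) (grad ?B) \<le> nrm \<mu> (\<lambda>x. grad (\<phi> n) x - snd (V x)) * (4 * nrm \<mu> (grad (\<phi> n)))"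
      by linarith
    then have "l * (- ip \<mu> (\<lambda>x. snd (V x)) (grad ?B)) \<le> l * (nrm \<mu> (\<lambda>x. grad (\<phi> n) x - snd (V x)) * (4 * nrm \<mu> (grad (\<phi> n))))"
      using l by (intro mult_left_mono) auto
    moreover have "ip \<mu> (\<lambda>x. v x - u x) ?B = - ip \<mu> (\<lambda>x. u x - v x) ?B"
      using ip_minus_left[of \<mu> "\<lambda>x. u x - v x" ?B] by simp
    ultimately show ?thesis using eq[OF test[of n]] by (simp add: v_def)
  qed
  have "(\<lambda>n. ip \<mu> (\<lambda>x. v x - u x) (\<lambda>x. \<beta> (\<phi> n x))) \<longlonglongrightarrow> ip \<mu> (\<lambda>x. v x - u x) (\<lambda>x. \<beta> (v x))"
    unfolding ip_commute[of \<mu> "\<lambda>x. v x - u x"]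
  proof (rule ip_tendsto_left)
    have "nrm \<mu> (\<lambda>x. \<beta> (\<phi> n x) - \<beta> (v x)) \<le> 4 * nrm \<mu> (\<lambda>x. \<phi> n x - v x)" for n
      by (intro nrm_mono sq_int_diff s\<phi> sv sq_int_measurable[OF sq_int_diff[OF comp comp]]) (use Lip in auto)
    moreover have "(\<lambda>n. 4 * nrm \<mu> (\<lambda>x. \<phi> n x - v x)) \<longlonglongrightarrow> 4 * 0" by (intro tendsto_mult_left lf)
    then have l: "(\<lambda>n. 4 * nrm \<mu> (\<lambda>x. \<phi> n x - v x)) \<longlonglongrightarrow> 0" by simp
    ultimately show "(\<lambda>n. nrm \<mu> (\<lambda>x. \<beta> (\<phi> n x) - \<beta> (v x))) \<longlonglongrightarrow> 0"
      by (intro tendsto_sandwich[OF _ _ tendsto_const l]) auto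
  qed (use comp s\<phi> sv u in auto)
  moreover have "(\<lambda>n. l * (nrm \<mu> (\<lambda>x. grad (\<phi> n) x - snd (V x)) * (4 * nrm \<mu> (grad (\<phi> n))))) \<longlonglongrightarrow> l * (0 * (4 * nrm \<mu> (\<lambda>x. snd (V x))))"
    by (intro tendsto_mult tendsto_const ls nrm_tendsto s\<phi> sV)
  ultimately have le0: "ip \<mu> (\<lambda>x. v x - u x) (\<lambda>x. \<beta> (v x)) \<le> l * (0 * (4 * nrm \<mu> (\<lambda>x. snd (V x))))"
    by (rule LIMSEQ_le) (use bound in auto)
  have sign: "0 \<le> (t - a) * \<beta> t" "(t - a) * \<beta> t = 0 \<Longrightarrow> \<bar>t\<bar> \<le> m" if a: "\<bar>a\<bar> \<le> m" for t a
  proof -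
    consider "m < t" | "t < - m" | "\<bar>t\<bar> \<le> m" by linarith
    then have "0 < (t - a) * \<beta> t \<or> (t - a) * \<beta> t = 0 \<and> \<bar>t\<bar> \<le> m"
    proof cases
      case 1
      then have "0 < \<beta> t" using m by (simp add: \<beta>_def flat_eq)
      with 1 a show ?thesis by simp
    next
      case 2
      then have "\<beta> t < 0" using m by (simp add: \<beta>_def flat_eq)
      with 2 a show ?thesis by (simp add: mult_neg_neg)
    next
      case 3
      then show ?thesis by (simp add: \<beta>_def flat_eq)
    qed
    then show "0 \<le> (t - a) * \<beta> t" "(t - a) * \<beta> t = 0 \<Longrightarrow> \<bar>t\<bar> \<le> m" by auto
  qed
  have int: "integrable \<mu> (\<lambda>x. (v x - u x) * \<beta> (v x))"
    by (intro integrable_mult_sq sq_int_diff sv u comp)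
  have nn: "AE x in \<mu>. 0 \<le> (v x - u x) * \<beta> (v x)" using u(2) by eventually_elim (rule sign)
  have "(LINT x|\<mu>. (v x - u x) * \<beta> (v x)) \<le> 0" using le0 by (simp add: ip_def)
  then have "(LINT x|\<mu>. (v x - u x) * \<beta> (v x)) = 0"
    using integral_nonneg_AE[OF nn] by linarith
  then have "AE x in \<mu>. (v x - u x) * \<beta> (v x) = 0"
    using integral_nonneg_eq_0_iff_AE[OF int nn] by simp
  with u(2) show ?thesis by eventually_elim (use sign v_def in auto)
qed

section \<open>The Euler-Lagrange equation\<close>

definition minimizer :: "('a \<Rightarrow> real \<times> 'a) \<Rightarrow> real \<Rightarrow> bool" where
  "minimizer U m \<longleftrightarrow> feasible U m \<and> (\<forall>V n. feasible V n \<longrightarrow> bounded_J1 U m \<le> bounded_J1 V n)"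

lemma minimizer_H0: "minimizer U m \<Longrightarrow> U \<in> H0 \<Omega>"
  by (simp add: minimizer_def feasible_def)

text \<open>
  The first-order condition on the segment from \<open>U\<close> to \<open>V\<close>, along which \<open>m\<close> remains a bound.
\<close>

lemma variational_inequality:
  assumes U: "minimizer U m" and V: "V \<in> H0 \<Omega>" "AE x in \<mu>. \<bar>fst (V x)\<bar> \<le> m"
  shows "ip \<mu> f (\<lambda>x. fst (V x) - fst (U x)) \<le> ip \<mu> (\<lambda>x. snd (U x)) (\<lambda>x. snd (V x) - snd (U x))"
proof -
  have UH: "U \<in> H0 \<Omega>" by (rule minimizer_H0[OF U])
  have V': "feasible V m" using U V by (auto simp: minimizer_def feasible_def)
  have "0 \<le> t * (ip \<mu> (\<lambda>x. snd (U x)) (\<lambda>x. snd (V x) - snd (U x)) - ip \<mu> f (\<lambda>x. fst (V x) - fst (U x)))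
    + t\<^sup>2 * (ip \<mu> (\<lambda>x. snd (V x) - snd (U x)) (\<lambda>x. snd (V x) - snd (U x)) / 2)" if t: "0 < t" "t \<le> 1" for t
  proof -
    have "feasible (\<lambda>x. (1 - t) *\<^sub>R U x + t *\<^sub>R V x) ((1 - t) * m + t * m)"
      using U V' t by (intro feasible_affine) (auto simp: minimizer_def)
    then have "bounded_J1 U m \<le> bounded_J1 (\<lambda>x. (1 - t) *\<^sub>R U x + t *\<^sub>R V x) ((1 - t) * m + t * m)"
      using U by (simp add: minimizer_def)
    also have "(1 - t) * m + t * m = m" by (simp add: algebra_simps)
    finally show ?thesis unfolding bounded_J1_affine[OF UH V(1), of t m m] by simp
  qed
  then have "0 \<le> ip \<mu> (\<lambda>x. snd (U x)) (\<lambda>x. snd (V x) - snd (U x)) - ip \<mu> f (\<lambda>x. fst (V x) - fst (U x))"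
    by (rule small_linear_nonneg)
  then show ?thesis by simp
qed

text \<open>
  The first-order condition along the ray through \<open>(U, m)\<close>, which may be followed in both directions.
\<close>

lemma scaling_identity:
  assumes U: "minimizer U m"
  shows "ip \<mu> (\<lambda>x. snd (U x)) (\<lambda>x. snd (U x)) + m\<^sup>2 = ip \<mu> f (\<lambda>x. fst (U x))"
proof -
  define a where "a = ip \<mu> (\<lambda>x. snd (U x)) (\<lambda>x. snd (U x)) + m\<^sup>2"
  define b where "b = ip \<mu> f (\<lambda>x. fst (U x))"
  have "0 \<le> 0 + 2 * t * ((a - b) / 2) + t\<^sup>2 * (a / 2)" for t
  proof -
    have "feasible (\<lambda>x. (1 + t) *\<^sub>R U x) (\<bar>1 + t\<bar> * m)"
      unfolding feasible_def
    proof (intro conjI)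
      show "(\<lambda>x. (1 + t) *\<^sub>R U x) \<in> H0 \<Omega>"
        using H0_comb[OF \<Omega>(1) minimizer_H0[OF U] minimizer_H0[OF U], of "1 + t" 0] by simp
      show "0 \<le> \<bar>1 + t\<bar> * m" using U by (simp add: minimizer_def feasible_def)
      have "AE x in \<mu>. \<bar>fst (U x)\<bar> \<le> m" using U by (simp add: minimizer_def feasible_def)
      then show "AE x in \<mu>. \<bar>fst ((1 + t) *\<^sub>R U x)\<bar> \<le> \<bar>1 + t\<bar> * m"
        by eventually_elim (simp add: abs_mult mult_left_mono)
    qed
    then have "bounded_J1 U m \<le> bounded_J1 (\<lambda>x. (1 + t) *\<^sub>R U x) (\<bar>1 + t\<bar> * m)"
      using U by (simp add: minimizer_def)
    also have "\<dots> = (1 + t)\<^sup>2 * a / 2 - (1 + t) * b"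
      unfolding bounded_J1_def snd_scaleR fst_scaleR ip_scale_left ip_scale_right a_def b_def power_mult_distrib power2_abs
      by (simp add: power2_eq_square field_simps)
    finally show ?thesis by (simp add: bounded_J1_def a_def b_def power2_eq_square field_simps)
  qed
  then have "((a - b) / 2)\<^sup>2 \<le> 0 * (a / 2)"
    by (rule quadratic_nonneg_discriminant) (auto simp: a_def)
  then show ?thesis by (simp add: a_def b_def)
qed

text \<open>
  The distribution \<open>\<Delta>u\<close> is square-integrable. For \<open>v\<close> with \<open>v - l \<Delta>v = u\<close>, which is admissible in the
  variational inequality by the maximum principle, and \<open>z = -\<Delta>v = (u - v)/l\<close>, the inequality becomes
  \<open>-l \<integral>f z \<le> \<integral>\<nabla>u \<cdot> \<nabla>(v - u) \<le> \<integral>\<nabla>v \<cdot> \<nabla>(v - u) = -l \<integral>z\<^sup>2\<close>, so \<open>\<parallel>z\<parallel> \<le> \<parallel>f\<parallel>\<close> independently of \<open>l\<close>. As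
  \<open>l\<close> tends to zero, \<open>v\<close> tends to \<open>u\<close>.
\<close>

lemma source_bound:
  assumes U: "minimizer U m" and \<phi>: "\<phi> \<in> test_functions \<Omega>"
  shows "\<bar>ip \<mu> (\<lambda>x. snd (U x)) (grad \<phi>)\<bar> \<le> nrm \<mu> f * nrm \<mu> \<phi>"
proof -
  have UH: "U \<in> H0 \<Omega>" by (rule minimizer_H0[OF U])
  note sU = H0_comp[OF UH]
  have m: "0 \<le> m" "AE x in \<mu>. \<bar>fst (U x)\<bar> \<le> m" using U by (auto simp: minimizer_def feasible_def)
  have s\<phi>: "sq_int \<mu> \<phi>" "sq_int \<mu> (laplacian \<phi>)" using \<phi> laplacian_test[OF \<phi>] \<Omega> by auto
  have step: "\<exists>v. sq_int \<mu> v \<and> nrm \<mu> (\<lambda>x. v x - fst (U x)) \<le> l * nrm \<mu> f \<and> \<bar>ip \<mu> v (laplacian \<phi>)\<bar> \<le> nrm \<mu> f * nrm \<mu> \<phi>"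
    if l: "0 < l" for l
  proof -
    obtain V \<psi> where V: "V \<in> H0 \<Omega>" "\<And>n. \<psi> n \<in> test_functions \<Omega>" "(\<lambda>n. nrm \<mu> (\<lambda>x. jet (\<psi> n) x - V x)) \<longlonglongrightarrow> 0"
      and eq: "\<And>\<eta>. \<eta> \<in> test_functions \<Omega> \<Longrightarrow> l * ip \<mu> (\<lambda>x. snd (V x)) (grad \<eta>) = ip \<mu> (\<lambda>x. fst (U x) - fst (V x)) \<eta>"
      by (rule resolvent[OF sU(1) l]) (rule that)
    note sV = H0_comp[OF V(1)]
    have Vm: "AE x in \<mu>. \<bar>fst (V x)\<bar> \<le> m"
      by (rule resolvent_bounded[OF sU(1) m(2,1) l V eq])
    define z where "z x = (1 / l) * (fst (U x) - fst (V x))" for x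
    have sz: "sq_int \<mu> z" unfolding z_def by (intro sq_int_cmult sq_int_diff sU sV)
    have lz: "fst (U x) - fst (V x) = l * z x" for x using l by (simp add: z_def)
    have eqz: "ip \<mu> (\<lambda>x. snd (V x)) (grad \<eta>) = ip \<mu> z \<eta>" if "\<eta> \<in> test_functions \<Omega>" for \<eta>
      using eq[OF that] l by (simp add: lz)
    have sd: "sq_int \<mu> (\<lambda>x. snd (V x) - snd (U x))" using sU sV by auto
    have D: "(\<lambda>x. V x - U x) \<in> H0 \<Omega>" by (rule H0_diff[OF \<Omega>(1) V(1) UH])
    have "ip \<mu> (\<lambda>x. snd (V x)) (\<lambda>x. snd (V x) - snd (U x)) = ip \<mu> z (\<lambda>x. fst (V x) - fst (U x))"
      using H0_Green[OF \<Omega>(1) D sV(2) sz eqz] by simp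
    also have "(\<lambda>x. fst (V x) - fst (U x)) = (\<lambda>x. - l * z x)" using lz by (auto simp: algebra_simps)
    finally have 1: "ip \<mu> (\<lambda>x. snd (V x)) (\<lambda>x. snd (V x) - snd (U x)) = - l * ip \<mu> z z"
      by (simp only: ip_cmult_right)
    have "ip \<mu> f (\<lambda>x. fst (V x) - fst (U x)) \<le> ip \<mu> (\<lambda>x. snd (U x)) (\<lambda>x. snd (V x) - snd (U x))"
      by (rule variational_inequality[OF U V(1) Vm])
    also have "(\<lambda>x. fst (V x) - fst (U x)) = (\<lambda>x. - l * z x)" using lz by (auto simp: algebra_simps)
    finally have "- l * ip \<mu> f z \<le> ip \<mu> (\<lambda>x. snd (U x)) (\<lambda>x. snd (V x) - snd (U x))"
      by (simp only: ip_cmult_right)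
    \<comment> \<open>The difference of the two sides is the squared norm of \<open>\<nabla>v - \<nabla>u\<close>.\<close>
    also have "\<dots> \<le> ip \<mu> (\<lambda>x. snd (V x)) (\<lambda>x. snd (V x) - snd (U x))"
      using ip_diff_left[OF sV(2) sU(2) sd] ip_self_nonneg[of \<mu> "\<lambda>x. snd (V x) - snd (U x)"] by linarith
    finally have "l * ip \<mu> z z \<le> l * ip \<mu> f z" unfolding 1 by simp
    then have "ip \<mu> z z \<le> ip \<mu> f z" using l by simp
    then have "nrm \<mu> z * nrm \<mu> z \<le> nrm \<mu> f * nrm \<mu> z"
      using ip_Cauchy_Schwarz[OF f sz] by (simp add: nrm_sq[symmetric] power2_eq_square)
    then have zf: "nrm \<mu> z \<le> nrm \<mu> f"
      by (cases "nrm \<mu> z = 0") (auto simp: mult_le_cancel_right order_less_le)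
    have "nrm \<mu> (\<lambda>x. fst (V x) - fst (U x)) = l * nrm \<mu> z"
      using l unfolding nrm_diff_commute[of _ "\<lambda>x. fst (V x)"] lz by simp
    also have "\<dots> \<le> l * nrm \<mu> f" using zf l by (intro mult_left_mono) auto
    finally have 2: "nrm \<mu> (\<lambda>x. fst (V x) - fst (U x)) \<le> l * nrm \<mu> f" .
    have "\<bar>ip \<mu> (\<lambda>x. fst (V x)) (laplacian \<phi>)\<bar> = \<bar>ip \<mu> z \<phi>\<bar>"
      using ip_grad_H0[OF \<Omega>(1) V(1) \<phi>] eqz[OF \<phi>] by simp
    also have "\<dots> \<le> nrm \<mu> z * nrm \<mu> \<phi>" by (rule ip_Cauchy_Schwarz[OF sz s\<phi>(1)])
    also have "\<dots> \<le> nrm \<mu> f * nrm \<mu> \<phi>" using zf by (intro mult_right_mono) auto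
    finally show ?thesis using 2 sV(1) by blast
  qed
  have "\<forall>n. \<exists>v. sq_int \<mu> v \<and> nrm \<mu> (\<lambda>x. v x - fst (U x)) \<le> (1 / real (Suc n)) * nrm \<mu> f \<and>
      \<bar>ip \<mu> v (laplacian \<phi>)\<bar> \<le> nrm \<mu> f * nrm \<mu> \<phi>"
    by (rule allI, rule step) simp
  from choice[OF this] obtain v where "\<forall>n. sq_int \<mu> (v n) \<and> nrm \<mu> (\<lambda>x. v n x - fst (U x)) \<le> (1 / real (Suc n)) * nrm \<mu> f \<and>
      \<bar>ip \<mu> (v n) (laplacian \<phi>)\<bar> \<le> nrm \<mu> f * nrm \<mu> \<phi>" ..
  then have v: "\<And>n. sq_int \<mu> (v n)" "\<And>n. nrm \<mu> (\<lambda>x. v n x - fst (U x)) \<le> (1 / real (Suc n)) * nrm \<mu> f"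
    "\<And>n. \<bar>ip \<mu> (v n) (laplacian \<phi>)\<bar> \<le> nrm \<mu> f * nrm \<mu> \<phi>" by blast+
  have "(\<lambda>n. (1 / real (Suc n)) * nrm \<mu> f) \<longlonglongrightarrow> 0 * nrm \<mu> f"
    by (intro tendsto_mult tendsto_const LIMSEQ_Suc[OF lim_1_over_n])
  then have l0: "(\<lambda>n. (1 / real (Suc n)) * nrm \<mu> f) \<longlonglongrightarrow> 0" by simp
  have "(\<lambda>n. nrm \<mu> (\<lambda>x. v n x - fst (U x))) \<longlonglongrightarrow> 0"
    by (rule tendsto_sandwich[OF _ _ tendsto_const l0]) (use v(2) in \<open>auto intro: always_eventually\<close>)
  then have "(\<lambda>n. \<bar>ip \<mu> (v n) (laplacian \<phi>)\<bar>) \<longlonglongrightarrow> \<bar>ip \<mu> (\<lambda>x. fst (U x)) (laplacian \<phi>)\<bar>"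
    by (intro tendsto_rabs ip_tendsto_left v sU s\<phi>)
  then have "\<bar>ip \<mu> (\<lambda>x. fst (U x)) (laplacian \<phi>)\<bar> \<le> nrm \<mu> f * nrm \<mu> \<phi>"
    by (rule LIMSEQ_le_const2) (use v(3) in auto)
  then show ?thesis using ip_grad_H0[OF \<Omega>(1) UH \<phi>] by simp
qed

lemma exists_source:
  assumes U: "minimizer U m"
  obtains g where "sq_int \<mu> g" "\<And>\<phi>. \<phi> \<in> test_functions \<Omega> \<Longrightarrow> ip \<mu> (\<lambda>x. snd (U x)) (grad \<phi>) = ip \<mu> g \<phi>"
proof -
  note sU = H0_comp[OF minimizer_H0[OF U]]
  show thesis
  proof (rule L2_Riesz[of "test_functions \<Omega>" \<mu> "\<lambda>\<phi>. ip \<mu> (\<lambda>x. snd (U x)) (grad \<phi>)" "nrm \<mu> f"])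
    show "test_functions \<Omega> \<noteq> {}" using test_zero by blast
    show "sq_int \<mu> \<phi>" if "\<phi> \<in> test_functions \<Omega>" for \<phi> using that \<Omega> by auto
    fix \<phi> \<psi> a b assume t: "\<phi> \<in> test_functions \<Omega>" "\<psi> \<in> test_functions \<Omega>"
    show "(\<lambda>x. a *\<^sub>R \<phi> x + b *\<^sub>R \<psi> x) \<in> test_functions \<Omega>"
      unfolding real_scaleR_def using t by (intro test_add test_cmult)
    have "sq_int \<mu> (grad \<phi>)" "sq_int \<mu> (grad \<psi>)" using t \<Omega> by auto
    moreover have "grad (\<lambda>x. a *\<^sub>R \<phi> x + b *\<^sub>R \<psi> x) = (\<lambda>x. a *\<^sub>R grad \<phi> x + b *\<^sub>R grad \<psi> x)"
      unfolding real_scaleR_def using grad_comb[OF test_smooth[OF t(1)] test_smooth[OF t(2)]] by auto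
    ultimately show "ip \<mu> (\<lambda>x. snd (U x)) (grad (\<lambda>x. a *\<^sub>R \<phi> x + b *\<^sub>R \<psi> x))
      = a * ip \<mu> (\<lambda>x. snd (U x)) (grad \<phi>) + b * ip \<mu> (\<lambda>x. snd (U x)) (grad \<psi>)"
      using ip_add_right[OF sq_int_scale sq_int_scale sU(2)] by simp
  next
    fix \<phi> assume "\<phi> \<in> test_functions \<Omega>"
    then show "\<bar>ip \<mu> (\<lambda>x. snd (U x)) (grad \<phi>)\<bar> \<le> nrm \<mu> f * nrm \<mu> \<phi>" by (rule source_bound[OF U])
  qed (use that in auto)
qed

text \<open>
  The variational inequality is tested with \<open>u + \<zeta> (c - u)\<close>, a pointwise convex combination of \<open>u\<close> and the
  constant \<open>c\<close>.
\<close>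

lemma source_sign:
  assumes U: "minimizer U m" and g: "sq_int \<mu> g"
    and eq: "\<And>\<phi>. \<phi> \<in> test_functions \<Omega> \<Longrightarrow> ip \<mu> (\<lambda>x. snd (U x)) (grad \<phi>) = ip \<mu> g \<phi>"
    and c: "\<bar>c\<bar> = m"
  shows "AE x in \<mu>. 0 \<le> (g x - f x) * (c - fst (U x))"
proof (rule AE_nonneg_if_test_nonneg[OF \<Omega>(1)])
  have UH: "U \<in> H0 \<Omega>" by (rule minimizer_H0[OF U])
  note sU = H0_comp[OF UH]
  have Um: "AE x in \<mu>. \<bar>fst (U x)\<bar> \<le> m" using U by (auto simp: minimizer_def feasible_def)
  have sc: "sq_int \<mu> (\<lambda>x. c - fst (U x))" using const_sq_int[OF \<Omega>(2,1)] sU by auto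
  have sgf: "sq_int \<mu> (\<lambda>x. g x - f x)" using g f by auto
  show "integrable \<mu> (\<lambda>x. (g x - f x) * (c - fst (U x)))"
    by (rule integrable_mult_sq[OF sgf sc])
  fix \<zeta> :: "'a \<Rightarrow> real" assume \<zeta>: "\<zeta> \<in> test_functions \<Omega>" "\<And>x. 0 \<le> \<zeta> x" "\<And>x. \<zeta> x \<le> 1"
  have W: "cut \<zeta> c U \<in> H0 \<Omega>" by (rule cut_in_H0[OF \<Omega> UH \<zeta>(1)])
  let ?V = "\<lambda>x. U x - cut \<zeta> c U x"
  have V: "?V \<in> H0 \<Omega>" by (rule H0_diff[OF \<Omega>(1) UH W])
  have d: "(\<lambda>x. fst (?V x) - fst (U x)) = (\<lambda>x. \<zeta> x * (c - fst (U x)))"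
    "(\<lambda>x. snd (?V x) - snd (U x)) = (\<lambda>x. snd ((- 1) *\<^sub>R cut \<zeta> c U x + 0 *\<^sub>R U x))"
    by (auto simp: cut_def algebra_simps)
  have sd: "sq_int \<mu> (\<lambda>x. \<zeta> x * (c - fst (U x)))" using sq_int_test_mult[OF sc \<zeta>(1)] by simp
  have "AE x in \<mu>. \<bar>fst (?V x)\<bar> \<le> m"
    using Um
  proof eventually_elim
    case (elim x)
    have "\<bar>fst (?V x)\<bar> = \<bar>(1 - \<zeta> x) * fst (U x) + \<zeta> x * c\<bar>" by (simp add: cut_def algebra_simps)
    also have "\<dots> \<le> \<bar>(1 - \<zeta> x) * fst (U x)\<bar> + \<bar>\<zeta> x * c\<bar>" by (rule abs_triangle_ineq)
    also have "\<dots> \<le> (1 - \<zeta> x) * m + \<zeta> x * m"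
      using elim \<zeta>(2,3)[of x] c by (auto simp: abs_mult intro!: add_mono mult_left_mono)
    finally show ?case by (simp add: algebra_simps)
  qed
  from variational_inequality[OF U V this]
  have "ip \<mu> f (\<lambda>x. \<zeta> x * (c - fst (U x))) \<le> ip \<mu> (\<lambda>x. snd (U x)) (\<lambda>x. snd ((- 1) *\<^sub>R cut \<zeta> c U x + 0 *\<^sub>R U x))"
    unfolding d .
  also have "\<dots> = ip \<mu> g (\<lambda>x. fst ((- 1) *\<^sub>R cut \<zeta> c U x + 0 *\<^sub>R U x))"
    by (rule H0_Green[OF \<Omega>(1) H0_comb[OF \<Omega>(1) W UH] sU(2) g eq])
  also have "(\<lambda>x. fst ((- 1) *\<^sub>R cut \<zeta> c U x + 0 *\<^sub>R U x)) = (\<lambda>x. \<zeta> x * (c - fst (U x)))"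
    by (auto simp: cut_def algebra_simps)
  finally have "0 \<le> ip \<mu> (\<lambda>x. g x - f x) (\<lambda>x. \<zeta> x * (c - fst (U x)))"
    using ip_diff_left[OF g f sd] by simp
  then show "0 \<le> (LINT x|\<mu>. (g x - f x) * (c - fst (U x)) * \<zeta> x)"
    by (simp add: ip_def mult_ac)
qed

text \<open>
  Here \<open>g = -\<Delta>u\<close>. The sign conditions with \<open>c = m\<close> and \<open>c = -m\<close> leave \<open>g = f\<close> where \<open>\<bar>u\<bar> < m\<close> and determine
  the sign of \<open>g - f\<close> on the contact set, where moreover \<open>g = 0\<close>.
\<close>

lemma Euler_Lagrange:
  assumes U: "minimizer U m" and m: "0 < m"
  obtains g where "sq_int \<mu> g" "\<And>V. V \<in> H0 \<Omega> \<Longrightarrow> ip \<mu> (\<lambda>x. snd (U x)) (\<lambda>x. snd (V x)) = ip \<mu> g (\<lambda>x. fst (V x))"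
    "AE x in \<mu>. \<bar>fst (U x)\<bar> < m \<and> g x = f x \<or> fst (U x) = m \<and> g x = 0 \<and> 0 \<le> f x \<or> fst (U x) = - m \<and> g x = 0 \<and> f x \<le> 0"
proof -
  have UH: "U \<in> H0 \<Omega>" by (rule minimizer_H0[OF U])
  obtain g where g: "sq_int \<mu> g" "\<And>\<phi>. \<phi> \<in> test_functions \<Omega> \<Longrightarrow> ip \<mu> (\<lambda>x. snd (U x)) (grad \<phi>) = ip \<mu> g \<phi>"
    by (rule exists_source[OF U]) (rule that)
  have Um: "AE x in \<mu>. \<bar>fst (U x)\<bar> \<le> m" using U by (auto simp: minimizer_def feasible_def)
  have "AE x in \<mu>. 0 \<le> (g x - f x) * (m - fst (U x))" "AE x in \<mu>. 0 \<le> (g x - f x) * (- m - fst (U x))"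
    using source_sign[OF U g, of m] source_sign[OF U g, of "- m"] m by auto
  moreover have "AE x in \<mu>. fst (U x) = m \<longrightarrow> g x = 0" "AE x in \<mu>. fst (U x) = - m \<longrightarrow> g x = 0"
    using source_zero_on_level_set[OF \<Omega> UH g, of m] source_zero_on_level_set[OF \<Omega> UH g, of "- m"] by auto
  ultimately have "AE x in \<mu>. \<bar>fst (U x)\<bar> < m \<and> g x = f x \<or> fst (U x) = m \<and> g x = 0 \<and> 0 \<le> f x \<or> fst (U x) = - m \<and> g x = 0 \<and> f x \<le> 0"
    using Um
  proof eventually_elim
    case (elim x)
    consider "\<bar>fst (U x)\<bar> < m" | "fst (U x) = m" | "fst (U x) = - m" using elim(5) by linarith
    then show ?case
    proof cases
      case 1
      then have "0 < m - fst (U x)" "- m - fst (U x) < 0" by auto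
      with elim(1,2) have "0 \<le> g x - f x" "g x - f x \<le> 0"
        by (auto simp: zero_le_mult_iff)
      with 1 show ?thesis by simp
    next
      case 2
      with elim m have "g x = 0" "0 \<le> (g x - f x) * (- m - m)" by auto
      then have "0 \<le> f x" using m by (auto simp: zero_le_mult_iff)
      with 2 \<open>g x = 0\<close> show ?thesis by simp
    next
      case 3
      with elim m have "g x = 0" "0 \<le> (g x - f x) * (m - (- m))" by auto
      then have "f x \<le> 0" using m by (auto simp: mult_le_0_iff)
      with 3 \<open>g x = 0\<close> show ?thesis by simp
    qed
  qed
  moreover have "ip \<mu> (\<lambda>x. snd (U x)) (\<lambda>x. snd (V x)) = ip \<mu> g (\<lambda>x. fst (V x))" if "V \<in> H0 \<Omega>" for V
    by (rule H0_Green[OF \<Omega>(1) that H0_comp(2)[OF UH] g])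
  ultimately show thesis using g(1) by (intro that)
qed

text \<open>
  If \<open>m = 0\<close>, then \<open>u = 0\<close>, and the functional is nonnegative at all multiples \<open>t \<phi>\<close> of a test function,
  where it is \<open>O(t\<^sup>2) - t \<integral>f \<phi>\<close>.
\<close>

lemma source_trivial:
  assumes U: "minimizer U 0" shows "AE x in \<mu>. f x = 0"
proof (rule AE_zero_if_test_zero[OF \<Omega>(1)])
  show "integrable \<mu> f" using integrable_mult_sq[OF f sq_int_one] by simp
  fix \<phi> assume \<phi>: "\<phi> \<in> test_functions \<Omega>"
  obtain B where B: "0 < B" "\<And>x. \<bar>\<phi> x\<bar> \<le> B" using test_bounded[OF \<phi>] by blast
  have UH: "U \<in> H0 \<Omega>" by (rule minimizer_H0[OF U])
  have "0 \<le> bounded_J1 U 0"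
  proof -
    have "AE x in \<mu>. fst (U x) = 0" using U by (auto simp: minimizer_def feasible_def)
    then have "ip \<mu> f (\<lambda>x. fst (U x)) = (LINT x|\<mu>. 0)"
      unfolding ip_def using sq_int_measurable[OF f] sq_int_measurable[OF H0_comp(1)[OF UH]]
      by (intro integral_cong_AE) auto
    then show ?thesis by (simp add: bounded_J1_def)
  qed
  have "0 \<le> 0 + 2 * t * (- ip \<mu> f \<phi> / 2) + t\<^sup>2 * ((ip \<mu> (grad \<phi>) (grad \<phi>) + B\<^sup>2) / 2)" for t
  proof -
    have "feasible (\<lambda>x. t *\<^sub>R jet \<phi> x) (\<bar>t\<bar> * B)"
      unfolding feasible_def
    proof (intro conjI)
      show "(\<lambda>x. t *\<^sub>R jet \<phi> x) \<in> H0 \<Omega>"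
        using H0_comb[OF \<Omega>(1) jet_in_H0 jet_in_H0, OF \<phi> \<Omega>(1) \<phi> \<Omega>(1), of t 0] by simp
    qed (use B in \<open>auto simp: abs_mult mult_left_mono\<close>)
    then have "0 \<le> bounded_J1 (\<lambda>x. t *\<^sub>R jet \<phi> x) (\<bar>t\<bar> * B)"
      using U \<open>0 \<le> bounded_J1 U 0\<close> by (force simp: minimizer_def)
    also have "\<dots> = 0 + 2 * t * (- ip \<mu> f \<phi> / 2) + t\<^sup>2 * ((ip \<mu> (grad \<phi>) (grad \<phi>) + B\<^sup>2) / 2)"
      by (simp add: bounded_J1_def power_mult_distrib field_simps power2_eq_square)
    finally show ?thesis .
  qed
  then have "(- ip \<mu> f \<phi> / 2)\<^sup>2 \<le> 0 * ((ip \<mu> (grad \<phi>) (grad \<phi>) + B\<^sup>2) / 2)"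
    by (rule quadratic_nonneg_discriminant) auto
  then show "(LINT x|\<mu>. f x * \<phi> x) = 0" by (simp add: ip_def)
qed

section \<open>Optimal potentials\<close>

lemma Linf_norm_le_iff:
  assumes u: "u \<in> borel_measurable \<mu>" and c: "0 \<le> c"
  shows "Linf_norm \<Omega> u \<le> ennreal c \<longleftrightarrow> (AE x in \<mu>. \<bar>u x\<bar> \<le> c)"
proof
  have m: "(\<lambda>x. ennreal \<bar>u x\<bar>) \<in> borel_measurable \<mu>" using u by measurable
  show "Linf_norm \<Omega> u \<le> ennreal c" if "AE x in \<mu>. \<bar>u x\<bar> \<le> c"
    unfolding Linf_norm_def by (rule esssup_I[OF m]) (use that in \<open>auto elim!: eventually_mono intro: ennreal_leI\<close>)
  show "AE x in \<mu>. \<bar>u x\<bar> \<le> c" if le: "Linf_norm \<Omega> u \<le> ennreal c"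
    using esssup_AE[of "\<lambda>x. ennreal \<bar>u x\<bar>" \<mu>]
  proof eventually_elim
    case (elim x)
    also have "esssup \<mu> (\<lambda>x. ennreal \<bar>u x\<bar>) \<le> ennreal c" using le by (simp add: Linf_norm_def)
    finally show ?case using c by simp
  qed
qed

lemma feasible_Linf:
  assumes "U \<in> H0 \<Omega>" "Linf_norm \<Omega> (\<lambda>x. fst (U x)) \<le> ennreal n" "0 \<le> n"
  shows "feasible U n"
  using assms Linf_norm_le_iff[OF sq_int_measurable[OF H0_comp(1)[OF assms(1)]] assms(3)]
  by (simp add: feasible_def)

lemma minimizer_Linf:
  assumes U: "minimizer U m" shows "Linf_norm \<Omega> (\<lambda>x. fst (U x)) = ennreal m"
proof -
  let ?N = "Linf_norm \<Omega> (\<lambda>x. fst (U x))"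
  have UH: "U \<in> H0 \<Omega>" and m: "0 \<le> m" "AE x in \<mu>. \<bar>fst (U x)\<bar> \<le> m"
    using U by (auto simp: minimizer_def feasible_def)
  have le: "?N \<le> ennreal m"
    using Linf_norm_le_iff[OF sq_int_measurable[OF H0_comp(1)[OF UH]] m(1)] m(2) by simp
  then have N: "?N = ennreal (enn2real ?N)"
    by (metis ennreal_enn2real ennreal_less_top le_less_trans)
  then have "feasible U (enn2real ?N)" by (intro feasible_Linf UH) auto
  then have "bounded_J1 U m \<le> bounded_J1 U (enn2real ?N)" using U by (simp add: minimizer_def)
  then have "m\<^sup>2 \<le> (enn2real ?N)\<^sup>2" by (simp add: bounded_J1_def)
  then have "m \<le> enn2real ?N" by (rule power2_le_imp_le) simp
  then have "ennreal m \<le> ?N" by (subst N) (rule ennreal_leI)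
  with le show ?thesis by simp
qed

lemma weak_grad_integral:
  assumes U: "U \<in> H0 \<Omega>"
  shows "integrable \<mu> (\<lambda>x. (norm (weak_grad \<Omega> (\<lambda>x. fst (U x)) x))\<^sup>2)"
    "(LINT x|\<mu>. (norm (weak_grad \<Omega> (\<lambda>x. fst (U x)) x))\<^sup>2) = ip \<mu> (\<lambda>x. snd (U x)) (\<lambda>x. snd (U x))"
proof -
  note s = H0_comp[OF U]
  note w = weak_grad_eq[OF \<Omega> H0_weak_gradient[OF \<Omega>(1) U] s(2)]
  show "integrable \<mu> (\<lambda>x. (norm (weak_grad \<Omega> (\<lambda>x. fst (U x)) x))\<^sup>2)"
    by (rule sq_int_integrable[OF w(1)])
  have "nrm \<mu> (weak_grad \<Omega> (\<lambda>x. fst (U x))) = nrm \<mu> (\<lambda>x. snd (U x))"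
    by (rule nrm_cong_AE[OF sq_int_measurable[OF w(1)] sq_int_measurable[OF s(2)] w(2)])
  then show "(LINT x|\<mu>. (norm (weak_grad \<Omega> (\<lambda>x. fst (U x)) x))\<^sup>2) = ip \<mu> (\<lambda>x. snd (U x)) (\<lambda>x. snd (U x))"
    by (metis nrm_sq nrm_sq_integral)
qed

text \<open>
  The part of the energy that is independent of the potential.
\<close>

definition free_energy :: "('a \<Rightarrow> real \<times> 'a) \<Rightarrow> real" where
  "free_energy U = ip \<mu> (\<lambda>x. snd (U x)) (\<lambda>x. snd (U x)) / 2 - ip \<mu> f (\<lambda>x. fst (U x))"

lemma bounded_J1_eq: "bounded_J1 U m = free_energy U + m\<^sup>2 / 2"
  by (simp add: bounded_J1_def free_energy_def)

lemma energy_functional_H0: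
  assumes U: "U \<in> H0 \<Omega>"
  shows "energy_functional \<Omega> f W (\<lambda>x. fst (U x)) =
    ereal (free_energy U) + enn2ereal (\<integral>\<^sup>+x. W x * ennreal ((fst (U x))\<^sup>2) / 2 \<partial>\<mu>)"
proof -
  have "(LINT x|\<mu>. (norm (weak_grad \<Omega> (\<lambda>x. fst (U x)) x))\<^sup>2 / 2 - f x * fst (U x)) = free_energy U"
    using weak_grad_integral[OF U] integrable_mult_sq[OF f H0_comp(1)[OF U]]
    by (simp add: free_energy_def ip_def[of _ f])
  then show ?thesis by (simp add: energy_functional_def)
qed

lemma J1_finite:
  assumes U: "U \<in> H0 \<Omega>" and n: "Linf_norm \<Omega> (\<lambda>x. fst (U x)) = ennreal n" "0 \<le> n"
  shows "J1 \<Omega> f (\<lambda>x. fst (U x)) = ereal (bounded_J1 U n)"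
proof -
  have "(ennreal n)\<^sup>2 / 2 = ennreal (n\<^sup>2 / 2)"
    using n(2) by (simp add: ennreal_power ennreal_divide_numeral)
  then have "J1 \<Omega> f (\<lambda>x. fst (U x)) = ereal (1 / 2 * ip \<mu> (\<lambda>x. snd (U x)) (\<lambda>x. snd (U x))) + ereal (n\<^sup>2 / 2) - ereal (ip \<mu> f (\<lambda>x. fst (U x)))"
    unfolding J1_def weak_grad_integral(2)[OF U] n(1) by (simp add: enn2ereal_ennreal ip_def[of _ f] mult.commute)
  then show ?thesis by (simp add: bounded_J1_def)
qed

lemma J1_infinite:
  assumes "Linf_norm \<Omega> u = \<infinity>" shows "J1 \<Omega> f u = \<infinity>"
  using assms by (simp add: J1_def power2_eq_square ennreal_top_divide ennreal_mult_top)

lemma H10_cases: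
  assumes v: "v \<in> H10 \<Omega>"
  obtains V where "V \<in> H0 \<Omega>" "v = (\<lambda>x. fst (V x))"
  using that[of "\<lambda>x. (v x, weak_grad \<Omega> v x)"] H10_imp_H0[OF \<Omega> v] by simp

lemma J1_minimizer:
  assumes U: "minimizer U m"
  shows "is_arg_min (J1 \<Omega> f) (\<lambda>u. u \<in> H10 \<Omega>) (\<lambda>x. fst (U x))"
    "is_arg_min (J1 \<Omega> f) (\<lambda>u. u \<in> H10 \<Omega>) w \<Longrightarrow> AE x in \<mu>. w x = fst (U x)"
proof -
  have UH: "U \<in> H0 \<Omega>" and m: "0 \<le> m" using U by (auto simp: minimizer_def feasible_def)
  have JU: "J1 \<Omega> f (\<lambda>x. fst (U x)) = ereal (bounded_J1 U m)"
    by (rule J1_finite[OF UH minimizer_Linf[OF U] m])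
  have "\<not> J1 \<Omega> f v < J1 \<Omega> f (\<lambda>x. fst (U x))" if vH: "v \<in> H10 \<Omega>" for v
  proof -
    obtain V where V: "V \<in> H0 \<Omega>" "v = (\<lambda>x. fst (V x))" by (rule H10_cases[OF vH])
    show ?thesis
    proof (cases "Linf_norm \<Omega> v")
      case (real n)
      then have n: "Linf_norm \<Omega> (\<lambda>x. fst (V x)) = ennreal n" "0 \<le> n" using V(2) by auto
      then have "feasible V n" by (intro feasible_Linf V) auto
      then have "bounded_J1 U m \<le> bounded_J1 V n" using U by (simp add: minimizer_def)
      then show ?thesis using J1_finite[OF V(1) n] JU V(2) by simp
    next
      case top
      then show ?thesis using J1_infinite[of v] by simp
    qed
  qed
  then show min: "is_arg_min (J1 \<Omega> f) (\<lambda>u. u \<in> H10 \<Omega>) (\<lambda>x. fst (U x))"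
    using H0_imp_H10(1)[OF \<Omega> UH] by (auto simp: is_arg_min_def)
  assume w: "is_arg_min (J1 \<Omega> f) (\<lambda>u. u \<in> H10 \<Omega>) w"
  then have wH: "w \<in> H10 \<Omega>" and le: "J1 \<Omega> f w \<le> ereal (bounded_J1 U m)"
    using H0_imp_H10(1)[OF \<Omega> UH] JU by (auto simp: is_arg_min_def not_less)
  obtain V where V: "V \<in> H0 \<Omega>" "w = (\<lambda>x. fst (V x))" by (rule H10_cases[OF wH])
  show "AE x in \<mu>. w x = fst (U x)"
  proof (cases "Linf_norm \<Omega> w")
    case (real n)
    then have n: "Linf_norm \<Omega> (\<lambda>x. fst (V x)) = ennreal n" "0 \<le> n" using V(2) by auto
    then have "feasible V n" by (intro feasible_Linf V) auto
    moreover have "bounded_J1 V n \<le> bounded_J1 U m" using J1_finite[OF V(1) n] V(2) le by simp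
    ultimately have "AE x in \<mu>. fst (V x) = fst (U x)"
      using U by (intro minimizer_unique[of U m V n]) (auto simp: minimizer_def)
    then show ?thesis using V(2) by simp
  next
    case top
    then show ?thesis using J1_infinite[of w] le by simp
  qed
qed

lemma energy_term_real:
  assumes w: "AE x in \<mu>. W x = ennreal (w x)" "AE x in \<mu>. 0 \<le> w x" and int: "integrable \<mu> (\<lambda>x. w x * (v x)\<^sup>2)"
  shows "(\<integral>\<^sup>+x. W x * ennreal ((v x)\<^sup>2) / 2 \<partial>\<mu>) = ennreal ((LINT x|\<mu>. w x * (v x)\<^sup>2) / 2)"
    "0 \<le> (LINT x|\<mu>. w x * (v x)\<^sup>2)"
proof -
  have "(\<integral>\<^sup>+x. W x * ennreal ((v x)\<^sup>2) / 2 \<partial>\<mu>) = (\<integral>\<^sup>+x. ennreal (w x * (v x)\<^sup>2 / 2) \<partial>\<mu>)"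
    using w by (intro nn_integral_cong_AE, eventually_elim)
      (simp add: ennreal_mult'[symmetric] ennreal_divide_numeral)
  also have "\<dots> = ennreal (LINT x|\<mu>. w x * (v x)\<^sup>2 / 2)"
    using w(2) int by (intro nn_integral_eq_integral) (auto elim!: eventually_mono)
  finally show "(\<integral>\<^sup>+x. W x * ennreal ((v x)\<^sup>2) / 2 \<partial>\<mu>) = ennreal ((LINT x|\<mu>. w x * (v x)\<^sup>2) / 2)" by simp
  show "0 \<le> (LINT x|\<mu>. w x * (v x)\<^sup>2)"
    using w(2) by (intro integral_nonneg_AE) (auto elim!: eventually_mono)
qed

lemma energy_functional_real:
  assumes "V \<in> H0 \<Omega>" and w: "AE x in \<mu>. W x = ennreal (w x)" "AE x in \<mu>. 0 \<le> w x"
    and int: "integrable \<mu> (\<lambda>x. w x * (fst (V x))\<^sup>2)"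
  shows "energy_functional \<Omega> f W (\<lambda>x. fst (V x)) = ereal (free_energy V + (LINT x|\<mu>. w x * (fst (V x))\<^sup>2) / 2)"
  using energy_term_real[OF w int] by (simp add: energy_functional_H0[OF assms(1)] enn2ereal_ennreal)

lemma energy_term_bound:
  assumes W: "admissible \<Omega> W" and m: "AE x in \<mu>. \<bar>v x\<bar> \<le> m"
  shows "(\<integral>\<^sup>+x. W x * ennreal ((v x)\<^sup>2) / 2 \<partial>\<mu>) \<le> ennreal (m\<^sup>2 / 2)"
proof -
  have [measurable]: "W \<in> borel_measurable \<mu>" using W by (simp add: admissible_def)
  have "(\<integral>\<^sup>+x. W x * ennreal ((v x)\<^sup>2) / 2 \<partial>\<mu>) \<le> (\<integral>\<^sup>+x. W x * ennreal (m\<^sup>2 / 2) \<partial>\<mu>)"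
  proof (rule nn_integral_mono_AE, use m in eventually_elim)
    case (elim x)
    then have "(v x)\<^sup>2 \<le> m\<^sup>2" by (metis abs_ge_zero power2_abs power_mono)
    then have "W x * ennreal ((v x)\<^sup>2 / 2) \<le> W x * ennreal (m\<^sup>2 / 2)"
      by (intro mult_left_mono ennreal_leI) auto
    then show ?case by (simp add: ennreal_divide_numeral[symmetric] ennreal_times_divide)
  qed
  also have "\<dots> = (\<integral>\<^sup>+x. W x \<partial>\<mu>) * ennreal (m\<^sup>2 / 2)" by (rule nn_integral_multc) measurable
  also have "\<dots> \<le> 1 * ennreal (m\<^sup>2 / 2)" using W by (intro mult_right_mono) (auto simp: admissible_def)
  finally show ?thesis by simp
qed

text \<open>
  The easy half of the duality: \<open>\<integral>W u\<^sup>2 \<le> m\<^sup>2\<close> for every admissible \<open>W\<close>.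
\<close>

lemma energy_le:
  assumes U: "minimizer U m" and W: "admissible \<Omega> W"
  shows "energy_functional \<Omega> f W (\<lambda>x. fst (U x)) \<le> ereal (bounded_J1 U m)" "energy \<Omega> f W \<le> energy_functional \<Omega> f W (\<lambda>x. fst (U x))"
proof -
  have UH: "U \<in> H0 \<Omega>" and m: "AE x in \<mu>. \<bar>fst (U x)\<bar> \<le> m" using U by (auto simp: minimizer_def feasible_def)
  have "enn2ereal (\<integral>\<^sup>+x. W x * ennreal ((fst (U x))\<^sup>2) / 2 \<partial>\<mu>) \<le> enn2ereal (ennreal (m\<^sup>2 / 2))"
    using energy_term_bound[OF W m] by (simp add: less_eq_ennreal.rep_eq)
  also have "\<dots> = ereal (m\<^sup>2 / 2)" by (simp add: enn2ereal_ennreal)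
  finally show "energy_functional \<Omega> f W (\<lambda>x. fst (U x)) \<le> ereal (bounded_J1 U m)"
    unfolding energy_functional_H0[OF UH] bounded_J1_eq plus_ereal.simps(1)[symmetric] by (rule add_left_mono)
  show "energy \<Omega> f W \<le> energy_functional \<Omega> f W (\<lambda>x. fst (U x))"
    unfolding energy_def by (rule INF_lower) (rule H0_imp_H10[OF \<Omega> UH])
qed

text \<open>
  The hypotheses say that \<open>-\<Delta>u + V u = f\<close> and that \<open>V\<close> lives on the contact set \<open>{\<bar>u\<bar> = m}\<close>. Testing with \<open>u\<close>
  and comparing with the scaling identity gives \<open>V\<close> total mass one; by convexity, \<open>u\<close> minimizes the
  energy of \<open>V\<close>, so the upper bound is attained.

  For another optimal \<open>W\<close> the chain of inequalities
  is an equality throughout: \<open>\<integral>W (m\<^sup>2 - u\<^sup>2) = 0\<close> confines \<open>W\<close> to the contact set, and \<open>u\<close> minimizes the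
  energy of \<open>W\<close> too, so \<open>W u = f + \<Delta>u = V u\<close>.
\<close>

lemma optimal_potential:
  assumes U: "minimizer U m" and m: "0 < m"
    and V: "AE x in \<mu>. 0 \<le> V x" "V \<in> borel_measurable \<mu>"
    and g: "sq_int \<mu> g" "\<And>W. W \<in> H0 \<Omega> \<Longrightarrow> ip \<mu> (\<lambda>x. snd (U x)) (\<lambda>x. snd (W x)) = ip \<mu> g (\<lambda>x. fst (W x))"
    and Vu: "AE x in \<mu>. V x * fst (U x) = f x - g x" "AE x in \<mu>. V x * (m\<^sup>2 - (fst (U x))\<^sup>2) = 0"
  shows "integrable \<mu> V" "(LINT x|\<mu>. V x) = 1"
    "is_arg_min (\<lambda>V. - energy \<Omega> f V) (admissible \<Omega>) (\<lambda>x. ennreal (V x))"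
    "is_arg_min (\<lambda>V. - energy \<Omega> f V) (admissible \<Omega>) W \<Longrightarrow> AE x in \<mu>. W x = ennreal (V x)"
proof -
  have UH: "U \<in> H0 \<Omega>" and Um: "AE x in \<mu>. \<bar>fst (U x)\<bar> \<le> m" using U by (auto simp: minimizer_def feasible_def)
  define u where "u x = fst (U x)" for x
  have su: "sq_int \<mu> u" using H0_comp[OF UH] by (simp add: u_def[abs_def])
  have sfg: "sq_int \<mu> (\<lambda>x. f x - g x)" using f g by auto
  have [measurable]: "V \<in> borel_measurable \<mu>" "u \<in> borel_measurable \<mu>" "f \<in> borel_measurable \<mu>" "g \<in> borel_measurable \<mu>"
    using V su f g by (auto intro: sq_int_measurable)
  have Vm: "AE x in \<mu>. V x * (u x)\<^sup>2 = (f x - g x) * u x" "AE x in \<mu>. m\<^sup>2 * V x = (f x - g x) * u x"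
  proof -
    show "AE x in \<mu>. V x * (u x)\<^sup>2 = (f x - g x) * u x"
      using Vu(1) by eventually_elim (simp add: u_def power2_eq_square)
    then show "AE x in \<mu>. m\<^sup>2 * V x = (f x - g x) * u x"
      using Vu(2) by eventually_elim (auto simp: u_def mult.commute)
  qed
  have int_fgu: "integrable \<mu> (\<lambda>x. (f x - g x) * u x)" by (rule integrable_mult_sq[OF sfg su])
  have "integrable \<mu> (\<lambda>x. m\<^sup>2 * V x)"
    using int_fgu integrable_cong_AE[OF _ _ Vm(2)] by simp
  then show intV: "integrable \<mu> V" using m by simp
  have int_Vu2: "integrable \<mu> (\<lambda>x. V x * (u x)\<^sup>2)"
    using int_fgu integrable_cong_AE[OF _ _ Vm(1)] by simp
  have fgu: "(LINT x|\<mu>. (f x - g x) * u x) = m\<^sup>2"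
  proof -
    have "(LINT x|\<mu>. (f x - g x) * u x) = ip \<mu> f u - ip \<mu> g u"
      using ip_diff_left[OF f g(1) su] by (simp add: ip_def)
    also have "ip \<mu> g u = ip \<mu> (\<lambda>x. snd (U x)) (\<lambda>x. snd (U x))" using g(2)[OF UH] by (simp add: u_def[abs_def])
    also have "ip \<mu> f u = \<dots> + m\<^sup>2" using scaling_identity[OF U] by (simp add: u_def[abs_def])
    finally show ?thesis by simp
  qed
  have "m\<^sup>2 * (LINT x|\<mu>. V x) = (LINT x|\<mu>. (f x - g x) * u x)"
    using integral_cong_AE[OF _ _ Vm(2)] by simp
  then show total: "(LINT x|\<mu>. V x) = 1" using fgu m by simp
  have Vu2: "(LINT x|\<mu>. V x * (u x)\<^sup>2) = m\<^sup>2"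
    using integral_cong_AE[OF _ _ Vm(1)] fgu by simp
  have QU: "bounded_J1 U m = - (ip \<mu> (\<lambda>x. snd (U x)) (\<lambda>x. snd (U x)) + m\<^sup>2) / 2"
    using scaling_identity[OF U] by (simp add: bounded_J1_def field_simps)
  have adm: "admissible \<Omega> (\<lambda>x. ennreal (V x))"
    unfolding admissible_def using nn_integral_eq_integral[OF intV V(1)] total by simp
  have lower: "ereal (bounded_J1 U m) \<le> energy_functional \<Omega> f (\<lambda>x. ennreal (V x)) v" if vH: "v \<in> H10 \<Omega>" for v
  proof -
    obtain Z where Z: "Z \<in> H0 \<Omega>" "v = (\<lambda>x. fst (Z x))" by (rule H10_cases[OF vH])
    note sZ = H0_comp[OF Z(1)]
    have sv: "sq_int \<mu> v" using sZ Z(2) by simp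
    have [measurable]: "v \<in> borel_measurable \<mu>" using sv by (rule sq_int_measurable)
    show ?thesis
    proof (cases "integrable \<mu> (\<lambda>x. V x * (v x)\<^sup>2)")
      case True
      \<comment> \<open>The square \<open>V (v - u)\<^sup>2\<close> is nonnegative, and \<open>V u = f - g\<close>.\<close>
      have "(LINT x|\<mu>. 2 * ((f x - g x) * v x) - V x * (u x)\<^sup>2) \<le> (LINT x|\<mu>. V x * (v x)\<^sup>2)"
      proof (rule integral_mono_AE)
        show "integrable \<mu> (\<lambda>x. 2 * ((f x - g x) * v x) - V x * (u x)\<^sup>2)"
          using integrable_mult_sq[OF sfg sv] int_Vu2 by auto
        show "AE x in \<mu>. 2 * ((f x - g x) * v x) - V x * (u x)\<^sup>2 \<le> V x * (v x)\<^sup>2"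
          using Vu(1) V(1)
        proof eventually_elim
          case (elim x)
          have "0 \<le> V x * (v x - u x)\<^sup>2" using elim(2) by simp
          then have "2 * ((V x * u x) * v x) - V x * (u x)\<^sup>2 \<le> V x * (v x)\<^sup>2"
            by (simp add: power2_eq_square algebra_simps)
          then show ?case using elim(1) by (simp add: u_def)
        qed
      qed (rule True)
      moreover have "(LINT x|\<mu>. 2 * ((f x - g x) * v x) - V x * (u x)\<^sup>2) = 2 * (ip \<mu> f v - ip \<mu> g v) - m\<^sup>2"
        using integrable_mult_sq[OF sfg sv] int_Vu2 Vu2 ip_diff_left[OF f g(1) sv] by (simp add: ip_def)
      ultimately have 1: "ip \<mu> f v - ip \<mu> g v - m\<^sup>2 / 2 \<le> (LINT x|\<mu>. V x * (v x)\<^sup>2) / 2" by simp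
      have "0 \<le> ip \<mu> (\<lambda>x. snd (Z x) - snd (U x)) (\<lambda>x. snd (Z x) - snd (U x))" by simp
      also have "\<dots> = ip \<mu> (\<lambda>x. snd (Z x)) (\<lambda>x. snd (Z x)) - 2 * ip \<mu> (\<lambda>x. snd (Z x)) (\<lambda>x. snd (U x)) + ip \<mu> (\<lambda>x. snd (U x)) (\<lambda>x. snd (U x))"
        by (rule ip_diff_self[OF sZ(2) H0_comp(2)[OF UH]])
      also have "ip \<mu> (\<lambda>x. snd (Z x)) (\<lambda>x. snd (U x)) = ip \<mu> g v"
        using g(2)[OF Z(1)] Z(2) by (simp add: ip_commute)
      finally have "bounded_J1 U m \<le> free_energy Z + (LINT x|\<mu>. V x * (v x)\<^sup>2) / 2"
        using 1 unfolding QU free_energy_def Z(2) by (simp add: field_simps)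
      moreover have "energy_functional \<Omega> f (\<lambda>x. ennreal (V x)) v = ereal (free_energy Z + (LINT x|\<mu>. V x * (v x)\<^sup>2) / 2)"
        using energy_functional_real[OF Z(1) _ V(1)] True Z(2) by simp
      ultimately show ?thesis by simp
    next
      case False
      have "(\<integral>\<^sup>+x. ennreal (V x) * ennreal ((v x)\<^sup>2) / 2 \<partial>\<mu>) = \<infinity>"
      proof (rule ccontr)
        assume fin: "(\<integral>\<^sup>+x. ennreal (V x) * ennreal ((v x)\<^sup>2) / 2 \<partial>\<mu>) \<noteq> \<infinity>"
        have "(\<integral>\<^sup>+x. ennreal (V x) * ennreal ((v x)\<^sup>2) / 2 \<partial>\<mu>) = (\<integral>\<^sup>+x. ennreal (V x * (v x)\<^sup>2 / 2) \<partial>\<mu>)"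
          using V(1) by (intro nn_integral_cong_AE, eventually_elim)
            (simp add: ennreal_mult'[symmetric] ennreal_divide_numeral)
        with fin have "(\<integral>\<^sup>+x. ennreal (V x * (v x)\<^sup>2 / 2) \<partial>\<mu>) < \<infinity>" by (simp add: less_top)
        then have "integrable \<mu> (\<lambda>x. V x * (v x)\<^sup>2 / 2)"
          using V(1) by (intro integrableI_nonneg) (auto elim!: eventually_mono)
        then have "integrable \<mu> (\<lambda>x. 2 * (V x * (v x)\<^sup>2 / 2))" by (rule integrable_mult_right)
        with False show False by simp
      qed
      then show ?thesis using energy_functional_H0[OF Z(1), of "\<lambda>x. ennreal (V x)"] Z(2) by simp
    qed
  qed
  have low: "ereal (bounded_J1 U m) \<le> energy \<Omega> f (\<lambda>x. ennreal (V x))"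
    unfolding energy_def by (rule INF_greatest) (rule lower)
  have up: "energy \<Omega> f Y \<le> ereal (bounded_J1 U m)" if "admissible \<Omega> Y" for Y
    using energy_le[OF U that] by (rule order_trans[rotated])
  show "is_arg_min (\<lambda>V. - energy \<Omega> f V) (admissible \<Omega>) (\<lambda>x. ennreal (V x))"
    unfolding is_arg_min_def
  proof (intro conjI adm notI)
    assume "\<exists>Y. admissible \<Omega> Y \<and> - energy \<Omega> f Y < - energy \<Omega> f (\<lambda>x. ennreal (V x))"
    then obtain Y where Y: "admissible \<Omega> Y" "energy \<Omega> f (\<lambda>x. ennreal (V x)) < energy \<Omega> f Y" by auto
    with low up[OF Y(1)] show False by (meson leD order_trans)
  qed
  assume W: "is_arg_min (\<lambda>V. - energy \<Omega> f V) (admissible \<Omega>) W"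
  then have Wad: "admissible \<Omega> W" by (simp add: is_arg_min_def)
  have "\<not> - energy \<Omega> f (\<lambda>x. ennreal (V x)) < - energy \<Omega> f W" using W adm by (auto simp: is_arg_min_def)
  then have "energy \<Omega> f (\<lambda>x. ennreal (V x)) \<le> energy \<Omega> f W" by simp
  with low have Wlow: "ereal (bounded_J1 U m) \<le> energy \<Omega> f W" by (rule order_trans)
  have [measurable]: "W \<in> borel_measurable \<mu>" using Wad by (simp add: admissible_def)
  have W1: "(\<integral>\<^sup>+x. W x \<partial>\<mu>) \<le> 1" using Wad by (simp add: admissible_def)
  then have "(\<integral>\<^sup>+x. W x \<partial>\<mu>) \<noteq> \<infinity>" by (auto simp: top_unique)
  then have Wfin: "AE x in \<mu>. W x \<noteq> \<infinity>" by (intro nn_integral_noteq_infinite) auto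
  \<comment> \<open>A potential of finite mass is finite almost everywhere, so a real-valued version of \<open>W\<close> suffices.\<close>
  define w where "w x = enn2real (W x)" for x
  have wm [measurable]: "w \<in> borel_measurable \<mu>" unfolding w_def by measurable
  have Ww: "AE x in \<mu>. W x = ennreal (w x)"
    using Wfin by eventually_elim (simp add: w_def less_top)
  have w0: "0 \<le> w x" for x by (simp add: w_def)
  have nnw: "(\<integral>\<^sup>+x. ennreal (w x) \<partial>\<mu>) \<le> 1"
    using W1 nn_integral_cong_AE[OF Ww] by simp
  have intw: "integrable \<mu> w"
    using le_less_trans[OF nnw] by (intro integrableI_nonneg) (auto simp: w0)
  have "ennreal (LINT x|\<mu>. w x) \<le> ennreal 1"
    using nnw nn_integral_eq_integral[OF intw] w0 by simp
  then have w1: "(LINT x|\<mu>. w x) \<le> 1" by (subst (asm) ennreal_le_iff) auto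
  have bounded_int: "integrable \<mu> (\<lambda>x. w x * p x)"
    if [measurable]: "p \<in> borel_measurable \<mu>" and B: "AE x in \<mu>. \<bar>p x\<bar> \<le> B" for p B
  proof (rule Bochner_Integration.integrable_bound[OF integrable_mult_left[OF intw, of B]])
    show "AE x in \<mu>. norm (w x * p x) \<le> norm (w x * B)"
      using B by eventually_elim (auto simp: abs_mult w0 intro!: mult_left_mono)
  qed measurable
  have Umu: "AE x in \<mu>. \<bar>u x\<bar> \<le> m" using Um by (simp add: u_def)
  have u2: "AE x in \<mu>. (u x)\<^sup>2 \<le> m\<^sup>2"
    using Umu by eventually_elim (metis abs_ge_zero power2_abs power_mono)
  have int_wu2: "integrable \<mu> (\<lambda>x. w x * (u x)\<^sup>2)"
    by (rule bounded_int[where B="m\<^sup>2"]) (use u2 in auto)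
  have wfun: "ereal (bounded_J1 U m) \<le> ereal (free_energy Y + (LINT x|\<mu>. w x * (fst (Y x))\<^sup>2) / 2)"
    if Y: "Y \<in> H0 \<Omega>" "integrable \<mu> (\<lambda>x. w x * (fst (Y x))\<^sup>2)" for Y
  proof -
    have "energy \<Omega> f W \<le> energy_functional \<Omega> f W (\<lambda>x. fst (Y x))"
      unfolding energy_def by (rule INF_lower) (rule H0_imp_H10[OF \<Omega> Y(1)])
    also have "\<dots> = ereal (free_energy Y + (LINT x|\<mu>. w x * (fst (Y x))\<^sup>2) / 2)"
      by (rule energy_functional_real[OF Y(1) Ww _ Y(2)]) (simp add: w0)
    finally show ?thesis using Wlow order_trans by blast
  qed
  have wu2: "m\<^sup>2 \<le> (LINT x|\<mu>. w x * (u x)\<^sup>2)"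
    using wfun[OF UH] int_wu2 by (simp add: bounded_J1_eq u_def)
  have int_d: "integrable \<mu> (\<lambda>x. w x * m\<^sup>2 - w x * (u x)\<^sup>2)"
    using intw int_wu2 by auto
  have nn_d: "AE x in \<mu>. 0 \<le> w x * m\<^sup>2 - w x * (u x)\<^sup>2"
    using u2 by eventually_elim (simp add: mult_left_mono w0)
  have d0: "(LINT x|\<mu>. w x * m\<^sup>2 - w x * (u x)\<^sup>2) \<le> 0"
    using intw int_wu2 wu2 mult_right_mono[OF w1, of "m\<^sup>2"] by simp
  have "(LINT x|\<mu>. w x * m\<^sup>2 - w x * (u x)\<^sup>2) = 0"
    using d0 integral_nonneg_AE[OF nn_d] by simp
  then have conc: "AE x in \<mu>. w x * m\<^sup>2 - w x * (u x)\<^sup>2 = 0"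
    using integral_nonneg_eq_0_iff_AE[OF int_d nn_d] by simp
  have wu2eq: "(LINT x|\<mu>. w x * (u x)\<^sup>2) = m\<^sup>2"
  proof -
    have "(LINT x|\<mu>. w x * (u x)\<^sup>2) \<le> (LINT x|\<mu>. w x) * m\<^sup>2" using nn_d integral_nonneg_AE[OF nn_d] intw int_wu2 by simp
    also have "\<dots> \<le> 1 * m\<^sup>2" by (intro mult_right_mono w1) simp
    finally show ?thesis using wu2 by simp
  qed
  have int_wu: "integrable \<mu> (\<lambda>x. w x * u x)" by (rule bounded_int[where B=m]) (use Umu in auto)
  have "AE x in \<mu>. w x * u x - (f x - g x) = 0"
  proof (rule AE_zero_if_test_zero[OF \<Omega>(1)])
    have fgi: "integrable \<mu> (\<lambda>x. f x - g x)" using integrable_mult_sq[OF sfg sq_int_one] by simp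
    show "integrable \<mu> (\<lambda>x. w x * u x - (f x - g x))" using int_wu fgi by auto
    fix \<phi> assume \<phi>: "\<phi> \<in> test_functions \<Omega>"
    obtain B where B: "0 < B" "\<And>x. \<bar>\<phi> x\<bar> \<le> B" using test_bounded[OF \<phi>] by blast
    have s\<phi>: "sq_int \<mu> \<phi>" "sq_int \<mu> (grad \<phi>)" using \<phi> \<Omega> by auto
    have [measurable]: "\<phi> \<in> borel_measurable \<mu>" using s\<phi> by (auto intro: sq_int_measurable)
    have i1: "integrable \<mu> (\<lambda>x. w x * (u x * \<phi> x))"
    proof (rule bounded_int)
      show "AE x in \<mu>. \<bar>u x * \<phi> x\<bar> \<le> m * B"
        using Umu by eventually_elim (use B m in \<open>auto simp: abs_mult intro!: mult_mono\<close>)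
    qed measurable
    have i2: "integrable \<mu> (\<lambda>x. w x * (\<phi> x)\<^sup>2)"
    proof (rule bounded_int)
      show "AE x in \<mu>. \<bar>(\<phi> x)\<^sup>2\<bar> \<le> B\<^sup>2"
        using B(2) by (auto intro!: AE_I2) (metis abs_ge_zero power2_abs power_mono)
    qed measurable
    \<comment> \<open>The energy of \<open>W\<close> at \<open>u + t \<phi>\<close> is a quadratic polynomial in \<open>t\<close> with linear coefficient \<open>K\<close>.\<close>
    define K where "K = ip \<mu> g \<phi> - ip \<mu> f \<phi> + (LINT x|\<mu>. w x * (u x * \<phi> x))"
    have "0 \<le> 0 + 2 * t * (K / 2) + t\<^sup>2 * ((ip \<mu> (grad \<phi>) (grad \<phi>) + (LINT x|\<mu>. w x * (\<phi> x)\<^sup>2)) / 2)" for t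
    proof -
      let ?Y = "\<lambda>x. 1 *\<^sub>R U x + t *\<^sub>R jet \<phi> x"
      have Y: "?Y \<in> H0 \<Omega>" by (rule H0_comb[OF \<Omega>(1) UH jet_in_H0[OF \<phi> \<Omega>(1)]])
      have sq: "w x * (fst (?Y x))\<^sup>2 = w x * (u x)\<^sup>2 + 2 * t * (w x * (u x * \<phi> x)) + t\<^sup>2 * (w x * (\<phi> x)\<^sup>2)" for x
        by (simp add: u_def power2_eq_square algebra_simps)
      have iY: "integrable \<mu> (\<lambda>x. w x * (fst (?Y x))\<^sup>2)"
        unfolding sq using i1 i2 int_wu2 by auto
      have LY: "(LINT x|\<mu>. w x * (fst (?Y x))\<^sup>2) = m\<^sup>2 + 2 * t * (LINT x|\<mu>. w x * (u x * \<phi> x)) + t\<^sup>2 * (LINT x|\<mu>. w x * (\<phi> x)\<^sup>2)"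
        unfolding sq using i1 i2 int_wu2 wu2eq by simp
      have EY: "free_energy ?Y = free_energy U + t * (ip \<mu> g \<phi> - ip \<mu> f \<phi>) + t\<^sup>2 / 2 * ip \<mu> (grad \<phi>) (grad \<phi>)"
      proof -
        have "ip \<mu> (\<lambda>x. snd (?Y x)) (\<lambda>x. snd (?Y x)) = ip \<mu> (\<lambda>x. snd (U x)) (\<lambda>x. snd (U x))
            + 2 * t * ip \<mu> (\<lambda>x. snd (U x)) (grad \<phi>) + t\<^sup>2 * ip \<mu> (grad \<phi>) (grad \<phi>)"
          using ip_add_self[OF H0_comp(2)[OF UH] s\<phi>(2), of t] by simp
        moreover have "ip \<mu> (\<lambda>x. snd (U x)) (grad \<phi>) = ip \<mu> g \<phi>"
          using g(2)[OF jet_in_H0[OF \<phi> \<Omega>(1)]] by simp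
        moreover have "ip \<mu> f (\<lambda>x. fst (?Y x)) = ip \<mu> f (\<lambda>x. fst (U x)) + t * ip \<mu> f \<phi>"
          using ip_add_right[OF H0_comp(1)[OF UH] sq_int_cmult[OF s\<phi>(1)] f, of t] by simp
        ultimately show ?thesis by (simp add: free_energy_def field_simps)
      qed
      show ?thesis
        using wfun[OF Y iY] unfolding LY EY bounded_J1_eq K_def by (simp add: field_simps)
    qed
    then have "(K / 2)\<^sup>2 \<le> 0 * ((ip \<mu> (grad \<phi>) (grad \<phi>) + (LINT x|\<mu>. w x * (\<phi> x)\<^sup>2)) / 2)"
    proof (rule quadratic_nonneg_discriminant)
      show "0 \<le> (ip \<mu> (grad \<phi>) (grad \<phi>) + (LINT x|\<mu>. w x * (\<phi> x)\<^sup>2)) / 2"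
        using Bochner_Integration.integral_nonneg[of \<mu> "\<lambda>x. w x * (\<phi> x)\<^sup>2"] w0 by simp
    qed simp
    then have "K = 0" by simp
    moreover have "(LINT x|\<mu>. (w x * u x - (f x - g x)) * \<phi> x) = (LINT x|\<mu>. w x * (u x * \<phi> x)) - ip \<mu> (\<lambda>x. f x - g x) \<phi>"
    proof -
      have "(w x * u x - (f x - g x)) * \<phi> x = w x * (u x * \<phi> x) - (f x - g x) * \<phi> x" for x
        by (simp add: algebra_simps)
      then show ?thesis using i1 integrable_mult_sq[OF sfg s\<phi>(1)] by (simp add: ip_def)
    qed
    ultimately show "(LINT x|\<mu>. (w x * u x - (f x - g x)) * \<phi> x) = 0"
      using ip_diff_left[OF f g(1) s\<phi>(1)] by (simp add: K_def)
  qed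
  then show "AE x in \<mu>. W x = ennreal (V x)"
    using Ww conc Vu
  proof eventually_elim
    case (elim x)
    have "w x = V x"
    proof (cases "(u x)\<^sup>2 = m\<^sup>2")
      case True
      then have "u x \<noteq> 0" using m by auto
      moreover have "w x * u x = V x * u x" using elim(1,4) by (simp add: u_def)
      ultimately show ?thesis by simp
    next
      case False
      have "w x * (m\<^sup>2 - (u x)\<^sup>2) = 0" using elim(3) by (simp add: right_diff_distrib)
      moreover have "V x * (m\<^sup>2 - (u x)\<^sup>2) = 0" using elim(5) by (simp add: u_def)
      ultimately show ?thesis using False by simp
    qed
    with elim(2) show ?case by simp
  qed
qed

end

theorem proposition3p9:
  fixes \<Omega> :: "'a::euclidean_space set" and f :: "'a \<Rightarrow> real"
  assumes "open \<Omega>" and "bounded \<Omega>" and "f \<in> L2 \<Omega>"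
  shows "\<exists>u1.
    is_arg_min (J1 \<Omega> f) (\<lambda>u. u \<in> H10 \<Omega>) u1 \<and>
    (\<forall>w. is_arg_min (J1 \<Omega> f) (\<lambda>u. u \<in> H10 \<Omega>) w \<longrightarrow> (AE x in lebesgue_on \<Omega>. w x = u1 x)) \<and>
    u1 \<in> Linf \<Omega> \<and>
    (let M = enn2real (Linf_norm \<Omega> u1);
         \<omega>p = {x \<in> \<Omega>. u1 x = M};
         \<omega>m = {x \<in> \<Omega>. u1 x = - M};
         V1 = (\<lambda>x. 1 / M * (indicator \<omega>p x * f x - indicator \<omega>m x * f x))
     in (\<not> (AE x in lebesgue_on \<Omega>. f x = 0) \<longrightarrow>
           0 < M \<and>
           (AE x in lebesgue_on \<Omega>. 0 \<le> V1 x) \<and>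
           is_arg_min (\<lambda>V. - energy \<Omega> f V) (admissible \<Omega>) (\<lambda>x. ennreal (V1 x)) \<and>
           (\<forall>W. is_arg_min (\<lambda>V. - energy \<Omega> f V) (admissible \<Omega>) W \<longrightarrow>
                  (AE x in lebesgue_on \<Omega>. W x = ennreal (V1 x)))) \<and>
        (LINT x:\<omega>p|lebesgue_on \<Omega>. f x) - (LINT x:\<omega>m|lebesgue_on \<Omega>. f x) = M \<and>
        (AE x in lebesgue_on \<Omega>. x \<in> \<omega>p \<longrightarrow> 0 \<le> f x) \<and>
        (AE x in lebesgue_on \<Omega>. x \<in> \<omega>m \<longrightarrow> f x \<le> 0))"
proof -
  interpret source_problem \<Omega> f
    by standard (use assms in \<open>auto simp: L2_iff\<close>)
  obtain U m where "feasible U m" "\<And>V n. feasible V n \<Longrightarrow> bounded_J1 U m \<le> bounded_J1 V n"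
    by (rule exists_minimizer) (rule that)
  then have U: "minimizer U m" by (simp add: minimizer_def)
  have UH: "U \<in> H0 \<Omega>" by (rule minimizer_H0[OF U])
  have m0: "0 \<le> m" using U by (simp add: minimizer_def feasible_def)
  define u1 where "u1 x = fst (U x)" for x
  have su: "sq_int \<mu> u1" using H0_comp[OF UH] by (simp add: u1_def[abs_def])
  have [measurable]: "u1 \<in> borel_measurable \<mu>" "f \<in> borel_measurable \<mu>"
    using su f by (auto intro: sq_int_measurable)
  have norm: "Linf_norm \<Omega> u1 = ennreal m" using minimizer_Linf[OF U] by (simp add: u1_def[abs_def])
  then have M: "enn2real (Linf_norm \<Omega> u1) = m" using m0 by simp
  define \<omega>p where "\<omega>p = {x \<in> \<Omega>. u1 x = m}"
  define \<omega>m where "\<omega>m = {x \<in> \<Omega>. u1 x = - m}"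
  define V1 where "V1 x = 1 / m * (indicator \<omega>p x * f x - indicator \<omega>m x * f x)" for x
  have [measurable]: "\<omega>p \<in> sets \<mu>" "\<omega>m \<in> sets \<mu>"
  proof -
    have "{x \<in> space \<mu>. u1 x = m} \<in> sets \<mu>" "{x \<in> space \<mu>. u1 x = - m} \<in> sets \<mu>" by measurable
    then show "\<omega>p \<in> sets \<mu>" "\<omega>m \<in> sets \<mu>" by (simp_all add: \<omega>p_def \<omega>m_def)
  qed
  have min: "is_arg_min (J1 \<Omega> f) (\<lambda>u. u \<in> H10 \<Omega>) u1"
    "is_arg_min (J1 \<Omega> f) (\<lambda>u. u \<in> H10 \<Omega>) w \<Longrightarrow> AE x in \<mu>. w x = u1 x" for w
    using J1_minimizer[OF U] by (simp_all add: u1_def[abs_def])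
  have Linf: "u1 \<in> Linf \<Omega>" using norm by (simp add: Linf_def)
  have rest: "(\<not> (AE x in \<mu>. f x = 0) \<longrightarrow> 0 < m \<and> (AE x in \<mu>. 0 \<le> V1 x) \<and>
        is_arg_min (\<lambda>V. - energy \<Omega> f V) (admissible \<Omega>) (\<lambda>x. ennreal (V1 x)) \<and>
        (\<forall>W. is_arg_min (\<lambda>V. - energy \<Omega> f V) (admissible \<Omega>) W \<longrightarrow> (AE x in \<mu>. W x = ennreal (V1 x)))) \<and>
      (LINT x:\<omega>p|\<mu>. f x) - (LINT x:\<omega>m|\<mu>. f x) = m \<and>
      (AE x in \<mu>. x \<in> \<omega>p \<longrightarrow> 0 \<le> f x) \<and> (AE x in \<mu>. x \<in> \<omega>m \<longrightarrow> f x \<le> 0)"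
  \<comment> \<open>If \<open>m = 0\<close>, the two contact sets coincide and \<open>f\<close> vanishes, so that nothing is divided by \<open>m\<close>.\<close>
  proof (cases "m = 0")
    case True
    then have "AE x in \<mu>. f x = 0" using source_trivial U by simp
    moreover have "\<omega>p = \<omega>m" using True by (simp add: \<omega>p_def \<omega>m_def)
    ultimately show ?thesis using True by (auto elim!: eventually_mono)
  next
    case False
    with m0 have m: "0 < m" by simp
    obtain g where g: "sq_int \<mu> g" "\<And>V. V \<in> H0 \<Omega> \<Longrightarrow> ip \<mu> (\<lambda>x. snd (U x)) (\<lambda>x. snd (V x)) = ip \<mu> g (\<lambda>x. fst (V x))"
      and EL: "AE x in \<mu>. \<bar>fst (U x)\<bar> < m \<and> g x = f x \<or> fst (U x) = m \<and> g x = 0 \<and> 0 \<le> f x \<or> fst (U x) = - m \<and> g x = 0 \<and> f x \<le> 0"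
      by (rule Euler_Lagrange[OF U m]) (rule that)
    have all: "AE x in \<mu>. 0 \<le> V1 x \<and> V1 x * fst (U x) = f x - g x \<and> V1 x * (m\<^sup>2 - (fst (U x))\<^sup>2) = 0 \<and>
        (x \<in> \<omega>p \<longrightarrow> 0 \<le> f x) \<and> (x \<in> \<omega>m \<longrightarrow> f x \<le> 0)"
      using EL AE_space
    proof eventually_elim
      case (elim x)
      then have x: "x \<in> \<Omega>" by simp
      from elim(1) consider "\<bar>fst (U x)\<bar> < m" "g x = f x" | "fst (U x) = m" "g x = 0" "0 \<le> f x"
        | "fst (U x) = - m" "g x = 0" "f x \<le> 0" by blast
      then show ?case
      proof cases
        case 1
        then have "x \<notin> \<omega>p" "x \<notin> \<omega>m" by (auto simp: \<omega>p_def \<omega>m_def u1_def)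
        with 1 show ?thesis by (simp add: V1_def)
      next
        case 2
        then have "x \<in> \<omega>p" "x \<notin> \<omega>m" using m x by (auto simp: \<omega>p_def \<omega>m_def u1_def)
        with 2 m show ?thesis by (simp add: V1_def)
      next
        case 3
        then have "x \<notin> \<omega>p" "x \<in> \<omega>m" using m x by (auto simp: \<omega>p_def \<omega>m_def u1_def)
        with 3 m show ?thesis by (simp add: V1_def divide_nonpos_pos)
      qed
    qed
    have V1m: "V1 \<in> borel_measurable \<mu>" unfolding V1_def by measurable
    have V1: "AE x in \<mu>. 0 \<le> V1 x" "AE x in \<mu>. V1 x * fst (U x) = f x - g x"
      "AE x in \<mu>. V1 x * (m\<^sup>2 - (fst (U x))\<^sup>2) = 0"
      using all by (auto elim!: eventually_mono)
    note opt = optimal_potential[OF U m V1(1) V1m g V1(2,3)]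
    have fint: "integrable \<mu> f" using integrable_mult_sq[OF f sq_int_one] by simp
    have "set_integrable \<mu> \<omega>p f" "set_integrable \<mu> \<omega>m f"
      unfolding set_integrable_def by (rule integrable_mult_indicator[OF _ fint], measurable)+
    then have "(LINT x:\<omega>p|\<mu>. f x) - (LINT x:\<omega>m|\<mu>. f x) = (LINT x|\<mu>. indicator \<omega>p x * f x - indicator \<omega>m x * f x)"
      by (simp add: set_lebesgue_integral_def set_integrable_def)
    also have "\<dots> = (LINT x|\<mu>. m * V1 x)" using m by (simp add: V1_def)
    also have "\<dots> = m" using opt(2) by simp
    finally have "(LINT x:\<omega>p|\<mu>. f x) - (LINT x:\<omega>m|\<mu>. f x) = m" .
    then show ?thesis using m V1(1) opt(3,4) all by (auto elim: eventually_mono)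
  qed
  show ?thesis
    unfolding Let_def
    by (rule exI[of _ u1], intro conjI allI impI)
       (use min Linf rest in \<open>simp_all add: M V1_def \<omega>p_def \<omega>m_def\<close>)
qed

end
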